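(* Let $R>0$. (i) Let $g\in C(\partial B_R)$. Then there exists $\widetilde u\in C(\overline B_R)\cap C^\infty(B_R)$ which is a (unique) solution to the Dirichlet problem $\Delta \widetilde u=0$ in $B_R$, $\widetilde u=g$ on $\partial B_R$. Moreover, for each $r\in[0,R)$, $(x,y)\in\overline B_r$ and $\alpha_1,\alpha_2\in\mathbb N\cup\{0\}$, $$|D^{(\alpha_1,\alpha_2)}\widetilde u(x,y)|\le D^{(\alpha_1,\alpha_2)}\left(\frac{-1}{2\pi R}\int_{\partial B_R}|g|\,ds\right)+\frac{(\alpha_1+\alpha_2)!}{\pi(R-r)^{\alpha_1+\alpha_2+1}}\int_{\partial B_R}|g|\,ds .$$ (ii) The function $\widetilde u$ in (i) is analytic in $B_R$. In particular, for each $\mathbf x_0=(x_0,y_0)\in B_R$, with $L:=R-\|\mathbf x_0\|$, each $\kappa\in(0,\tfrac13)$ and each $\mathbf h=(h_1,h_2)\in\mathbb R^2$ with $\|\mathbf h\|\in[0,\kappa L)$, $$\widetilde u(\mathbf x_0+\mathbf h)=\sum_{k=0}^\infty\left(\sum_{\alpha_1+\alpha_2=k}\frac{D^{(\alpha_1,\alpha_2)}\widetilde u(\mathbf x_0)}{\alpha_1!\,\alpha_2!}h_1^{\alpha_1}h_2^{\alpha_2}\right),$$ and, for every integer $n\ge1$, $$\left|\widetilde u(\mathbf x_0+\mathbf h)-\sum_{k=0}^{n-1}\left(\sum_{\alpha_1+\alpha_2=k}\frac{D^{(\alpha_1,\alpha_2)}\widetilde u(\mathbf x_0)}{\alpha_1!\,\alpha_2!}h_1^{\alpha_1}h_2^{\alpha_2}\right)\right|\le\left(\frac{2\kappa}{1-\kappa}\right)^n\frac{1}{\pi(L-\kappa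 L)}\int_{\partial B_L(\mathbf x_0)}|\widetilde u|\,ds .$$ (iii) Assume that $g\in C^\alpha(\partial B_R)$ for some $\alpha\in(0,1]$, let $\widetilde u$ be the corresponding solution from (i), and let $f(\theta):=g(R\cos\theta,R\sin\theta)$, $\theta\in[-\pi,\pi]$. (Then $f\in C^\alpha([-\pi,\pi])$ with $[f]_{C^\alpha([-\pi,\pi])}\le R^\alpha[g]_{C^\alpha(\partial B_R)}$.) For each integer $n\ge1$ let $\widetilde u_n$ be the polynomial $$\widetilde u_n(x,y):=\frac{c_0}{2}+\sum_{k=1}^n\left(c_k\sum_{\substack{0\le j\le k\\ j\text{ even}}}(-1)^{\frac j2}\binom kj x^{k-j}y^j+d_k\sum_{\substack{0\le j\le k\\ j\text{ odd}}}(-1)^{\frac{j-1}2}\binom kj x^{k-j}y^j\right),\quad (x,y)\in\mathbb R^2,$$ where, for $k\ge0$, $$c_k:=\frac1{R^k\pi}\int_{-\pi}^\pi f(\theta)\cos k\theta\,d\theta,\qquad d_k:=\frac1{R^k\pi}\int_{-\pi}^\pi f(\theta)\sin k\theta\,d\theta .$$ Then $\widetilde u_n$ converges to $\widetilde u$ uniformly on $\overline B_R$ as $n\to\infty$. In particular, for each integer $n\ge e^{1/\alpha}$, $$|\widetilde u(x,y)-\widetilde u_n(x,y)|\le 2\gamma_0(2\pi)^\alpha[f]_{C^\alpha([-\pi,\pi])}\left(\frac{\sqrt{x^2+y^2}}{R}\right)^{n+1}(\ln n)\left(\frac1n\right)^\alpha\quad\text{for all }(x,y)\in\overline B_R .$$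 (iv) Let $\alpha$, $g$, $f$, $\widetilde u$ and $(\widetilde u_n)_{n\ge1}$ be as in (iii), and assume that $f\in C^{k,\alpha}([-\pi,\pi])$ for some $k\in\mathbb N$. Then, for each integer $n\ge e$, $$|\widetilde u(x,y)-\widetilde u_n(x,y)|\le 2\gamma_k(2\pi)^\alpha[f^{(k)}]_{C^\alpha([-\pi,\pi])}\left(\frac{\sqrt{x^2+y^2}}{R}\right)^{n+1}(\ln n)\left(\frac1n\right)^{k+\alpha}\quad\text{for all }(x,y)\in\overline B_R .$$
   Context: Notation: $\|\cdot\|$ is the Euclidean norm on $\mathbb R^2$; $B_R(\mathbf x_0)$, $\overline B_R(\mathbf x_0)$, $\partial B_R(\mathbf x_0)$ are the open disk, closed disk and circle of radius $R$ centered at $\mathbf x_0$; $B_R=B_R(\mathbf 0)$, etc., and $\overline B_0:=\{\mathbf 0\}$. $ds$ is arc length. $\Delta=\partial_x^2+\partial_y^2$ and $D^{(\alpha_1,\alpha_2)}=\partial_x^{\alpha_1}\partial_y^{\alpha_2}$. A solution of the Dirichlet problem means a function in $C^2(B_R)\cap C(\overline B_R)$ satisfying the equation and boundary condition pointwise. In the expression $D^{(\alpha_1,\alpha_2)}\big(\frac{-1}{2\pi R}\int_{\partial B_R}|g|\,ds\big)$ the operator acts on a constant function of $(x,y)$; thus it equals $\frac{-1}{2\pi R}\int_{\partial B_R}|g|\,ds$ if $\alpha_1=\alpha_2=0$ and $0$ otherwise. For $\alpha\in(0,1]$ and $K$ a compact set ($K=\partial B_R$ or $K=[-\pi,\pi]$),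 $C^\alpha(K)$ is the set of continuous functions $w$ on $K$ with $[w]_{C^\alpha(K)}:=\sup_{p\ne q\in K}\frac{|w(p)-w(q)|}{\|p-q\|^\alpha}<\infty$. For $k\in\mathbb N=\{1,2,\dots\}$, $C^k([-\pi,\pi])$ is the set of functions that are $k$ times continuously differentiable on $(-\pi,\pi)$ and whose derivatives of order $0,\dots,k$ are uniformly continuous on $(-\pi,\pi)$ (the function and these derivatives being extended continuously to $[-\pi,\pi]$), and $C^{k,\alpha}([-\pi,\pi])$ is the set of $w\in C^k([-\pi,\pi])$ with $w^{(k)}\in C^\alpha([-\pi,\pi])$. Constants $\gamma_0,\gamma_k$: for a $2\pi$-periodic function $\phi$ that is continuous on $[-\pi,\pi]$ let $S_n(\phi)(\theta)=\frac{\tilde c_0}2+\sum_{k=1}^n(\tilde c_k\cos k\theta+\tilde d_k\sin k\theta)$ with $\tilde c_k=\frac1\pi\int_{-\pi}^\pi\phi(\theta)\cos k\theta\,d\theta$, $\tilde d_k=\frac1\pi\int_{-\pi}^\pi\phi(\theta)\sin k\theta\,d\theta$, and for a function $\psi$ on $[-\pi,\pi]$ let $\omega_\psi(\delta)=\sup\{|\psi(\theta_1)-\psi(\theta_2)|:\theta_1,\theta_2\in[-\pi,\pi],\ |\theta_1-\theta_2|\le\delta\}$. The constants are those of the following two results, quoted from D. Jackson. First, $\gamma_0>0$ is a universal constant such that $|\phi(\theta)-S_n(\phi)(\theta)|\le\gamma_0\ln n\cdot\omega_\phi(2\pi/n)$ for all $2\pi$-periodic $\phi\in C([-\pi,\pi])$,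 all $\theta\in[-\pi,\pi]$ and all integers $n\ge2$. Second, for $k\in\mathbb N$, $\gamma_k$ is a constant depending on $k$ such that $|\phi(\theta)-S_n(\phi)(\theta)|\le\frac{\gamma_k}{n^k}\ln n\cdot\omega_{\phi^{(k)}}(2\pi/n)$ for all $2\pi$-periodic $\phi\in C^k([-\pi,\pi])$, all $\theta\in[-\pi,\pi]$ and all integers $n\ge2$.
   Formalization: In (iv), no constant γ_k exists for periodic φ in C^k([-π,π]) as defined (e.g. φ=θ²). The literal (iv) is thus vacuous; it is also proved with f C^k as a 2π-periodic function on the whole line and γ_k Jackson's constant for such functions. *)

theory Defs
  imports "HOL-Analysis.Analysis"
begin

text \<open>
  The plane is \<^typ>\<open>real \<times> real\<close>; its norm in the library is the Euclidean one, so
  \<^const>\<open>ball\<close>, \<^const>\<open>cball\<close> and \<^const>\<open>sphere\<close> are the open disk, the closed disk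
  and the circle.
\<close>

definition pdx :: "(real \<times> real \<Rightarrow> real) \<Rightarrow> real \<times> real \<Rightarrow> real"
  where "pdx w p = deriv (\<lambda>t. w (t, snd p)) (fst p)"

definition pdy :: "(real \<times> real \<Rightarrow> real) \<Rightarrow> real \<times> real \<Rightarrow> real"
  where "pdy w p = deriv (\<lambda>t. w (fst p, t)) (snd p)"

definition Dpart :: "nat \<Rightarrow> nat \<Rightarrow> (real \<times> real \<Rightarrow> real) \<Rightarrow> real \<times> real \<Rightarrow> real"
  where "Dpart a1 a2 w = (pdx ^^ a1) ((pdy ^^ a2) w)"

definition laplacian :: "(real \<times> real \<Rightarrow> real) \<Rightarrow> real \<times> real \<Rightarrow> real"
  where "laplacian w p = Dpart 2 0 w p + Dpart 0 2 w p"

text \<open>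
  \<open>Ck_plane k S w\<close>, for open \<open>S\<close>: all iterated partial derivatives of \<open>w\<close> of order at most
  \<open>k\<close>, in any order of differentiation, exist and are continuous on \<open>S\<close>.  The differentiability
  clauses are needed because \<^const>\<open>deriv\<close> is total.
\<close>

primrec Ck_plane :: "nat \<Rightarrow> (real \<times> real) set \<Rightarrow> (real \<times> real \<Rightarrow> real) \<Rightarrow> bool" where
  "Ck_plane 0 S w \<longleftrightarrow> continuous_on S w"
| "Ck_plane (Suc k) S w \<longleftrightarrow>
     continuous_on S w \<and>
     (\<forall>p\<in>S. (\<lambda>t. w (t, snd p)) field_differentiable at (fst p) \<and>
            (\<lambda>t. w (fst p, t)) field_differentiable at (snd p)) \<and>
     Ck_plane k S (pdx w) \<and> Ck_plane k S (pdy w)"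

definition Cinf_plane :: "(real \<times> real) set \<Rightarrow> (real \<times> real \<Rightarrow> real) \<Rightarrow> bool"
  where "Cinf_plane S w \<longleftrightarrow> (\<forall>k. Ck_plane k S w)"

text \<open>
  Real analyticity on an open set: near every point, \<open>w\<close> is the sum of an (unconditionally,
  hence absolutely) convergent double power series.
\<close>

definition analytic_plane :: "(real \<times> real) set \<Rightarrow> (real \<times> real \<Rightarrow> real) \<Rightarrow> bool"
  where "analytic_plane S w \<longleftrightarrow>
    (\<forall>p\<in>S. \<exists>(a :: nat \<Rightarrow> nat \<Rightarrow> real). \<exists>\<delta>>0. \<forall>h. norm h < \<delta> \<longrightarrow>
       ((\<lambda>(i, j). a i j * fst h ^ i * snd h ^ j) has_sum w (p + h)) UNIV)"

definition taylor_term :: "(real \<times> real \<Rightarrow> real) \<Rightarrow> real \<times> real \<Rightarrow> real \<times> real \<Rightarrow> nat \<Rightarrow> real"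
  where "taylor_term w p h k =
    (\<Sum>(a1, a2) \<in> {(a1, a2). a1 + a2 = k}.
       Dpart a1 a2 w p / (fact a1 * fact a2) * fst h ^ a1 * snd h ^ a2)"

definition dirichlet_solution ::
    "real \<Rightarrow> (real \<times> real \<Rightarrow> real) \<Rightarrow> (real \<times> real \<Rightarrow> real) \<Rightarrow> bool"
  where "dirichlet_solution R g u \<longleftrightarrow>
    Ck_plane 2 (ball 0 R) u \<and> continuous_on (cball 0 R) u \<and>
    (\<forall>p\<in>ball 0 R. laplacian u p = 0) \<and> (\<forall>p\<in>sphere 0 R. u p = g p)"

text \<open>
  The arc length integral over the circle of radius \<open>\<rho>\<close> about \<open>p\<close>, written in the standard
  parametrization, for which \<open>ds = \<rho> d\<theta>\<close>.
\<close>

definition circle_integral :: "real \<times> real \<Rightarrow> real \<Rightarrow> (real \<times> real \<Rightarrow> real) \<Rightarrow> real"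
  where "circle_integral p \<rho> w =
    integral {-pi..pi} (\<lambda>\<theta>. w (p + (\<rho> * cos \<theta>, \<rho> * sin \<theta>)) * \<rho>)"

definition bdry_fun :: "real \<Rightarrow> (real \<times> real \<Rightarrow> real) \<Rightarrow> real \<Rightarrow> real"
  where "bdry_fun R g \<theta> = g (R * cos \<theta>, R * sin \<theta>)"

definition coef_c :: "real \<Rightarrow> (real \<Rightarrow> real) \<Rightarrow> nat \<Rightarrow> real"
  where "coef_c R f k = 1 / (R ^ k * pi) * integral {-pi..pi} (\<lambda>\<theta>. f \<theta> * cos (real k * \<theta>))"

definition coef_d :: "real \<Rightarrow> (real \<Rightarrow> real) \<Rightarrow> nat \<Rightarrow> real"
  where "coef_d R f k = 1 / (R ^ k * pi) * integral {-pi..pi} (\<lambda>\<theta>. f \<theta> * sin (real k * \<theta>))"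

definition approx_poly :: "real \<Rightarrow> (real \<Rightarrow> real) \<Rightarrow> nat \<Rightarrow> real \<times> real \<Rightarrow> real"
  where "approx_poly R f n = (\<lambda>(x, y).
    coef_c R f 0 / 2 +
    (\<Sum>k=1..n.
       coef_c R f k * (\<Sum>j | j \<le> k \<and> even j.
          (-1) ^ (j div 2) * real (k choose j) * x ^ (k - j) * y ^ j) +
       coef_d R f k * (\<Sum>j | j \<le> k \<and> odd j.
          (-1) ^ ((j - 1) div 2) * real (k choose j) * x ^ (k - j) * y ^ j)))"

definition holder_on :: "real \<Rightarrow> 'a::real_normed_vector set \<Rightarrow> ('a \<Rightarrow> real) \<Rightarrow> bool"
  where "holder_on \<alpha> K w \<longleftrightarrow>
    continuous_on K w \<and>
    bdd_above {\<bar>w p - w q\<bar> / norm (p - q) powr \<alpha> | p q. p \<in> K \<and> q \<in> K \<and> p \<noteq> q}"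

definition holder_seminorm :: "real \<Rightarrow> 'a::real_normed_vector set \<Rightarrow> ('a \<Rightarrow> real) \<Rightarrow> real"
  where "holder_seminorm \<alpha> K w =
    Sup {\<bar>w p - w q\<bar> / norm (p - q) powr \<alpha> | p q. p \<in> K \<and> q \<in> K \<and> p \<noteq> q}"

text \<open>
  \<open>Ck_interval k\<close> is \<open>C\<^sup>k([-\<pi>, \<pi>])\<close>: derivatives are taken on the open interval only, and
  \<open>ext_deriv k w\<close> is the derivative of order \<open>k\<close> extended by its one-sided limits at \<open>\<plusminus>\<pi>\<close>.
\<close>

definition Ck_interval :: "nat \<Rightarrow> (real \<Rightarrow> real) set"
  where "Ck_interval k = {w.
    continuous_on {-pi..pi} w \<and>
    (\<forall>j<k. \<forall>\<theta>\<in>{-pi<..<pi}. (deriv ^^ j) w field_differentiable at \<theta>) \<and>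
    (\<forall>j\<le>k. uniformly_continuous_on {-pi<..<pi} ((deriv ^^ j) w))}"

definition ext_deriv :: "nat \<Rightarrow> (real \<Rightarrow> real) \<Rightarrow> real \<Rightarrow> real"
  where "ext_deriv k w \<theta> =
    (if \<theta> \<in> {-pi<..<pi} then (deriv ^^ k) w \<theta>
     else Lim (at \<theta> within {-pi<..<pi}) ((deriv ^^ k) w))"

definition Ck_line :: "nat \<Rightarrow> (real \<Rightarrow> real) set"
  where "Ck_line k = {w.
    (\<forall>j<k. \<forall>\<theta>. (deriv ^^ j) w field_differentiable at \<theta>) \<and>
    continuous_on UNIV ((deriv ^^ k) w)}"

definition fourier_sum :: "(real \<Rightarrow> real) \<Rightarrow> nat \<Rightarrow> real \<Rightarrow> real"
  where "fourier_sum \<phi> n \<theta> =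
    (1 / pi * integral {-pi..pi} (\<lambda>t. \<phi> t * cos (real 0 * t))) / 2 +
    (\<Sum>k=1..n.
       (1 / pi * integral {-pi..pi} (\<lambda>t. \<phi> t * cos (real k * t))) * cos (real k * \<theta>) +
       (1 / pi * integral {-pi..pi} (\<lambda>t. \<phi> t * sin (real k * t))) * sin (real k * \<theta>))"

definition modulus_cont :: "(real \<Rightarrow> real) \<Rightarrow> real \<Rightarrow> real"
  where "modulus_cont \<psi> \<delta> =
    Sup {\<bar>\<psi> \<theta>1 - \<psi> \<theta>2\<bar> | \<theta>1 \<theta>2. \<theta>1 \<in> {-pi..pi} \<and> \<theta>2 \<in> {-pi..pi} \<and> \<bar>\<theta>1 - \<theta>2\<bar> \<le> \<delta>}"

definition two_pi_periodic :: "(real \<Rightarrow> real) \<Rightarrow> bool"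
  where "two_pi_periodic \<phi> \<longleftrightarrow> (\<forall>\<theta>. \<phi> (\<theta> + 2 * pi) = \<phi> \<theta>)"

definition jackson_const_0 :: "real \<Rightarrow> bool"
  where "jackson_const_0 \<gamma> \<longleftrightarrow> \<gamma> > 0 \<and>
    (\<forall>\<phi>. two_pi_periodic \<phi> \<and> continuous_on {-pi..pi} \<phi> \<longrightarrow>
      (\<forall>\<theta>\<in>{-pi..pi}. \<forall>n\<ge>2.
         \<bar>\<phi> \<theta> - fourier_sum \<phi> n \<theta>\<bar> \<le> \<gamma> * ln (real n) * modulus_cont \<phi> (2 * pi / real n)))"

text \<open>
  The function class \<open>\<F>\<close> is a parameter because two readings of ``\<open>2\<pi>\<close>-periodic of class
  \<open>C\<^sup>k\<close>'' matter.  For \<open>\<F> = Ck_interval k\<close> the derivatives of \<open>\<phi>\<close> need not agree at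
  \<open>-\<pi>\<close> and \<open>\<pi>\<close>, and then no constant exists: the periodic extension of \<open>\<theta>\<^sup>2\<close> has
  \<open>\<phi>(\<pi>) - S\<^sub>n(\<phi>)(\<pi>)\<close> of order \<open>1/n\<close>, whereas the right-hand side for \<open>k = 1\<close> is of order
  \<open>ln n / n\<^sup>2\<close>.  For \<open>\<F> = Ck_line k\<close> this is Jackson's theorem.
\<close>

definition jackson_const :: "(real \<Rightarrow> real) set \<Rightarrow> nat \<Rightarrow> real \<Rightarrow> bool"
  where "jackson_const \<F> k \<gamma> \<longleftrightarrow>
    (\<forall>\<phi>\<in>\<F>. two_pi_periodic \<phi> \<longrightarrow>
      (\<forall>\<theta>\<in>{-pi..pi}. \<forall>n\<ge>2.
         \<bar>\<phi> \<theta> - fourier_sum \<phi> n \<theta>\<bar>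
           \<le> \<gamma> / real n ^ k * ln (real n) * modulus_cont (ext_deriv k \<phi>) (2 * pi / real n)))"

end

theory Submission
  imports Defs "HOL-Complex_Analysis.Complex_Analysis"
begin

text \<open>
  The solution is the real part of the Schwarz integral \<open>F\<close> of the boundary data, which is holomorphic.  The
  derivative bounds come from differentiating under the integral sign; uniqueness and all comparisons
  come from the weak maximum principle.  By uniqueness \<open>u\<close> is the Poisson integral of its own values
  on any circle inside the disc, even one that touches the boundary, so that \<open>k\<close>-th Taylor
  terms are bounded by \<open>\<kappa>\<^sup>k\<close> and the remainder is a geometric tail.

  On the boundary circle \<open>u - u\<^sub>n\<close> is the error of the \<open>n\<close>-th Fourier sum, and \<open>u - u\<^sub>n\<close> is the real part of
  \<open>z\<^bsup>n+1\<^esup> H(z)\<close>.  A Schwarz-type lemma turns a bound \<open>M\<close> on the circle into \<open>2M(\<bar>z\<bar>/R)\<^bsup>n+1\<^esup>\<close> inside, and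
  the rates follow by inserting Jackson's bounds for \<open>M\<close>.  Uniform convergence must not rely on the existence of
  Jackson's constant; it is obtained from the Dirichlet kernel by a uniform Riemann--Lebesgue argument.
\<close>

section \<open>The Schwarz integral\<close>

text \<open>Estimates up to the boundary are made for real-valued functions only, and the decay
  factor is gained with a multiplier that is real on a circle; this is the origin of the factor 2 in
  the error bounds.

  The other constants come from complex notation. The derivative of order \<open>(a, b)\<close> of
  the real part of \<open>F\<close> is the real part of \<open>\<i> ^ b\<close> times the derivative
  of \<open>F\<close> of order \<open>a + b\<close>. So one Cauchy-type estimate serves all
  derivatives of the same total order, and a homogeneous Taylor polynomial is the real part of a
  single complex term, with no loss from summing over \<open>\<alpha>1 + \<alpha>2 = k\<close>. The
  remainder comes out with \<open>\<kappa> ^ n\<close> and is weakened to the stated base at the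
  end. The negative summand at order zero is the constant subtracted in the Schwarz integral, which
  differentiation removes.\<close>

definition cauchy_mom :: "complex \<Rightarrow> real \<Rightarrow> (real \<Rightarrow> real) \<Rightarrow> nat \<Rightarrow> complex \<Rightarrow> complex" where
  "cauchy_mom c R \<phi> k w =
     integral {-pi..pi} (\<lambda>t. of_real (\<phi> t) * (of_real R * cis t) / (c + of_real R * cis t - w) ^ Suc k)"

text \<open>With z = c + R cis t one has dz = i R cis t dt, so \<open>cauchy_mom\<close> of order k
  is -i times the contour integral of \<phi> / (z - w)^(k+1). For a = z - c and b = w - c the
  combination here is the mean of \<phi> (a + b) / (a - b), the classical Schwarz kernel, split so
  that derivatives see only the moments.\<close>

definition schwarz :: "complex \<Rightarrow> real \<Rightarrow> (real \<Rightarrow> real) \<Rightarrow> complex \<Rightarrow> complex" where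
  "schwarz c R \<phi> w = cauchy_mom c R \<phi> 0 w / of_real pi - of_real (integral {-pi..pi} \<phi> / (2 * pi))"

text \<open>Normalised to have integral 2\<pi> over the angle; the factor 1 / (2\<pi>) is left to
  the formulas that use it.\<close>

definition poisson_ker :: "complex \<Rightarrow> real \<Rightarrow> complex \<Rightarrow> real \<Rightarrow> real" where
  "poisson_ker c R w t = (R\<^sup>2 - (dist c w)\<^sup>2) / (norm (c + of_real R * cis t - w))\<^sup>2"

lemma norm_circle_minus_ge:
  assumes "R > 0"
  shows "R - dist c w \<le> norm (c + of_real R * cis t - w)"
proof -
  have "R = norm (of_real R * cis t)" using assms by (simp add: norm_mult)
  also have "\<dots> \<le> norm (c + of_real R * cis t - w) + norm (w - c)"
    using norm_triangle_ineq[of "c + of_real R * cis t - w" "w - c"] by simp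
  finally show ?thesis by (simp add: dist_norm norm_minus_commute)
qed

lemma circle_minus_neq_0:
  assumes "w \<in> ball c R"
  shows "c + of_real R * cis t - w \<noteq> 0"
proof
  assume a: "c + of_real R * cis t - w = 0"
  have "R > 0" using assms by (metis mem_ball dist_not_less_zero order.strict_trans1 not_le)
  then show False using norm_circle_minus_ge[of R c w t] a assms by simp
qed

lemma continuous_on_cauchy_mom_kernel:
  assumes "continuous_on {-pi..pi} \<phi>"
  shows "continuous_on (ball c R \<times> cbox (-pi) pi)
     (\<lambda>(w, t). of_real (\<phi> t) * (of_real R * cis t) / (c + of_real R * cis t - w) ^ k)"
proof -
  have "continuous_on (ball c R \<times> cbox (-pi) pi) (\<lambda>x. \<phi> (snd x))"
    by (rule continuous_on_compose2[OF assms]) (auto intro!: continuous_intros)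
  then show ?thesis
    unfolding split_beta
    by (intro continuous_intros) (use circle_minus_neq_0 in auto)
qed

lemma continuous_on_cauchy_mom_kernel':
  assumes "continuous_on {-pi..pi} \<phi>" "w \<in> ball c R"
  shows "continuous_on {-pi..pi} (\<lambda>t. of_real (\<phi> t) * (of_real R * cis t) / (c + of_real R * cis t - w) ^ k)"
  using assms circle_minus_neq_0[OF assms(2)]
  by (intro continuous_intros) auto

lemma has_field_derivative_divide_power:
  fixes A b x :: "'a::real_normed_field"
  assumes "b - x \<noteq> 0"
  shows "((\<lambda>x. A / (b - x) ^ Suc k) has_field_derivative of_nat (Suc k) * (A / (b - x) ^ Suc (Suc k))) (at x)"
proof -
  have eq: "(0 * D ^ Suc k - A * (m * ((0 - 1) * D ^ k))) / (D ^ Suc k * D ^ Suc k) = m * (A / D ^ Suc (Suc k))"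
    if "D \<noteq> 0" for D m :: 'a using that by (simp add: field_simps)
  have "((\<lambda>x. b - x) has_field_derivative (0 - 1)) (at x)"
    by (intro DERIV_diff DERIV_const DERIV_ident)
  from DERIV_divide[OF DERIV_const[of A] DERIV_power_Suc[OF this, of k]]
  have "((\<lambda>x. A / (b - x) ^ Suc k) has_field_derivative
      (0 * (b - x) ^ Suc k - A * ((1 + of_nat k) * ((0 - 1) * (b - x) ^ k))) / ((b - x) ^ Suc k * (b - x) ^ Suc k)) (at x)"
    using assms by simp
  then show ?thesis unfolding eq[OF assms] by simp
qed

text \<open>The Leibniz rule applies on the whole open disc: the denominator vanishes only for
  \<open>w\<close> on the circle, so the kernel of the next order is jointly continuous. Closure of
  the family under differentiation is why the exponent is a parameter.\<close>

lemma has_field_derivative_cauchy_mom: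
  assumes "continuous_on {-pi..pi} \<phi>" "w \<in> ball c R"
  shows "(cauchy_mom c R \<phi> k has_field_derivative of_nat (Suc k) * cauchy_mom c R \<phi> (Suc k) w) (at w)"
proof -
  define K where "K = (\<lambda>k w t. of_real (\<phi> t) * (of_real R * cis t) / (c + of_real R * cis t - w) ^ Suc k)"
  have "((\<lambda>w. integral (cbox (-pi) pi) (K k w)) has_field_derivative
          integral (cbox (-pi) pi) (\<lambda>t. of_nat (Suc k) * K (Suc k) w t)) (at w within ball c R)"
  proof (rule leibniz_rule_field_derivative)
    fix x t assume x: "x \<in> ball c R"
    note nz = circle_minus_neq_0[OF x, of t]
    have "((\<lambda>x. K k x t) has_field_derivative of_nat (Suc k) * K (Suc k) x t) (at x)"
      unfolding K_def by (rule has_field_derivative_divide_power[OF nz])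
    then show "((\<lambda>x. K k x t) has_field_derivative of_nat (Suc k) * K (Suc k) x t) (at x within ball c R)"
      by (rule has_field_derivative_at_within)
  next
    fix x assume x: "x \<in> ball c R"
    show "K k x integrable_on cbox (- pi) pi"
      unfolding K_def cbox_interval
      by (rule integrable_continuous_interval[OF continuous_on_cauchy_mom_kernel'[OF assms(1) x]])
  next
    have "continuous_on (ball c R \<times> cbox (- pi) pi) (\<lambda>x. of_nat (Suc k) * (\<lambda>(w, t). K (Suc k) w t) x)"
      unfolding K_def by (intro continuous_intros continuous_on_cauchy_mom_kernel[OF assms(1)])
    then show "continuous_on (ball c R \<times> cbox (- pi) pi) (\<lambda>(x, t). of_nat (Suc k) * K (Suc k) x t)"
      by (simp add: split_beta)
  qed (use assms in auto)
  moreover have "at w within ball c R = at w" by (rule at_within_open[OF assms(2) open_ball])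
  ultimately show ?thesis
    unfolding cauchy_mom_def[abs_def] K_def cbox_interval integral_mult_right by (simp only:)
qed

lemma holomorphic_schwarz:
  assumes "continuous_on {-pi..pi} \<phi>"
  shows "schwarz c R \<phi> holomorphic_on ball c R"
  unfolding schwarz_def[abs_def]
proof (intro holomorphic_intros)
  show "cauchy_mom c R \<phi> 0 holomorphic_on ball c R"
    unfolding holomorphic_on_open[OF open_ball]
    using has_field_derivative_cauchy_mom[OF assms, of _ c R 0] by blast
qed auto

text \<open>Order zero is excluded because there the subtracted mean survives; hence the separate
  case in \<open>Dpart_dirichlet_fun_le\<close>.\<close>

lemma higher_deriv_schwarz:
  assumes "continuous_on {-pi..pi} \<phi>" "w \<in> ball c R" "k > 0"
  shows "(deriv ^^ k) (schwarz c R \<phi>) w = fact k * cauchy_mom c R \<phi> k w / of_real pi"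
  using assms(3,2)
proof (induction k arbitrary: w rule: nat_induct_non_zero)
  case 1
  have "(schwarz c R \<phi> has_field_derivative (of_nat (Suc 0) * cauchy_mom c R \<phi> (Suc 0) w) / of_real pi - 0) (at w)"
    unfolding schwarz_def[abs_def]
    by (rule DERIV_diff[OF DERIV_cdivide[OF has_field_derivative_cauchy_mom[OF assms(1) 1]] DERIV_const])
  then show ?case by (simp add: DERIV_imp_deriv)
next
  case (Suc k)
  have ev: "\<forall>\<^sub>F v in nhds w. (deriv ^^ k) (schwarz c R \<phi>) v = fact k * cauchy_mom c R \<phi> k v / of_real pi"
    by (rule eventually_mono[OF eventually_nhds_in_open[OF open_ball Suc.prems]]) (rule Suc.IH)
  have "((\<lambda>v. fact k * cauchy_mom c R \<phi> k v / of_real pi) has_field_derivative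
           fact k * (of_nat (Suc k) * cauchy_mom c R \<phi> (Suc k) w) / of_real pi) (at w)"
    by (rule DERIV_cdivide[OF DERIV_cmult[OF has_field_derivative_cauchy_mom[OF assms(1) Suc.prems]]])
  then show ?case
    using deriv_cong_ev[OF ev refl] by (simp add: DERIV_imp_deriv algebra_simps)
qed

text \<open>The numerator \<open>R\<close> is the arc length factor; the denominator is a power of a
  lower bound for the distance from \<open>w\<close> to points of the circle.\<close>

lemma norm_cauchy_mom_le:
  assumes "continuous_on {-pi..pi} \<phi>" "w \<in> ball c R"
  shows "norm (cauchy_mom c R \<phi> k w) \<le> R / (R - dist c w) ^ Suc k * integral {-pi..pi} (\<lambda>t. \<bar>\<phi> t\<bar>)"
proof -
  have R: "R > dist c w" "R > 0" using assms(2) by (auto intro: le_less_trans[OF zero_le_dist])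
  have "norm (cauchy_mom c R \<phi> k w) \<le> integral {-pi..pi} (\<lambda>t. R / (R - dist c w) ^ Suc k * \<bar>\<phi> t\<bar>)"
    unfolding cauchy_mom_def
  proof (rule integral_norm_bound_integral)
    show "(\<lambda>t. of_real (\<phi> t) * (of_real R * cis t) / (c + of_real R * cis t - w) ^ Suc k) integrable_on {-pi..pi}"
      by (intro integrable_continuous_interval continuous_on_cauchy_mom_kernel'[OF assms])
    show "(\<lambda>t. R / (R - dist c w) ^ Suc k * \<bar>\<phi> t\<bar>) integrable_on {-pi..pi}"
      by (intro integrable_continuous_interval continuous_intros assms)
    fix t assume "t \<in> {-pi..pi}"
    have "(R - dist c w) ^ Suc k \<le> norm (c + of_real R * cis t - w) ^ Suc k"
      by (intro power_mono norm_circle_minus_ge) (use R in auto)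
    moreover have "(R - dist c w) ^ Suc k > 0" using R by simp
    ultimately have "\<bar>\<phi> t\<bar> * R / norm (c + of_real R * cis t - w) ^ Suc k \<le> \<bar>\<phi> t\<bar> * R / (R - dist c w) ^ Suc k"
      using R by (intro frac_le mult_nonneg_nonneg) auto
    then show "norm (of_real (\<phi> t) * (of_real R * cis t) / (c + of_real R * cis t - w) ^ Suc k)
        \<le> R / (R - dist c w) ^ Suc k * \<bar>\<phi> t\<bar>"
      using R by (simp add: norm_mult norm_divide norm_power mult.commute)
  qed
  then show ?thesis by simp
qed

section \<open>The Poisson kernel: total mass, positivity and boundary values\<close>

lemma has_integral_cis_multiple:
  assumes "n \<noteq> 0"
  shows "((\<lambda>t. cis (of_int n * t)) has_integral 0) {-pi..pi}"
proof -
  have "((\<lambda>t. cis (of_int n * t)) has_integral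
        (cis (of_int n * pi) / (\<i> * of_int n) - cis (of_int n * (-pi)) / (\<i> * of_int n))) {-pi..pi}"
  proof (rule fundamental_theorem_of_calculus)
    fix x :: real
    have "((\<lambda>t. cis (of_int n * t) / (\<i> * of_int n)) has_vector_derivative
            of_real (of_int n) * (\<i> * cis (of_int n * x)) / (\<i> * of_int n)) (at x within {-pi..pi})"
      unfolding cis_conv_exp using assms
      by (auto intro!: derivative_eq_intros has_vector_derivative_real_field
          simp: scaleR_conv_of_real) (simp add: complex_eq_iff)
    then show "((\<lambda>t. cis (of_int n * t) / (\<i> * of_int n)) has_vector_derivative cis (of_int n * x))
        (at x within {-pi..pi})"
      using assms by (simp add: field_simps)
  qed auto
  moreover have "cis (of_int n * pi) = cis (of_int n * (-pi))"
    using sin_npi_int[of n] by (simp add: complex_eq_iff mult.commute)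
  ultimately show ?thesis by simp
qed

text \<open>All Taylor coefficients of positive order vanish at the centre.\<close>
lemma cauchy_mom_one:
  assumes "w \<in> ball c R"
  shows "cauchy_mom c R (\<lambda>_. 1) 0 w = 2 * of_real pi"
proof -
  have R: "R > 0" using assms by (auto intro: le_less_trans[OF zero_le_dist])
  have c1: "continuous_on {-pi..pi} (\<lambda>_::real. 1::real)" by simp
  have hol: "schwarz c R (\<lambda>_. 1) holomorphic_on ball c R" by (rule holomorphic_schwarz[OF c1])
  have cm: "cauchy_mom c R (\<lambda>_. 1) k c = (if k = 0 then 2 * of_real pi else 0)" for k
  proof -
    have "cauchy_mom c R (\<lambda>_. 1) k c = integral {-pi..pi} (\<lambda>t. (1 / of_real R ^ k) * cis (of_int (- int k) * t))"
      unfolding cauchy_mom_def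
    proof (rule integral_cong)
      fix t :: real
      define z where "z = of_real R * cis t"
      have "z \<noteq> 0" using R by (simp add: z_def)
      then have "of_real 1 * z / (c + z - c) ^ Suc k = inverse (z ^ k)" by (simp add: field_simps)
      also have "z ^ k = of_real R ^ k * cis (real k * t)" by (simp add: z_def power_mult_distrib Complex.DeMoivre)
      also have "inverse \<dots> = (1 / of_real R ^ k) * cis (of_int (- int k) * t)"
        by (simp add: cis_inverse inverse_mult_distrib divide_inverse)
      finally show "of_real 1 * (of_real R * cis t) / (c + of_real R * cis t - c) ^ Suc k
          = (1 / of_real R ^ k) * cis (of_int (- int k) * t)" by (simp only: z_def)
    qed
    also have "\<dots> = (1 / of_real R ^ k) * integral {-pi..pi} (\<lambda>t. cis (of_int (- int k) * t))"
      by simp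
    finally show ?thesis
      using has_integral_cis_multiple[of "- int k"] by (auto simp: integral_unique scaleR_conv_of_real)
  qed
  have "(\<lambda>n. (deriv ^^ n) (schwarz c R (\<lambda>_. 1)) c / fact n * (w - c) ^ n) sums schwarz c R (\<lambda>_. 1) w"
    using holomorphic_power_series[OF hol assms] .
  moreover have "(deriv ^^ n) (schwarz c R (\<lambda>_. 1)) c / fact n * (w - c) ^ n = (if n = 0 then schwarz c R (\<lambda>_. 1) c else 0)" for n
  proof (cases "n = 0")
    case False
    then have "(deriv ^^ n) (schwarz c R (\<lambda>_. 1)) c = 0"
      using higher_deriv_schwarz[OF c1, of c c R n] R cm[of n] by simp
    then show ?thesis using False by simp
  qed simp
  ultimately have "(\<lambda>n. if n = 0 then schwarz c R (\<lambda>_. 1) c else 0) sums schwarz c R (\<lambda>_. 1) w" by simp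
  moreover have "(\<lambda>n. if n = 0 then schwarz c R (\<lambda>_. 1) c else 0) sums schwarz c R (\<lambda>_. 1) c"
    by (rule sums_If_finite_set[of "{0}" "\<lambda>_. schwarz c R (\<lambda>_. 1) c", simplified])
  ultimately have "schwarz c R (\<lambda>_. 1) w = schwarz c R (\<lambda>_. 1) c" by (rule sums_unique2)
  then show ?thesis using cm[of 0] by (simp add: schwarz_def field_simps)
qed

text \<open>With a = R cis t and b = w - c this is |a|^2 - |b|^2 = 2 Re (a cnj (a - b)) - |a - b|^2,
  divided by |a - b|^2, where |a| = R.\<close>

lemma poisson_ker_eq:
  assumes "w \<in> ball c R"
  shows "poisson_ker c R w t = 2 * Re (of_real R * cis t / (c + of_real R * cis t - w)) - 1"
proof -
  define a where "a = of_real R * cis t"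
  define b where "b = w - c"
  have nz: "a - b \<noteq> 0" using circle_minus_neq_0[OF assms, of t] by (simp add: a_def b_def algebra_simps)
  have na: "norm a ^ 2 = R^2" by (simp add: a_def norm_mult)
  have "Re (a / (a - b)) = Re (a * cnj (a - b)) / norm (a - b) ^ 2"
    by (simp add: complex_div_cnj[of a] Re_divide_of_real cmod_power2)
  then have "2 * Re (a / (a - b)) - 1 = (2 * Re (a * cnj (a - b)) - norm (a - b) ^ 2) / norm (a - b) ^ 2"
    using nz by (simp add: field_simps)
  also have "2 * Re (a * cnj (a - b)) - norm (a - b) ^ 2 = norm a ^ 2 - norm b ^ 2"
    unfolding cmod_power2 by (simp add: power2_eq_square algebra_simps)
  finally show ?thesis
    by (simp add: poisson_ker_def na flip: a_def) (simp add: a_def b_def dist_norm norm_minus_commute algebra_simps)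
qed

lemma poisson_ker_nonneg:
  assumes "w \<in> ball c R"
  shows "poisson_ker c R w t \<ge> 0"
proof -
  have "(dist c w)\<^sup>2 \<le> R\<^sup>2" using assms by (intro power_mono) auto
  then show ?thesis by (simp add: poisson_ker_def)
qed

lemma Re_schwarz:
  assumes "continuous_on {-pi..pi} \<phi>" "w \<in> ball c R"
  shows "((\<lambda>t. \<phi> t * poisson_ker c R w t) has_integral (2 * pi * Re (schwarz c R \<phi> w))) {-pi..pi}"
proof -
  let ?k = "\<lambda>t. of_real (\<phi> t) * (of_real R * cis t) / (c + of_real R * cis t - w) ^ Suc 0"
  have "(?k has_integral cauchy_mom c R \<phi> 0 w) {-pi..pi}"
    unfolding cauchy_mom_def
    by (intro integrable_integral integrable_continuous_interval continuous_on_cauchy_mom_kernel'[OF assms])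
  from has_integral_Re[OF this]
  have "((\<lambda>t. 2 * Re (?k t) - \<phi> t) has_integral (2 * Re (cauchy_mom c R \<phi> 0 w) - integral {-pi..pi} \<phi>)) {-pi..pi}"
    by (intro has_integral_diff has_integral_mult_right integrable_integral integrable_continuous_interval assms)
  moreover have "2 * Re (?k t) - \<phi> t = \<phi> t * poisson_ker c R w t" for t
  proof -
    have "?k t = of_real (\<phi> t) * (of_real R * cis t / (c + of_real R * cis t - w))" by simp
    then have "Re (?k t) = \<phi> t * Re (of_real R * cis t / (c + of_real R * cis t - w))"
      by (simp only: Re_complex_of_real Im_complex_of_real times_complex.sel mult_zero_left diff_zero)
    then show ?thesis by (simp only: poisson_ker_eq[OF assms(2)]) (simp only: algebra_simps)
  qed
  moreover have "2 * Re (cauchy_mom c R \<phi> 0 w) - integral {-pi..pi} \<phi> = 2 * pi * Re (schwarz c R \<phi> w)"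
    by (simp add: schwarz_def field_simps)
  ultimately show ?thesis by simp
qed

lemma has_integral_poisson_ker:
  assumes "w \<in> ball c R"
  shows "(poisson_ker c R w has_integral 2 * pi) {-pi..pi}"
proof -
  have "schwarz c R (\<lambda>_. 1) w = 1" using cauchy_mom_one[OF assms] by (simp add: schwarz_def)
  then show ?thesis using Re_schwarz[of "\<lambda>_. 1" w c R] assms by simp
qed

text \<open>Since the kernel is nonnegative, an upper bound for it bounds its absolute value. This
  keeps the -1 of \<open>poisson_ker_eq\<close> with its favourable sign; estimating the two
  summands of \<open>schwarz\<close> separately would turn it into +1.\<close>

lemma abs_Re_schwarz_le:
  assumes "continuous_on {-pi..pi} \<phi>" "w \<in> ball c R"
  shows "\<bar>Re (schwarz c R \<phi> w)\<bar> \<le> (R / (pi * (R - dist c w)) - 1 / (2 * pi)) * integral {-pi..pi} (\<lambda>t. \<bar>\<phi> t\<bar>)"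
proof -
  have R: "R > dist c w" "R > 0" using assms(2) by (auto intro: le_less_trans[OF zero_le_dist])
  have "norm (2 * pi * Re (schwarz c R \<phi> w)) \<le> integral {-pi..pi} (\<lambda>t. (2 * R / (R - dist c w) - 1) * \<bar>\<phi> t\<bar>)"
    unfolding integral_unique[OF Re_schwarz[OF assms], symmetric]
  proof (rule integral_norm_bound_integral)
    show "(\<lambda>t. \<phi> t * poisson_ker c R w t) integrable_on {-pi..pi}" using Re_schwarz[OF assms] by blast
    show "(\<lambda>t. (2 * R / (R - dist c w) - 1) * \<bar>\<phi> t\<bar>) integrable_on {-pi..pi}"
      by (intro integrable_continuous_interval continuous_intros assms)
    fix t
    have "Re (of_real R * cis t / (c + of_real R * cis t - w)) \<le> norm (of_real R * cis t / (c + of_real R * cis t - w))"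
      by (rule complex_Re_le_cmod)
    also have "\<dots> = R / norm (c + of_real R * cis t - w)" using R by (simp add: norm_divide norm_mult)
    also have "\<dots> \<le> R / (R - dist c w)"
      using norm_circle_minus_ge[OF R(2), of c w t] R by (intro divide_left_mono mult_pos_pos) auto
    finally have "poisson_ker c R w t \<le> 2 * R / (R - dist c w) - 1"
      using poisson_ker_eq[OF assms(2), of t] by simp
    then show "norm (\<phi> t * poisson_ker c R w t) \<le> (2 * R / (R - dist c w) - 1) * \<bar>\<phi> t\<bar>"
      using poisson_ker_nonneg[OF assms(2), of t] mult_right_mono[of "poisson_ker c R w t" _ "\<bar>\<phi> t\<bar>"]
      by (simp only: real_norm_def abs_mult abs_of_nonneg abs_ge_zero mult.commute[of "\<bar>\<phi> t\<bar>"])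
  qed
  then have "2 * pi * \<bar>Re (schwarz c R \<phi> w)\<bar> \<le> (2 * R / (R - dist c w) - 1) * integral {-pi..pi} (\<lambda>t. \<bar>\<phi> t\<bar>)"
    by (simp add: abs_mult)
  also have "\<dots> = 2 * pi * ((R / (pi * (R - dist c w)) - 1 / (2 * pi)) * integral {-pi..pi} (\<lambda>t. \<bar>\<phi> t\<bar>))"
    using R by (simp add: field_simps)
  finally show ?thesis by simp
qed

text \<open>Near a boundary point \<open>z\<close> the kernel splits: boundary points close to \<open>z\<close> contribute at most
  \<open>\<epsilon>\<close>, and on the others the kernel is small because \<open>w\<close> is close to the circle.\<close>
lemma Re_schwarz_boundary_limit:
  fixes g :: "complex \<Rightarrow> real"
  assumes "R > 0" "continuous_on (sphere c R) g" "z \<in> sphere c R" "\<epsilon> > 0"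
  shows "\<exists>\<delta>>0. \<forall>w\<in>ball c R. dist w z < \<delta> \<longrightarrow>
           \<bar>Re (schwarz c R (\<lambda>t. g (c + of_real R * cis t)) w) - g z\<bar> < \<epsilon>"
proof -
  define \<phi> where "\<phi> = (\<lambda>t. g (c + of_real R * cis t))"
  have on: "c + of_real R * cis t \<in> sphere c R" for t
    using assms(1) by (simp add: dist_norm norm_mult)
  have c\<phi>: "continuous_on A \<phi>" for A
    unfolding \<phi>_def by (rule continuous_on_compose2[OF assms(2)]) (use on in \<open>auto intro!: continuous_intros\<close>)
  have "compact (g ` sphere c R)" by (intro compact_continuous_image assms) auto
  then obtain M where "\<forall>y\<in>g ` sphere c R. norm y \<le> M"
    using compact_imp_bounded bounded_iff by blast
  then have M: "\<bar>g x\<bar> \<le> M" if "x \<in> sphere c R" for x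
    using that by (simp only: ball_simps real_norm_def)
  have M0: "M \<ge> 0" using M[OF assms(3)] by simp
  obtain d where d: "d > 0" "\<And>x. x \<in> sphere c R \<Longrightarrow> dist x z < d \<Longrightarrow> \<bar>g x - g z\<bar> < \<epsilon> / 4"
    using assms(2,3,4) unfolding continuous_on_iff dist_real_def[symmetric]
    by (metis divide_pos_pos zero_less_numeral)
  define C where "C = 8 * M * (2 * R) / d\<^sup>2"
  have C0: "C \<ge> 0" using M0 assms(1) by (simp add: C_def)
  \<comment> \<open>The bound \<open>d / 2\<close> keeps \<open>w\<close> at distance at least
    \<open>d / 2\<close> from every circle point that is \<open>d\<close> away from
    \<open>z\<close>; there the kernel is at most 2 R dist w z / (d/2)^2, and \<open>C\<close> is 2
    M times that coefficient. The second bound makes the far contribution at most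
    \<open>\<epsilon> / 4\<close>; \<open>C + 1\<close> keeps the denominator positive when
    \<open>M = 0\<close>.\<close>
  define \<delta> where "\<delta> = min (d / 2) (\<epsilon> / (4 * (C + 1)))"
  have "\<delta> > 0" using d(1) assms(4) C0 by (simp add: \<delta>_def)
  moreover have "\<bar>Re (schwarz c R \<phi> w) - g z\<bar> < \<epsilon>" if w: "w \<in> ball c R" and wz: "dist w z < \<delta>" for w
  proof -
    have dw: "dist c w < R" using w by simp
    have dz: "dist c z = R" using assms(3) by simp
    have "R - dist c w \<le> dist w z" using dz dist_triangle[of c z w] by simp
    then have small: "R\<^sup>2 - (dist c w)\<^sup>2 \<le> 2 * R * dist w z"
    proof -
      have "R\<^sup>2 - (dist c w)\<^sup>2 = (R + dist c w) * (R - dist c w)" by (simp add: power2_eq_square algebra_simps)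
      also have "\<dots> \<le> (2 * R) * dist w z"
        by (intro mult_mono) (use dw assms(1) \<open>R - dist c w \<le> dist w z\<close> in auto)
      finally show ?thesis .
    qed
    have I1: "((\<lambda>t. \<phi> t * poisson_ker c R w t - g z * poisson_ker c R w t) has_integral
       2 * pi * Re (schwarz c R \<phi> w) - g z * (2 * pi)) {-pi..pi}"
      by (intro has_integral_diff Re_schwarz has_integral_mult_right has_integral_poisson_ker w c\<phi>)
    have I2: "((\<lambda>t. \<epsilon> / 4 * poisson_ker c R w t + C * dist w z) has_integral
       \<epsilon> / 4 * (2 * pi) + (C * dist w z) * (2 * pi)) {-pi..pi}"
      using has_integral_const_real[of "C * dist w z" "-pi" pi]
      by (intro has_integral_add has_integral_mult_right has_integral_poisson_ker w) (auto simp: mult_ac)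
    have "norm (2 * pi * Re (schwarz c R \<phi> w) - g z * (2 * pi)) \<le> \<epsilon> / 4 * (2 * pi) + (C * dist w z) * (2 * pi)"
    proof (rule integral_norm_bound_integral[OF has_integral_integrable[OF I1] has_integral_integrable[OF I2],
           unfolded integral_unique[OF I1] integral_unique[OF I2]])
      fix t
      define P where "P = poisson_ker c R w t"
      define \<zeta> where "\<zeta> = c + of_real R * cis t"
      have P0: "P \<ge> 0" unfolding P_def by (rule poisson_ker_nonneg[OF w])
      have "\<bar>\<phi> t - g z\<bar> * P \<le> \<epsilon> / 4 * P + C * dist w z"
      proof (cases "dist \<zeta> z < d")
        case True
        then have "\<bar>\<phi> t - g z\<bar> \<le> \<epsilon> / 4" using d(2)[OF on[of t]] by (simp add: \<phi>_def \<zeta>_def)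
        then have "\<bar>\<phi> t - g z\<bar> * P \<le> \<epsilon> / 4 * P" using P0 by (rule mult_right_mono)
        moreover have "C * dist w z \<ge> 0" using C0 by simp
        ultimately show ?thesis by linarith
      next
        case False
        have "dist w z < d / 2" using wz by (simp add: \<delta>_def)
        then have far: "norm (\<zeta> - w) \<ge> d / 2" using False dist_triangle[of \<zeta> z w] by (simp add: dist_norm)
        have "P = (R\<^sup>2 - (dist c w)\<^sup>2) / (norm (\<zeta> - w))\<^sup>2" by (simp add: P_def poisson_ker_def \<zeta>_def)
        also have "\<dots> \<le> (2 * R * dist w z) / (d / 2)\<^sup>2"
          by (intro frac_le power_mono small far) (use d assms in auto)
        finally have P: "P \<le> 8 * R * dist w z / d\<^sup>2" by (simp add: power_divide)
        have "\<bar>\<phi> t - g z\<bar> \<le> 2 * M" using M[OF on[of t]] M[OF assms(3)] by (simp add: \<phi>_def)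
        then have "\<bar>\<phi> t - g z\<bar> * P \<le> (2 * M) * (8 * R * dist w z / d\<^sup>2)"
          by (rule mult_mono) (use P P0 M0 in auto)
        also have "\<dots> = C * dist w z" by (simp add: C_def)
        finally show ?thesis using P0 assms(4) by (simp add: add_increasing)
      qed
      then show "norm (\<phi> t * poisson_ker c R w t - g z * poisson_ker c R w t)
          \<le> \<epsilon> / 4 * poisson_ker c R w t + C * dist w z"
        using P0 by (simp add: P_def abs_mult flip: left_diff_distrib)
    qed
    then have "(2 * pi) * \<bar>Re (schwarz c R \<phi> w) - g z\<bar> \<le> (2 * pi) * (\<epsilon> / 4 + C * dist w z)"
    proof -
      have "2 * pi * Re (schwarz c R \<phi> w) - g z * (2 * pi) = 2 * pi * (Re (schwarz c R \<phi> w) - g z)"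
        by (simp add: algebra_simps)
      moreover have "\<epsilon> / 4 * (2 * pi) + (C * dist w z) * (2 * pi) = 2 * pi * (\<epsilon> / 4 + C * dist w z)"
        by (simp add: algebra_simps)
      ultimately show ?thesis
        using \<open>norm (2 * pi * Re (schwarz c R \<phi> w) - g z * (2 * pi)) \<le> _\<close> by (simp add: abs_mult)
    qed
    then have "\<bar>Re (schwarz c R \<phi> w) - g z\<bar> \<le> \<epsilon> / 4 + C * dist w z" by simp
    also have "C * dist w z \<le> (C + 1) * (\<epsilon> / (4 * (C + 1)))"
      using wz C0 by (intro mult_mono) (auto simp: \<delta>_def)
    also have "\<dots> = \<epsilon> / 4" using C0 by (simp add: divide_simps)
    finally show ?thesis using assms(4) by simp
  qed
  ultimately show ?thesis unfolding \<phi>_def by blast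
qed

text \<open>A boundary point is approached both from inside, where the limit lemma applies, and
  along the circle, where continuity of \<open>g\<close> does; the smaller of the two radii
  serves.\<close>

lemma continuous_on_schwarz_extension:
  fixes g :: "complex \<Rightarrow> real"
  assumes "R > 0" "continuous_on (sphere c R) g"
  shows "continuous_on (cball c R)
    (\<lambda>w. if w \<in> ball c R then Re (schwarz c R (\<lambda>t. g (c + of_real R * cis t)) w) else g w)"
    (is "continuous_on _ ?U")
proof -
  define \<phi> where "\<phi> = (\<lambda>t. g (c + of_real R * cis t))"
  have c\<phi>: "continuous_on A \<phi>" for A
    unfolding \<phi>_def by (rule continuous_on_compose2[OF assms(2)])
       (use assms in \<open>auto intro!: continuous_intros simp: dist_norm norm_mult\<close>)
  have "continuous (at z within cball c R) ?U" if z: "z \<in> cball c R" for z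
  proof (cases "z \<in> ball c R")
    case True
    have "continuous_on (ball c R) (\<lambda>w. Re (schwarz c R \<phi> w))"
      by (intro continuous_intros holomorphic_on_imp_continuous_on holomorphic_schwarz c\<phi>)
    then have "continuous_on (ball c R) ?U"
      by (rule continuous_on_eq) (simp add: \<phi>_def)
    then have "isCont ?U z" using True by (simp add: continuous_on_eq_continuous_at)
    then show ?thesis by (rule continuous_at_imp_continuous_at_within)
  next
    case False
    then have z': "z \<in> sphere c R" using z by auto
    show ?thesis unfolding continuous_within_eps_delta
    proof (intro allI impI)
      fix \<epsilon> :: real assume \<epsilon>: "\<epsilon> > 0"
      obtain d1 where d1: "d1 > 0" "\<And>w. w \<in> ball c R \<Longrightarrow> dist w z < d1 \<Longrightarrow> \<bar>Re (schwarz c R \<phi> w) - g z\<bar> < \<epsilon>"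
        using Re_schwarz_boundary_limit[OF assms z' \<epsilon>] unfolding \<phi>_def by blast
      obtain d2 where d2: "d2 > 0" "\<And>w. w \<in> sphere c R \<Longrightarrow> dist w z < d2 \<Longrightarrow> dist (g w) (g z) < \<epsilon>"
        using assms(2) z' \<epsilon> unfolding continuous_on_iff by blast
      have "dist (?U w) (?U z) < \<epsilon>" if "w \<in> cball c R" "dist w z < min d1 d2" for w
        using that d1(2)[of w] d2(2)[of w] False by (auto simp: dist_real_def \<phi>_def)
      then show "\<exists>d>0. \<forall>x'\<in>cball c R. dist x' z < d \<longrightarrow> dist (?U x') (?U z) < \<epsilon>"
        using d1(1) d2(1) by (intro exI[of _ "min d1 d2"]) auto
    qed
  qed
  then show ?thesis by (simp add: continuous_on_eq_continuous_within)
qed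

section \<open>Real parts of holomorphic functions on the plane\<close>

text \<open>The isometry by which discs and circles of the plane correspond to those of the complex
  numbers.\<close>

definition cx :: "real \<times> real \<Rightarrow> complex" where "cx p = Complex (fst p) (snd p)"

lemma cx_Pair [simp]: "cx (x, y) = Complex x y" by (simp add: cx_def)

lemma cx_add: "cx (p + q) = cx p + cx q" by (simp add: cx_def complex_eq_iff)

lemma cx_diff: "cx (p - q) = cx p - cx q" by (simp add: cx_def complex_eq_iff)

lemma cx_zero [simp]: "cx 0 = 0" by (simp add: cx_def complex_eq_iff)

lemma norm_cx [simp]: "norm (cx p) = norm p"
  by (cases p) (simp add: norm_Pair complex_norm)

lemma dist_cx [simp]: "dist (cx p) (cx q) = dist p q"
  by (simp add: dist_norm flip: cx_diff)

lemma Re_Im_cx [simp]: "(Re (cx p), Im (cx p)) = p" by (simp add: cx_def)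

lemma continuous_on_cx [continuous_intros]: "continuous_on A cx"
  unfolding cx_def[abs_def] Complex_eq by (intro continuous_intros)

lemma cx_mem_ball [simp]: "cx p \<in> ball (cx c) r \<longleftrightarrow> p \<in> ball c r" by simp

lemma vimage_cx_ball: "cx -` ball (cx c) r = ball c r" by (rule set_eqI) simp

text \<open>A relation that constrains \<open>w\<close> only over \<open>T\<close>: for open
  \<open>T\<close> it is inherited by partial derivatives whatever \<open>w\<close> is outside,
  which suits functions that are defined piecewise.\<close>

definition is_Re_on :: "complex set \<Rightarrow> (real \<times> real \<Rightarrow> real) \<Rightarrow> (complex \<Rightarrow> complex) \<Rightarrow> bool" where
  "is_Re_on T w G \<longleftrightarrow> (\<forall>p. cx p \<in> T \<longrightarrow> w p = Re (G (cx p)))"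

lemma is_Re_onD: "is_Re_on T w G \<Longrightarrow> cx p \<in> T \<Longrightarrow> w p = Re (G (cx p))"
  unfolding is_Re_on_def by blast

lemma open_horizontal_line: "open T \<Longrightarrow> open {t. Complex t y \<in> T}"
  using open_vimage[of T "\<lambda>t. Complex t y"] by (simp add: vimage_def Complex_eq continuous_intros)

lemma open_vertical_line: "open T \<Longrightarrow> open {t. Complex x t \<in> T}"
  using open_vimage[of T "\<lambda>t. Complex x t"] by (simp add: vimage_def Complex_eq continuous_intros)

text \<open>The chain rule along lines with directions 1 and i. The second derivative is left as Re
  (i G') instead of -Im G', so that it is again the real part of a holomorphic function and the rule
  can be iterated.\<close>

lemma has_field_derivative_Re_line:
  assumes "open T" "G holomorphic_on T" "is_Re_on T w G" "cx p \<in> T"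
  shows "((\<lambda>t. w (t, snd p)) has_field_derivative Re (deriv G (cx p))) (at (fst p))"
    and "((\<lambda>t. w (fst p, t)) has_field_derivative Re (\<i> * deriv G (cx p))) (at (snd p))"
proof -
  obtain x y where p: "p = (x, y)" by (cases p)
  have G: "(G has_field_derivative deriv G (Complex x y)) (at (Complex x y))"
    using assms p by (auto intro: holomorphic_derivI)
  have vx: "((\<lambda>t. Complex t y) has_vector_derivative 1) (at x)"
    unfolding Complex_eq by (auto intro!: derivative_eq_intros)
  have vy: "((\<lambda>t. Complex x t) has_vector_derivative \<i>) (at y)"
    unfolding Complex_eq by (auto intro!: derivative_eq_intros)
  have "((\<lambda>t. Re ((G \<circ> (\<lambda>t. Complex t y)) t)) has_vector_derivative Re (1 * deriv G (Complex x y))) (at x)"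
    by (intro bounded_linear.has_vector_derivative[OF bounded_linear_Re] field_vector_diff_chain_at vx G)
  then have "((\<lambda>t. Re (G (Complex t y))) has_field_derivative Re (deriv G (Complex x y))) (at x)"
    by (simp add: has_real_derivative_iff_has_vector_derivative o_def)
  then show "((\<lambda>t. w (t, snd p)) has_field_derivative Re (deriv G (cx p))) (at (fst p))"
    unfolding p fst_conv snd_conv cx_Pair
    by (rule has_field_derivative_transform_within_open[where S = "{t. Complex t y \<in> T}"])
       (use assms p in \<open>auto simp: open_horizontal_line is_Re_onD\<close>)
  have "((\<lambda>t. Re ((G \<circ> (\<lambda>t. Complex x t)) t)) has_vector_derivative Re (\<i> * deriv G (Complex x y))) (at y)"
    by (intro bounded_linear.has_vector_derivative[OF bounded_linear_Re] field_vector_diff_chain_at vy G)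
  then have "((\<lambda>t. Re (G (Complex x t))) has_field_derivative Re (\<i> * deriv G (Complex x y))) (at y)"
    by (simp add: has_real_derivative_iff_has_vector_derivative o_def)
  then show "((\<lambda>t. w (fst p, t)) has_field_derivative Re (\<i> * deriv G (cx p))) (at (snd p))"
    unfolding p fst_conv snd_conv cx_Pair
    by (rule has_field_derivative_transform_within_open[where S = "{t. Complex x t \<in> T}"])
       (use assms p in \<open>auto simp: open_vertical_line is_Re_onD\<close>)
qed

lemma is_Re_on_pdx:
  assumes "open T" "G holomorphic_on T" "is_Re_on T w G"
  shows "is_Re_on T (pdx w) (deriv G)"
  using has_field_derivative_Re_line(1)[OF assms] by (simp add: is_Re_on_def pdx_def DERIV_imp_deriv)

lemma is_Re_on_pdy:
  assumes "open T" "G holomorphic_on T" "is_Re_on T w G"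
  shows "is_Re_on T (pdy w) (\<lambda>z. \<i> * deriv G z)"
  unfolding is_Re_on_def pdy_def using has_field_derivative_Re_line(2)[OF assms] by (blast intro: DERIV_imp_deriv)

lemma Ck_plane_Re:
  assumes "open T" "G holomorphic_on T" "is_Re_on T w G"
  shows "Ck_plane k (cx -` T) w"
  using assms(2,3)
\<comment> \<open>The step replaces the pair \<open>w\<close>, \<open>G\<close> by a partial
  derivative of \<open>w\<close> together with G' or i G', so both must be general.\<close>
proof (induction k arbitrary: G w)
  case (0 G w)
  have "continuous_on (cx -` T) (\<lambda>p. Re (G (cx p)))"
    by (intro continuous_intros continuous_on_compose2[OF holomorphic_on_imp_continuous_on[OF 0(1)]]) auto
  then show ?case using is_Re_onD[OF 0(2)] by (auto elim: continuous_on_eq)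
next
  case (Suc k G w)
  have "continuous_on (cx -` T) (\<lambda>p. Re (G (cx p)))"
    by (intro continuous_intros continuous_on_compose2[OF holomorphic_on_imp_continuous_on[OF Suc.prems(1)]]) auto
  then have "continuous_on (cx -` T) w" using is_Re_onD[OF Suc.prems(2)] by (auto elim: continuous_on_eq)
  moreover have "Ck_plane k (cx -` T) (pdx w)"
    by (rule Suc.IH[OF holomorphic_deriv[OF Suc.prems(1) assms(1)] is_Re_on_pdx[OF assms(1) Suc.prems]])
  moreover have "Ck_plane k (cx -` T) (pdy w)"
    by (rule Suc.IH[OF _ is_Re_on_pdy[OF assms(1) Suc.prems]])
       (intro holomorphic_intros holomorphic_deriv Suc.prems assms(1))
  ultimately show ?case
    using has_field_derivative_Re_line[OF assms(1) Suc.prems] unfolding Ck_plane.simps field_differentiable_def vimage_eq by blast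
qed

lemma is_Re_on_pdy_power:
  assumes "open T" "G holomorphic_on T" "is_Re_on T w G"
  shows "is_Re_on T ((pdy ^^ k) w) (\<lambda>z. \<i> ^ k * (deriv ^^ k) G z)"
proof (induction k)
  case (Suc k)
  have hol: "(deriv ^^ k) G holomorphic_on T" by (intro holomorphic_higher_deriv assms)
  have "is_Re_on T (pdy ((pdy ^^ k) w)) (\<lambda>z. \<i> * deriv (\<lambda>z. \<i> ^ k * (deriv ^^ k) G z) z)"
    by (rule is_Re_on_pdy[OF assms(1) _ Suc]) (intro holomorphic_intros hol)
  moreover have "deriv (\<lambda>z. \<i> ^ k * (deriv ^^ k) G z) z = \<i> ^ k * (deriv ^^ Suc k) G z" if "z \<in> T" for z
    using hol assms(1) that by (simp add: holomorphic_on_imp_differentiable_at)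
  ultimately show ?case by (simp add: is_Re_on_def mult.assoc)
qed (use assms in simp)

lemma is_Re_on_pdx_power:
  assumes "open T" "G holomorphic_on T" "is_Re_on T w G"
  shows "is_Re_on T ((pdx ^^ k) w) ((deriv ^^ k) G)"
proof (induction k)
  case (Suc k)
  then show ?case using is_Re_on_pdx[OF assms(1) holomorphic_higher_deriv[OF assms(2,1)] Suc] by simp
qed (use assms in simp)

lemma is_Re_on_Dpart:
  assumes "open T" "G holomorphic_on T" "is_Re_on T w G"
  shows "is_Re_on T (Dpart a b w) (\<lambda>z. \<i> ^ b * (deriv ^^ (a + b)) G z)"
proof -
  have hol: "(\<lambda>z. \<i> ^ b * (deriv ^^ b) G z) holomorphic_on T"
    by (intro holomorphic_intros holomorphic_higher_deriv assms)
  have "is_Re_on T (Dpart a b w) ((deriv ^^ a) (\<lambda>z. \<i> ^ b * (deriv ^^ b) G z))"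
    unfolding Dpart_def by (rule is_Re_on_pdx_power[OF assms(1) hol is_Re_on_pdy_power[OF assms]])
  moreover have "(deriv ^^ a) (\<lambda>z. \<i> ^ b * (deriv ^^ b) G z) z = \<i> ^ b * (deriv ^^ (a + b)) G z" if "z \<in> T" for z
    using higher_deriv_cmult[OF holomorphic_higher_deriv[OF assms(2,1), of b] that assms(1), of a "\<i> ^ b"]
    by (simp add: funpow_add)
  ultimately show ?thesis by (simp add: is_Re_on_def)
qed

text \<open>The two second derivatives are the real parts of G'' and i^2 G'' = -G''.\<close>

lemma laplacian_Re:
  assumes "open T" "G holomorphic_on T" "is_Re_on T w G" "cx p \<in> T"
  shows "laplacian w p = 0"
  using is_Re_onD[OF is_Re_on_Dpart[OF assms(1-3), of 2 0] assms(4)]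
    is_Re_onD[OF is_Re_on_Dpart[OF assms(1-3), of 0 2] assms(4)]
  by (simp add: laplacian_def numeral_2_eq_2)

section \<open>Taylor terms and real analyticity\<close>

lemma sum_diagonal:
  "(\<Sum>(a, b)\<in>{(a, b). a + b = k}. f a b) = (\<Sum>j\<le>k. f (k - j) j)" for k :: nat
  by (rule sum.reindex_bij_witness[of _ "\<lambda>j. (k - j, j)" snd]) auto

lemma Re_mult_of_real: "Re (z * of_real a) = Re z * a"
  by simp

lemma Re_of_real_mult: "Re (of_real a * z) = a * Re z"
  by simp

text \<open>All complex factors stand in one bracket and the remaining monomial is real, so real and
  imaginary parts can be taken termwise. Taylor terms, the double power series and the polynomials
  \<open>approx_poly\<close> all use this form.\<close>

lemma cx_power_expand:
  "c * cx h ^ k = (\<Sum>j\<le>k. (c * of_nat (k choose j) * \<i> ^ j) * of_real (fst h ^ (k - j) * snd h ^ j))"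
proof -
  have "cx h = \<i> * of_real (snd h) + of_real (fst h)" by (simp add: cx_def Complex_eq)
  then have "cx h ^ k = (\<Sum>j\<le>k. of_nat (k choose j) * (\<i> * of_real (snd h)) ^ j * of_real (fst h) ^ (k - j))"
    by (simp only: binomial_ring)
  then show ?thesis by (simp add: sum_distrib_left power_mult_distrib mult_ac)
qed

text \<open>Because 1 / ((k - j)! j!) is the binomial coefficient divided by k!, the sum over all
  mixed derivatives of order \<open>k\<close> is the binomial expansion of one complex Taylor
  term.\<close>

lemma taylor_term_Re:
  assumes "open T" "G holomorphic_on T" "is_Re_on T w G" "cx p \<in> T"
  shows "taylor_term w p h k = Re ((deriv ^^ k) G (cx p) / fact k * cx h ^ k)"
proof -
  let ?D = "(deriv ^^ k) G (cx p)"
  have "taylor_term w p h k =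
      (\<Sum>j\<le>k. Dpart (k - j) j w p / (fact (k - j) * fact j) * fst h ^ (k - j) * snd h ^ j)"
    unfolding taylor_term_def by (rule sum_diagonal)
  also have "\<dots> = (\<Sum>j\<le>k. Re ((?D / fact k * of_nat (k choose j) * \<i> ^ j) * of_real (fst h ^ (k - j) * snd h ^ j)))"
  proof (rule sum.cong[OF refl])
    fix j assume "j \<in> {..k}"
    then have j: "j \<le> k" by simp
    have b: "real (k choose j) = fact k / (fact j * fact (k - j))" by (rule binomial_fact[OF j])
    have "?D / fact k * of_nat (k choose j) * \<i> ^ j = of_real (real (k choose j) / fact k) * (\<i> ^ j * ?D)"
      by simp
    also have "real (k choose j) / fact k = 1 / (fact (k - j) * fact j)" by (simp add: b)
    finally have e: "?D / fact k * of_nat (k choose j) * \<i> ^ j = of_real (1 / (fact (k - j) * fact j)) * (\<i> ^ j * ?D)" .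
    have D: "Dpart (k - j) j w p = Re (\<i> ^ j * ?D)"
      using is_Re_onD[OF is_Re_on_Dpart[OF assms(1-3), of "k - j" j] assms(4)] j by simp
    show "Dpart (k - j) j w p / (fact (k - j) * fact j) * fst h ^ (k - j) * snd h ^ j =
       Re ((?D / fact k * of_nat (k choose j) * \<i> ^ j) * of_real (fst h ^ (k - j) * snd h ^ j))"
      unfolding e D Re_mult_of_real Re_of_real_mult by (simp add: mult.assoc)
  qed
  also have "\<dots> = Re (?D / fact k * cx h ^ k)" by (simp only: cx_power_expand Re_sum)
  finally show ?thesis .
qed

text \<open>The complex power series is expanded in powers of h1 and h2. Its rearrangement as a
  double series is dominated by the sum of |b_k| (|h1| + |h2|)^k, which converges for |h1| + |h2| <
  r; the radius \<open>r / 2\<close> ensures this, as each coordinate is at most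
  \<open>norm h\<close>.\<close>

lemma analytic_plane_Re:
  assumes "open T" "G holomorphic_on T" "is_Re_on T w G"
  shows "analytic_plane (cx -` T) w"
  unfolding analytic_plane_def
proof
  fix p assume "p \<in> cx -` T"
  then obtain r where r: "r > 0" "ball (cx p) r \<subseteq> T" using assms(1) by (auto simp: open_contains_ball)
  have hol: "G holomorphic_on ball (cx p) r" using assms(2) r(2) by (rule holomorphic_on_subset)
  define b where "b = (\<lambda>k. (deriv ^^ k) G (cx p) / fact k)"
  have ps: "(\<lambda>k. b k * z ^ k) sums G (cx p + z)" if "norm z < r" for z
    using holomorphic_power_series[OF hol, of "cx p + z"] that by (simp add: b_def dist_norm)
  define a where "a = (\<lambda>i j. Re (b (i + j) * of_nat ((i + j) choose j) * \<i> ^ j))"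
  have "((\<lambda>(i, j). a i j * fst h ^ i * snd h ^ j) has_sum w (p + h)) UNIV" if h: "norm h < r / 2" for h
  proof -
    define s where "s = \<bar>fst h\<bar> + \<bar>snd h\<bar>"
    have "\<bar>fst h\<bar> \<le> norm h" "\<bar>snd h\<bar> \<le> norm h" using norm_fst_le[of "fst h" "snd h"] norm_snd_le[of "snd h" "fst h"] by simp_all
    then have s: "0 \<le> s" "s < r" using h by (auto simp: s_def)
    \<comment> \<open>A point strictly between \<open>s\<close> and the radius: convergence of the
      power series there yields absolute convergence at \<open>s\<close>.\<close>
    define x where "x = complex_of_real ((s + r) / 2)"
    have "norm x = (s + r) / 2" unfolding x_def norm_of_real using s by simp
    then have x: "norm x < r" "s < norm x" using s by auto
    have sum: "summable (\<lambda>k. norm (b k) * s ^ k)"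
      using powser_insidea[of b x "of_real s"] sums_summable[OF ps[OF x(1)]] x(2) s
      by (simp add: norm_mult norm_power)
    define f where "f = (\<lambda>(k, j). a (k - j) j * fst h ^ (k - j) * snd h ^ j)"
    define F where "F = (\<lambda>(k, j). norm (b k) * (real (k choose j) * \<bar>snd h\<bar> ^ j * \<bar>fst h\<bar> ^ (k - j)))"
    define g where "g = (\<lambda>k. Re (b k * cx h ^ k))"
    have g_le: "norm (g k) \<le> norm (b k) * s ^ k" for k
    proof -
      have "norm (g k) \<le> norm (b k * cx h ^ k)" unfolding g_def real_norm_def by (rule abs_Re_le_cmod)
      also have "\<dots> \<le> norm (b k) * s ^ k"
        unfolding norm_mult norm_power norm_cx s_def
        using norm_Pair_le[of "fst h" "snd h"] by (intro mult_left_mono power_mono) auto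
      finally show ?thesis .
    qed
    have wh: "w (p + h) = Re (G (cx p + cx h))"
      using is_Re_onD[OF assms(3), of "p + h"] r h by (simp add: cx_add dist_norm subset_iff)
    have "g sums w (p + h)"
      unfolding wh g_def by (intro sums_Re ps) (use h r in simp)
    moreover have "summable (\<lambda>k. norm (g k))"
      by (rule summable_comparison_test'[OF sum, of 0]) (use g_le in simp)
    ultimately have hg: "(g has_sum w (p + h)) UNIV" by (rule norm_summable_imp_has_sum[rotated])
    have inF: "((\<lambda>j. F (k, j)) has_sum norm (b k) * s ^ k) {..k}" for k
    proof -
      have "(\<Sum>j\<le>k. F (k, j)) = norm (b k) * (\<bar>snd h\<bar> + \<bar>fst h\<bar>) ^ k"
        by (simp add: F_def binomial_ring sum_distrib_left)
      then show ?thesis by (intro has_sum_finiteI) (auto simp: s_def add.commute)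
    qed
    have "(\<lambda>k. norm (b k) * s ^ k) summable_on UNIV"
      by (intro norm_summable_imp_summable_on) (use sum s in \<open>simp add: abs_mult\<close>)
    then have sF: "F summable_on (SIGMA k:UNIV. {..k})"
      by (intro summable_on_SigmaI[OF inF]) (auto simp: F_def)
    have fF: "norm (f x) \<le> F x" if xm: "x \<in> (SIGMA k:UNIV. {..k})" for x
    proof -
      obtain k j where x: "x = (k, j)" "j \<le> k" using xm by auto
      have "\<bar>a (k - j) j\<bar> \<le> norm (b k) * real (k choose j)"
        using abs_Re_le_cmod[of "b k * of_nat (k choose j) * \<i> ^ j"] x(2) by (simp add: a_def norm_mult norm_power)
      then have "\<bar>a (k - j) j\<bar> * (\<bar>fst h\<bar> ^ (k - j) * \<bar>snd h\<bar> ^ j) \<le> norm (b k) * real (k choose j) * (\<bar>fst h\<bar> ^ (k - j) * \<bar>snd h\<bar> ^ j)"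
        by (rule mult_right_mono) auto
      then show ?thesis by (simp add: x f_def F_def abs_mult power_abs mult_ac)
    qed
    have sf: "f summable_on (SIGMA k:UNIV. {..k})"
      by (rule abs_summable_summable[OF summable_on_comparison_test[OF sF fF norm_ge_zero]])
    have inf: "((\<lambda>j. f (k, j)) has_sum g k) {..k}" for k
    proof (rule has_sum_finiteI)
      show "g k = (\<Sum>j\<le>k. f (k, j))"
        unfolding g_def cx_power_expand Re_sum Re_mult_of_real
        by (intro sum.cong) (auto simp: f_def a_def)
    qed auto
    have "(f has_sum w (p + h)) (SIGMA k:UNIV. {..k})"
      by (rule has_sum_SigmaI[OF inf hg sf])
    then show ?thesis
      by (subst has_sum_reindex_bij_witness[of UNIV "\<lambda>(k, j). (k - j, j)" "\<lambda>(i, j). (i + j, j)" "SIGMA k:UNIV. {..k}" f _ "w (p + h)"])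
         (auto simp: f_def)
  qed
  then show "\<exists>a \<delta>. \<delta> > 0 \<and> (\<forall>h. norm h < \<delta> \<longrightarrow>
       ((\<lambda>(i, j). a i j * fst h ^ i * snd h ^ j) has_sum w (p + h)) UNIV)"
    using r(1) by (intro exI[of _ a] exI[of _ "r / 2"]) auto
qed

section \<open>The maximum principle\<close>

text \<open>At the maximum f' vanishes; a positive second derivative would make f' positive just to
  the right, and by the mean value theorem \<open>f\<close> would rise above its maximum.\<close>

lemma second_derivative_local_max:
  fixes f f' :: "real \<Rightarrow> real"
  assumes "d > 0" "\<And>t. \<bar>t - x\<bar> < d \<Longrightarrow> (f has_field_derivative f' t) (at t)"
    and "(f' has_field_derivative l) (at x)" "\<And>t. \<bar>t - x\<bar> < d \<Longrightarrow> f t \<le> f x"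
  shows "l \<le> 0"
proof (rule ccontr)
  assume "\<not> l \<le> 0"
  then obtain e where e: "e > 0" "\<And>h. 0 < h \<Longrightarrow> h < e \<Longrightarrow> f' x < f' (x + h)"
    using DERIV_pos_inc_right[OF assms(3)] by auto
  have "f' x = 0"
    by (rule DERIV_local_max[OF assms(2)[of x] assms(1)]) (use assms(1,4) in \<open>auto simp: abs_minus_commute\<close>)
  define h where "h = min d e / 2"
  have h: "h > 0" "h < d" "h < e" using assms(1) e(1) by (auto simp: h_def)
  have "\<exists>z. x < z \<and> z < x + h \<and> f (x + h) - f x = (x + h - x) * f' z"
    by (rule MVT2) (use h assms(2) in auto)
  then obtain z where z: "x < z" "z < x + h" "f (x + h) - f x = h * f' z" by auto
  have "f' z > 0" using e(2)[of "z - x"] z h \<open>f' x = 0\<close> by auto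
  then have "f (x + h) > f x" using z(3) h(1) mult_pos_pos[of h "f' z"] by linarith
  moreover have "f (x + h) \<le> f x" by (rule assms(4)) (use h in simp)
  ultimately show False by simp
qed

lemma Ck_plane_2_derivatives:
  assumes "Ck_plane 2 S w" "p \<in> S"
  shows "((\<lambda>t. w (t, snd p)) has_field_derivative pdx w p) (at (fst p))"
    and "((\<lambda>t. w (fst p, t)) has_field_derivative pdy w p) (at (snd p))"
    and "((\<lambda>t. pdx w (t, snd p)) has_field_derivative Dpart 2 0 w p) (at (fst p))"
    and "((\<lambda>t. pdy w (fst p, t)) has_field_derivative Dpart 0 2 w p) (at (snd p))"
  using assms
  by (auto simp: numeral_2_eq_2 pdx_def[of w p] pdy_def[of w p] pdx_def[of "pdx w" p] pdy_def[of "pdy w" p] Dpart_def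
      simp del: fun_upd_apply intro!: DERIV_deriv_iff_field_differentiable[THEN iffD2])

text \<open>At an interior maximum of \<open>u - v + \<epsilon>\<parallel>q - c\<parallel>\<^sup>2\<close> both pure second derivatives would be nonpositive, 
  while their sum is \<open>4\<epsilon>\<close>.\<close>
lemma harmonic_comparison:
  fixes u v :: "real \<times> real \<Rightarrow> real"
  assumes u: "Ck_plane 2 (ball c r) u" "continuous_on (cball c r) u"
    and v: "Ck_plane 2 (ball c r) v" "continuous_on (cball c r) v"
    and lap: "\<And>p. p \<in> ball c r \<Longrightarrow> laplacian u p = laplacian v p"
    and bd: "\<And>p. p \<in> sphere c r \<Longrightarrow> u p \<le> v p + M"
    and p: "p \<in> cball c r"
  shows "u p \<le> v p + M"
proof (rule ccontr)
  assume "\<not> u p \<le> v p + M"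
  then have gap: "u p - v p - M > 0" by simp
  \<comment> \<open>Small enough that \<epsilon> r^2 stays below the gap, so the perturbation cannot
    move the maximum to the circle; the +1 covers \<open>r = 0\<close>.\<close>
  define \<epsilon> where "\<epsilon> = (u p - v p - M) / (2 * (r\<^sup>2 + 1))"
  have pos: "r\<^sup>2 + 1 > 0" by (simp add: add_nonneg_pos)
  have \<epsilon>: "\<epsilon> > 0" using gap pos by (simp add: \<epsilon>_def)
  have "\<epsilon> * r\<^sup>2 \<le> \<epsilon> * (r\<^sup>2 + 1)" using \<epsilon> by simp
  also have "\<dots> = (u p - v p - M) / 2" using pos by (simp add: \<epsilon>_def divide_simps)
  also have "\<dots> < u p - v p - M" using gap by simp
  finally have \<epsilon>r: "\<epsilon> * r\<^sup>2 < u p - v p - M" .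
  define f where "f = (\<lambda>q. u q - v q + \<epsilon> * ((fst q - fst c)\<^sup>2 + (snd q - snd c)\<^sup>2))"
  have nrm: "(fst q - fst c)\<^sup>2 + (snd q - snd c)\<^sup>2 = (dist c q)\<^sup>2" for q
    by (simp add: dist_prod_def dist_real_def power2_commute)
  have "continuous_on (cball c r) f" unfolding f_def by (intro continuous_intros u v)
  moreover have "cball c r \<noteq> {}" using p by blast
  ultimately obtain q where q: "q \<in> cball c r" "\<And>x. x \<in> cball c r \<Longrightarrow> f x \<le> f q"
    using continuous_attains_sup[OF compact_cball] by blast
  have "q \<in> ball c r"
  proof (rule ccontr)
    assume "q \<notin> ball c r"
    then have "q \<in> sphere c r" using q(1) by auto
    then have "f q \<le> M + \<epsilon> * r\<^sup>2" using bd[of q] by (simp add: f_def nrm)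
    moreover have "f p \<ge> u p - v p" using \<epsilon> by (simp add: f_def)
    ultimately show False using q(2)[OF p] \<epsilon>r by simp
  qed
  then obtain d where d: "d > 0" "ball q d \<subseteq> ball c r" using openE[OF open_ball] by blast
  obtain x y where xy: "q = (x, y)" by (cases q)
  have inx: "(t, y) \<in> ball c r" if "\<bar>t - x\<bar> < d" for t
    using that d(2) by (auto simp: xy subset_iff dist_Pair_Pair dist_real_def abs_minus_commute)
  have iny: "(x, t) \<in> ball c r" if "\<bar>t - y\<bar> < d" for t
    using that d(2) by (auto simp: xy subset_iff dist_Pair_Pair dist_real_def abs_minus_commute)
  \<comment> \<open>Differences of \<open>u\<close> and \<open>v\<close> are formed only for
    one-variable derivatives, which is why the comparison is made for a pair of functions.\<close>
  note du = Ck_plane_2_derivatives[OF u(1)] and dv = Ck_plane_2_derivatives[OF v(1)]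
  have "Dpart 2 0 u q - Dpart 2 0 v q + \<epsilon> * 2 \<le> 0"
  proof (rule second_derivative_local_max[OF d(1)])
    fix t assume t: "\<bar>t - x\<bar> < d"
    show "((\<lambda>t. f (t, y)) has_field_derivative pdx u (t, y) - pdx v (t, y) + \<epsilon> * (2 * (t - fst c))) (at t)"
      unfolding f_def using du(1)[OF inx[OF t]] dv(1)[OF inx[OF t]]
      by (auto intro!: derivative_eq_intros)
    show "f (t, y) \<le> f (x, y)" using q(2)[of "(t, y)"] inx[OF t] by (simp add: xy less_imp_le)
  next
    have "(x, y) \<in> ball c r" using \<open>q \<in> ball c r\<close> xy by simp
    from du(3)[OF this] dv(3)[OF this]
    show "((\<lambda>t. pdx u (t, y) - pdx v (t, y) + \<epsilon> * (2 * (t - fst c))) has_field_derivative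
        Dpart 2 0 u q - Dpart 2 0 v q + \<epsilon> * 2) (at x)"
      unfolding xy by (auto intro!: derivative_eq_intros)
  qed
  moreover have "Dpart 0 2 u q - Dpart 0 2 v q + \<epsilon> * 2 \<le> 0"
  proof (rule second_derivative_local_max[OF d(1)])
    fix t assume t: "\<bar>t - y\<bar> < d"
    show "((\<lambda>t. f (x, t)) has_field_derivative pdy u (x, t) - pdy v (x, t) + \<epsilon> * (2 * (t - snd c))) (at t)"
      unfolding f_def using du(2)[OF iny[OF t]] dv(2)[OF iny[OF t]]
      by (auto intro!: derivative_eq_intros)
    show "f (x, t) \<le> f (x, y)" using q(2)[of "(x, t)"] iny[OF t] by (simp add: xy less_imp_le)
  next
    have "(x, y) \<in> ball c r" using \<open>q \<in> ball c r\<close> xy by simp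
    from du(4)[OF this] dv(4)[OF this]
    show "((\<lambda>t. pdy u (x, t) - pdy v (x, t) + \<epsilon> * (2 * (t - snd c))) has_field_derivative
        Dpart 0 2 u q - Dpart 0 2 v q + \<epsilon> * 2) (at y)"
      unfolding xy by (auto intro!: derivative_eq_intros)
  qed
  ultimately show False using lap[OF \<open>q \<in> ball c r\<close>] \<epsilon> by (simp add: laplacian_def)
qed

lemma harmonic_Re:
  assumes "G holomorphic_on ball (cx c) r" "is_Re_on (ball (cx c) r) w G"
  shows "Ck_plane k (ball c r) w" "Cinf_plane (ball c r) w" "p \<in> ball c r \<Longrightarrow> laplacian w p = 0"
    "analytic_plane (ball c r) w"
  using Ck_plane_Re[OF open_ball assms] laplacian_Re[OF open_ball assms] analytic_plane_Re[OF open_ball assms]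
  by (simp_all add: Cinf_plane_def vimage_cx_ball)

lemma harmonic_abs_le:
  fixes w :: "real \<times> real \<Rightarrow> real"
  assumes "Ck_plane 2 (ball c r) w" "continuous_on (cball c r) w"
    and "\<And>p. p \<in> ball c r \<Longrightarrow> laplacian w p = 0"
    and "\<And>p. p \<in> sphere c r \<Longrightarrow> \<bar>w p\<bar> \<le> M" "p \<in> cball c r"
  shows "\<bar>w p\<bar> \<le> M"
proof -
  have Z: "is_Re_on (ball (cx c) r) (\<lambda>_. 0) (\<lambda>_. 0)" by (simp add: is_Re_on_def)
  note Z' = harmonic_Re[OF holomorphic_on_const Z]
  have "w p \<le> 0 + M"
    by (rule harmonic_comparison[OF assms(1,2) Z'(1) continuous_on_const _ _ assms(5)])
       (use assms Z'(3) in \<open>auto simp: abs_le_iff\<close>)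
  moreover have "0 \<le> w p + M"
    by (rule harmonic_comparison[OF Z'(1) continuous_on_const assms(1,2) _ _ assms(5)])
       (use assms Z'(3) in \<open>force simp: abs_le_iff\<close>)+
  ultimately show ?thesis by simp
qed

section \<open>The Dirichlet problem on a disc\<close>

text \<open>The centre is kept general: the Taylor estimates apply the boundary theory on discs
  about arbitrary points of the large one.\<close>

definition circ :: "real \<times> real \<Rightarrow> real \<Rightarrow> (real \<times> real \<Rightarrow> real) \<Rightarrow> real \<Rightarrow> real" where
  "circ c r g t = g (c + (r * cos t, r * sin t))"

definition dirichlet_fun :: "real \<times> real \<Rightarrow> real \<Rightarrow> (real \<times> real \<Rightarrow> real) \<Rightarrow> real \<times> real \<Rightarrow> real" where
  "dirichlet_fun c r g p =
     (if p \<in> ball c r then Re (schwarz (cx c) r (circ c r g) (cx p)) else g p)"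

lemma cx_circ: "cx (c + (r * cos t, r * sin t)) = cx c + of_real r * cis t"
  by (simp add: cx_add complex_eq_iff)

lemma circ_mem_sphere: "r \<ge> 0 \<Longrightarrow> c + (r * cos t, r * sin t) \<in> sphere c r"
proof -
  assume "r \<ge> 0"
  have "dist c (c + (r * cos t, r * sin t)) = dist (cx c) (cx (c + (r * cos t, r * sin t)))" by simp
  also have "\<dots> = r" unfolding cx_circ using \<open>r \<ge> 0\<close> by (simp add: dist_norm norm_mult)
  finally show ?thesis by simp
qed

lemma sphere_circ:
  assumes "p \<in> sphere c r"
  obtains t where "t \<in> {-pi..pi}" "p = c + (r * cos t, r * sin t)"
proof -
  define z where "z = cx p - cx c"
  have r: "norm z = r" using assms dist_cx[of p c] by (simp add: z_def dist_norm norm_minus_commute)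
  have "z = of_real r * cis (Arg z)"
    using Arg_eq[of z] r by (cases "z = 0") (auto simp: cis_conv_exp)
  then have "cx p = cx (c + (r * cos (Arg z), r * sin (Arg z)))"
    unfolding cx_circ by (simp add: z_def)
  then have "p = c + (r * cos (Arg z), r * sin (Arg z))" by (metis Re_Im_cx)
  moreover have "Arg z \<in> {-pi..pi}" using Arg_bounded[of z] by simp
  ultimately show ?thesis by (rule that[rotated])
qed

lemma continuous_on_circ:
  assumes "r \<ge> 0" "continuous_on (sphere c r) g"
  shows "continuous_on A (circ c r g)"
  unfolding circ_def[abs_def]
proof (rule continuous_on_compose2[OF assms(2)])
  show "(\<lambda>t. c + (r * cos t, r * sin t)) ` A \<subseteq> sphere c r"
    using circ_mem_sphere[OF assms(1)] by blast
qed (intro continuous_intros)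

lemma circle_integral_abs_eq:
  "circle_integral c r (\<lambda>q. \<bar>w q\<bar>) = r * integral {-pi..pi} (\<lambda>t. \<bar>circ c r w t\<bar>)"
  by (simp add: circle_integral_def circ_def)

lemma circle_integral_abs_nonneg:
  assumes "r \<ge> 0" "continuous_on (sphere c r) w"
  shows "circle_integral c r (\<lambda>q. \<bar>w q\<bar>) \<ge> 0"
  unfolding circle_integral_abs_eq
  by (intro mult_nonneg_nonneg integral_nonneg integrable_continuous_interval continuous_intros continuous_on_circ assms)
     auto

lemma is_Re_on_dirichlet_fun:
  "is_Re_on (ball (cx c) r) (dirichlet_fun c r g) (schwarz (cx c) r (circ c r g))"
  by (simp add: is_Re_on_def dirichlet_fun_def del: cx_Pair)

lemma continuous_on_dirichlet_fun:
  assumes "r > 0" "continuous_on (sphere c r) g"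
  shows "continuous_on (cball c r) (dirichlet_fun c r g)"
proof -
  define g' where "g' = (\<lambda>z. g (Re z, Im z))"
  have g': "continuous_on (sphere (cx c) r) g'"
    unfolding g'_def
  proof (rule continuous_on_compose2[OF assms(2)])
    show "(\<lambda>z. (Re z, Im z)) ` sphere (cx c) r \<subseteq> sphere c r"
    proof clarify
      fix z assume "z \<in> sphere (cx c) r"
      then show "(Re z, Im z) \<in> sphere c r" using dist_cx[of c "(Re z, Im z)"] by simp
    qed
  qed (intro continuous_intros)
  have eq: "circ c r g = (\<lambda>t. g' (cx c + of_real r * cis t))"
    by (simp add: circ_def g'_def cx_def fun_eq_iff plus_prod_def)
  have "continuous_on (cball c r) (\<lambda>p. (\<lambda>w. if w \<in> ball (cx c) r then
       Re (schwarz (cx c) r (\<lambda>t. g' (cx c + of_real r * cis t)) w) else g' w) (cx p))"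
    by (rule continuous_on_compose2[OF continuous_on_schwarz_extension[OF assms(1) g'] continuous_on_cx])
       (auto simp del: cx_Pair)
  then show ?thesis
    by (rule continuous_on_eq) (simp add: dirichlet_fun_def eq, simp add: g'_def cx_def)
qed

lemma dirichlet_fun_sphere: "p \<in> sphere c r \<Longrightarrow> dirichlet_fun c r g p = g p"
  by (simp add: dirichlet_fun_def)

lemma holomorphic_schwarz_circ:
  assumes "r > 0" "continuous_on (sphere c r) g"
  shows "schwarz (cx c) r (circ c r g) holomorphic_on ball (cx c) r"
  by (intro holomorphic_schwarz continuous_on_circ) (use assms in auto)

lemma harmonic_unique:
  assumes "Ck_plane 2 (ball c r) u" "continuous_on (cball c r) u" "\<And>p. p \<in> ball c r \<Longrightarrow> laplacian u p = 0"
    and "Ck_plane 2 (ball c r) v" "continuous_on (cball c r) v" "\<And>p. p \<in> ball c r \<Longrightarrow> laplacian v p = 0"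
    and "\<And>p. p \<in> sphere c r \<Longrightarrow> u p = v p" "p \<in> cball c r"
  shows "u p = v p"
proof (rule antisym)
  show "u p \<le> v p"
    using harmonic_comparison[OF assms(1,2,4,5) _ _ assms(8), of 0] assms(3,6,7) by simp
  show "v p \<le> u p"
    using harmonic_comparison[OF assms(4,5,1,2) _ _ assms(8), of 0] assms(3,6,7) by simp
qed

text \<open>Yields derivative bounds by the integral of |u| over this very circle, whereas the
  representation on the large disc would bring in the original data.\<close>

lemma is_Re_on_schwarz:
  assumes "r > 0" "Ck_plane 2 (ball c r) u" "continuous_on (cball c r) u"
    "\<And>p. p \<in> ball c r \<Longrightarrow> laplacian u p = 0"
  shows "is_Re_on (ball (cx c) r) u (schwarz (cx c) r (circ c r u))"
proof -
  have cs: "continuous_on (sphere c r) u" using assms(3) by (rule continuous_on_subset) auto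
  note D = harmonic_Re[OF holomorphic_schwarz_circ[OF assms(1) cs] is_Re_on_dirichlet_fun]
  have "u p = dirichlet_fun c r u p" if "p \<in> ball c r" for p
    by (rule harmonic_unique[OF assms(2-4) D(1) continuous_on_dirichlet_fun[OF assms(1) cs] D(3)])
       (use that in \<open>auto simp: dirichlet_fun_sphere less_imp_le\<close>)
  then show ?thesis
    using is_Re_on_dirichlet_fun[of c r u] by (auto simp: is_Re_on_def simp del: cx_Pair)
qed

section \<open>Derivative estimates and the Taylor remainder\<close>

lemma norm_higher_deriv_schwarz_circ_le:
  assumes "r > 0" "continuous_on (sphere c r) g" "w \<in> ball (cx c) r" "k > 0"
  shows "norm ((deriv ^^ k) (schwarz (cx c) r (circ c r g)) w)
    \<le> fact k / (pi * (r - dist (cx c) w) ^ (k + 1)) * circle_integral c r (\<lambda>q. \<bar>g q\<bar>)"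
proof -
  have c: "continuous_on {-pi..pi} (circ c r g)" using assms by (intro continuous_on_circ) auto
  have "norm ((deriv ^^ k) (schwarz (cx c) r (circ c r g)) w)
      = fact k / pi * norm (cauchy_mom (cx c) r (circ c r g) k w)"
    using higher_deriv_schwarz[OF c assms(3,4)] by (simp add: norm_mult norm_divide)
  also have "\<dots> \<le> fact k / pi * (r / (r - dist (cx c) w) ^ Suc k * integral {-pi..pi} (\<lambda>t. \<bar>circ c r g t\<bar>))"
    by (intro mult_left_mono norm_cauchy_mom_le c assms) auto
  finally show ?thesis by (simp add: circle_integral_abs_eq)
qed

lemma Dpart_const: "Dpart a b (\<lambda>_. C) p = (if a + b = 0 then C else 0)"
proof -
  have "is_Re_on UNIV (\<lambda>_. C) (\<lambda>_. of_real C)" by (simp add: is_Re_on_def)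
  from is_Re_onD[OF is_Re_on_Dpart[OF open_UNIV holomorphic_on_const this, of a b], of p]
  show ?thesis by (simp del: cx_Pair)
qed

lemma Dpart_dirichlet_fun_le:
  assumes "R > 0" "continuous_on (sphere 0 R) g" "r < R" "p \<in> cball 0 r"
  shows "\<bar>Dpart a b (dirichlet_fun 0 R g) p\<bar>
    \<le> Dpart a b (\<lambda>_. -1 / (2 * pi * R) * circle_integral 0 R (\<lambda>q. \<bar>g q\<bar>)) p
      + fact (a + b) / (pi * (R - r) ^ (a + b + 1)) * circle_integral 0 R (\<lambda>q. \<bar>g q\<bar>)"
proof -
  define I where "I = circle_integral 0 R (\<lambda>q. \<bar>g q\<bar>)"
  have I: "I \<ge> 0" unfolding I_def by (rule circle_integral_abs_nonneg) (use assms in auto)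
  define F where "F = schwarz (cx 0) R (circ 0 R g)"
  have c: "continuous_on {-pi..pi} (circ 0 R g)" using assms by (intro continuous_on_circ) auto
  have hol: "F holomorphic_on ball (cx 0) R" unfolding F_def by (rule holomorphic_schwarz_circ[OF assms(1,2)])
  have p: "cx p \<in> ball (cx 0) R" using assms(3,4) by (simp del: cx_zero)
  have np: "norm p \<le> r" using assms(4) by simp
  have D: "Dpart a b (dirichlet_fun 0 R g) p = Re (\<i> ^ b * (deriv ^^ (a + b)) F (cx p))"
    using is_Re_onD[OF is_Re_on_Dpart[OF open_ball hol[unfolded F_def] is_Re_on_dirichlet_fun] p]
    by (simp add: F_def)
  show ?thesis
  proof (cases "a + b = 0")
    case False
    have "\<bar>Dpart a b (dirichlet_fun 0 R g) p\<bar> \<le> norm (\<i> ^ b * (deriv ^^ (a + b)) F (cx p))"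
      unfolding D by (rule abs_Re_le_cmod)
    also have "\<dots> = norm ((deriv ^^ (a + b)) F (cx p))" by (simp add: norm_mult norm_power)
    also have "\<dots> \<le> fact (a + b) / (pi * (R - dist (cx 0) (cx p)) ^ (a + b + 1)) * I"
      unfolding I_def F_def by (rule norm_higher_deriv_schwarz_circ_le) (use assms p False in auto)
    also have "\<dots> \<le> fact (a + b) / (pi * (R - r) ^ (a + b + 1)) * I"
      using assms(3) np I
      by (intro mult_right_mono divide_left_mono mult_left_mono power_mono mult_pos_pos zero_less_power) auto
    finally show ?thesis unfolding Dpart_const if_not_P[OF False] I_def[symmetric] by simp
  next
    \<comment> \<open>At order zero the kernel bound R / (\<pi> (R - |p|)) - 1 / (2\<pi>) is used;
      pulling out the arc length factor \<open>R\<close> turns its second term into the negative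
      summand of the claim.\<close>
    case True
    then have "\<bar>Dpart a b (dirichlet_fun 0 R g) p\<bar> = \<bar>Re (F (cx p))\<bar>" using D by simp
    also have "\<dots> \<le> (R / (pi * (R - norm p)) - 1 / (2 * pi)) * integral {-pi..pi} (\<lambda>t. \<bar>circ 0 R g t\<bar>)"
      using abs_Re_schwarz_le[OF c p] by (simp add: F_def)
    also have "\<dots> = - 1 / (2 * pi * R) * I + 1 / (pi * (R - norm p)) * I"
      using assms(1) by (simp add: I_def circle_integral_abs_eq field_simps)
    also have "\<dots> \<le> - 1 / (2 * pi * R) * I + 1 / (pi * (R - r)) * I"
      using assms(3) np I by (intro add_left_mono mult_right_mono divide_left_mono mult_left_mono) auto
    finally show ?thesis using True unfolding Dpart_const I_def by simp
  qed
qed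

text \<open>For \<open>k > 0\<close> Cauchy's estimate at the centre contains r^(-k), which |h| <
  \<kappa> r turns into \<kappa>^k; \<open>n \<ge> 1\<close> keeps the term of order zero, which has
  a different bound, out of the tail. The geometric sum supplies 1 / (1 - \<kappa>) and hence the
  denominator \<pi> (r - \<kappa> r). Only the last inequality passes from \<kappa> to 2\<kappa> /
  (1 - \<kappa>).\<close>

lemma taylor_harmonic:
  fixes u :: "real \<times> real \<Rightarrow> real"
  assumes "r > 0" "Ck_plane 2 (ball c r) u" "continuous_on (cball c r) u"
    "\<And>p. p \<in> ball c r \<Longrightarrow> laplacian u p = 0"
    and \<kappa>: "0 < \<kappa>" "\<kappa> < 1" "norm h < \<kappa> * r"
  shows "taylor_term u c h sums u (c + h)"
    and "n \<ge> 1 \<Longrightarrow> \<bar>u (c + h) - (\<Sum>k<n. taylor_term u c h k)\<bar>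
          \<le> (2 * \<kappa> / (1 - \<kappa>)) ^ n * (1 / (pi * (r - \<kappa> * r))) * circle_integral c r (\<lambda>q. \<bar>u q\<bar>)"
proof -
  define G where "G = schwarz (cx c) r (circ c r u)"
  have cs: "continuous_on (sphere c r) u" using assms(3) by (rule continuous_on_subset) auto
  have hol: "G holomorphic_on ball (cx c) r" unfolding G_def by (rule holomorphic_schwarz_circ[OF assms(1) cs])
  have re: "is_Re_on (ball (cx c) r) u G" unfolding G_def by (rule is_Re_on_schwarz[OF assms(1-4)])
  have c: "cx c \<in> ball (cx c) r" using assms(1) by simp
  have tt: "taylor_term u c h k = Re ((deriv ^^ k) G (cx c) / fact k * cx h ^ k)" for k
    by (rule taylor_term_Re[OF open_ball hol re c])
  have "\<kappa> * r \<le> 1 * r" using \<kappa> assms(1) by (intro mult_right_mono) auto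
  then have hr: "norm h < r" using \<kappa>(3) by simp
  have ch: "cx (c + h) \<in> ball (cx c) r" using hr by (simp add: cx_add dist_norm)
  have "(\<lambda>k. (deriv ^^ k) G (cx c) / fact k * (cx (c + h) - cx c) ^ k) sums G (cx (c + h))"
    by (rule holomorphic_power_series[OF hol ch])
  from sums_Re[OF this] show sums: "taylor_term u c h sums u (c + h)"
    using is_Re_onD[OF re ch] by (simp add: tt[abs_def] cx_add)
  define I where "I = circle_integral c r (\<lambda>q. \<bar>u q\<bar>)"
  have I: "I \<ge> 0" unfolding I_def by (rule circle_integral_abs_nonneg) (use assms(1) cs in auto)
  assume n: "n \<ge> 1"
  have le: "\<bar>taylor_term u c h k\<bar> \<le> \<kappa> ^ k * (I / (pi * r))" if "k > 0" for k
  proof -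
    have "\<bar>taylor_term u c h k\<bar> \<le> norm ((deriv ^^ k) G (cx c)) / fact k * norm h ^ k"
      unfolding tt using abs_Re_le_cmod[of "(deriv ^^ k) G (cx c) / fact k * cx h ^ k"]
      by (simp add: norm_mult norm_divide norm_power)
    also have "\<dots> \<le> (fact k / (pi * r ^ (k + 1)) * I) / fact k * (\<kappa> * r) ^ k"
      using norm_higher_deriv_schwarz_circ_le[OF assms(1) cs c that] \<kappa>(3) assms(1) \<kappa>(1) I
      by (intro mult_mono divide_right_mono power_mono) (auto simp: G_def I_def)
    also have "\<dots> = \<kappa> ^ k * (I / (pi * r))"
      using assms(1) by (simp add: power_mult_distrib field_simps)
    finally show ?thesis .
  qed
  have tail: "(\<lambda>k. taylor_term u c h (k + n)) sums (u (c + h) - (\<Sum>k<n. taylor_term u c h k))"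
    using sums by (subst sums_iff_shift) simp
  have geo: "(\<lambda>k. \<kappa> ^ k * (\<kappa> ^ n * (I / (pi * r)))) sums (1 / (1 - \<kappa>) * (\<kappa> ^ n * (I / (pi * r))))"
    using \<kappa> by (intro sums_mult2 geometric_sums) auto
  have "norm (u (c + h) - (\<Sum>k<n. taylor_term u c h k)) \<le> 1 / (1 - \<kappa>) * (\<kappa> ^ n * (I / (pi * r)))"
  proof (rule norm_sums_le[OF tail geo])
    fix k
    show "norm (taylor_term u c h (k + n)) \<le> \<kappa> ^ k * (\<kappa> ^ n * (I / (pi * r)))"
      using le[of "k + n"] n unfolding real_norm_def power_add mult.assoc by simp
  qed
  also have "\<dots> = \<kappa> ^ n * (1 / (pi * (r - \<kappa> * r)) * I)"
    using \<kappa> assms(1) by (simp add: field_simps)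
  also have "\<dots> \<le> (2 * \<kappa> / (1 - \<kappa>)) ^ n * (1 / (pi * (r - \<kappa> * r)) * I)"
  proof (intro mult_right_mono power_mono)
    have "\<kappa> * (1 - \<kappa>) \<le> \<kappa> * 2" using \<kappa> by (intro mult_left_mono) auto
    then show "\<kappa> \<le> 2 * \<kappa> / (1 - \<kappa>)" using \<kappa> by (simp add: le_divide_eq mult.commute)
    have "r - \<kappa> * r = r * (1 - \<kappa>)" by (simp add: algebra_simps)
    then have "r - \<kappa> * r > 0" using \<kappa> assms(1) by simp
    then show "0 \<le> 1 / (pi * (r - \<kappa> * r)) * I" using I by simp
  qed (use \<kappa> in auto)
  finally show "\<bar>u (c + h) - (\<Sum>k<n. taylor_term u c h k)\<bar>
          \<le> (2 * \<kappa> / (1 - \<kappa>)) ^ n * (1 / (pi * (r - \<kappa> * r))) * circle_integral c r (\<lambda>q. \<bar>u q\<bar>)"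
    by (simp add: I_def)
qed

section \<open>Decay of harmonic functions vanishing to high order at the centre\<close>

text \<open>On the circle \<open>\<bar>z\<bar> = s\<close> the factor \<open>(z/b)\<^sup>N + (b/z)\<^sup>N\<close> with \<open>\<bar>b\<bar> = s\<close> is real and bounded by \<open>2\<close>; at
  \<open>z = (\<rho>/s) b\<close> it is at least \<open>(s/\<rho>)\<^sup>N\<close>.  Multiplying by it therefore gains the decay, and the zero
  of order \<open>N\<close> cancels its pole.\<close>
lemma Re_decay:
  fixes F H :: "complex \<Rightarrow> complex"
  assumes "R > 0" and H: "H holomorphic_on ball 0 R" and F: "\<And>z. z \<in> ball 0 R \<Longrightarrow> F z = z ^ N * H z"
    and M: "\<And>z. z \<in> ball 0 R \<Longrightarrow> \<bar>Re (F z)\<bar> \<le> M"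
    and "N > 0" "z0 \<in> ball 0 R"
  shows "\<bar>Re (F z0)\<bar> \<le> 2 * M * (norm z0 / R) ^ N"
proof (cases "z0 = 0")
  case True
  then have "F z0 = 0" using F[of z0] assms by (simp add: zero_power)
  then show ?thesis using True assms(5) by (simp add: zero_power)
next
  case False
  define \<rho> where "\<rho> = norm z0"
  have \<rho>: "0 < \<rho>" "\<rho> < R" using False assms(6) by (auto simp: \<rho>_def)
  \<comment> \<open>The circle is taken strictly inside, because nothing is assumed about
    \<open>F\<close> or \<open>H\<close> on the circle of radius \<open>R\<close>; letting
    \<open>s\<close> tend to \<open>R\<close> gives the claim.\<close>
  have bound: "\<bar>Re (F z0)\<bar> \<le> 2 * M * (\<rho> / s) ^ N" if s: "\<rho> < s" "s < R" for s
  proof -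
    define b where "b = of_real (s / \<rho>) * z0"
    have s0: "s > 0" using \<rho> s by simp
    have nb: "norm b = s" using \<rho> s0 unfolding b_def norm_mult norm_of_real \<rho>_def[symmetric] by simp
    then have b0: "b \<noteq> 0" using s0 by auto
    define Q where "Q = (\<lambda>z. H z * (z ^ (2 * N) / b ^ N + b ^ N))"
    have Q: "Q holomorphic_on ball 0 R" unfolding Q_def by (intro holomorphic_intros H) (use b0 in auto)
    have Q_eq: "Q z = F z * ((z / b) ^ N + (b / z) ^ N)" if "z \<in> ball 0 R" "z \<noteq> 0" for z
      unfolding Q_def F[OF that(1)] power_even_eq power2_eq_square using that(2) b0
      by (simp add: power_divide field_simps)
    have re: "is_Re_on (ball (cx 0) R) (\<lambda>p. Re (Q (cx p))) Q" by (simp add: is_Re_on_def)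
    have re': "is_Re_on (ball (cx 0) s) (\<lambda>p. Re (Q (cx p))) Q" by (simp add: is_Re_on_def)
    have Q': "Q holomorphic_on ball (cx 0) s" by (rule holomorphic_on_subset[OF Q]) (use s in auto)
    note har = harmonic_Re[OF Q' re']
    have cQ: "continuous_on (cball 0 s) (\<lambda>p. Re (Q (cx p)))"
      by (intro continuous_intros continuous_on_compose2[OF holomorphic_on_imp_continuous_on[OF Q] continuous_on_cx])
         (use s in \<open>auto simp del: cx_Pair\<close>)
    have bQ: "\<bar>Re (Q (cx p))\<bar> \<le> 2 * M" if "p \<in> sphere 0 s" for p
    proof -
      define z where "z = cx p"
      have nz: "norm z = s" using that by (simp add: z_def)
      then have z: "z \<in> ball 0 R" "z \<noteq> 0" using s s0 by auto
      define y where "y = (z / b) ^ N"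
      have "norm (z / b) = 1" using nz nb s0 by (simp add: norm_divide)
      then have ny: "norm y = 1" by (simp add: y_def norm_power)
      then have "y * cnj y = 1" by (simp add: complex_norm_square[symmetric])
      moreover have "y * (b / z) ^ N = 1" using z b0 by (simp add: y_def flip: power_mult_distrib)
      ultimately have "(b / z) ^ N = cnj y"
        by (metis mult_left_cancel mult_zero_left zero_neq_one)
      then have "Q z = F z * of_real (2 * Re y)"
        using Q_eq[OF z] by (simp only: y_def[symmetric] complex_add_cnj)
      then have "\<bar>Re (Q z)\<bar> = \<bar>Re (F z)\<bar> * (2 * \<bar>Re y\<bar>)" by (simp add: abs_mult)
      also have "\<dots> \<le> M * (2 * 1)"
        using M[OF z(1)] abs_Re_le_cmod[of y] ny by (intro mult_mono) auto
      finally show ?thesis by (simp add: z_def)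
    qed
    have zs: "(Re z0, Im z0) \<in> cball 0 s"
      using s by (simp add: norm_Pair \<rho>_def cmod_def)
    have "\<bar>Re (Q (cx (Re z0, Im z0)))\<bar> \<le> 2 * M"
      by (rule harmonic_abs_le[OF har(1) cQ har(3) bQ zs])
    then have "\<bar>Re (Q z0)\<bar> \<le> 2 * M" by simp
    moreover have "Q z0 = F z0 * of_real ((\<rho> / s) ^ N + (s / \<rho>) ^ N)"
    proof -
      have "z0 / b = of_real (\<rho> / s)" "b / z0 = of_real (s / \<rho>)"
        using False \<rho> s0 by (auto simp: b_def)
      then show ?thesis using Q_eq[OF assms(6) False] by simp
    qed
    ultimately have "\<bar>Re (F z0)\<bar> * \<bar>(\<rho> / s) ^ N + (s / \<rho>) ^ N\<bar> \<le> 2 * M"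
      by (simp only: Re_mult_of_real abs_mult)
    moreover have "\<bar>Re (F z0)\<bar> * (s / \<rho>) ^ N \<le> \<bar>Re (F z0)\<bar> * \<bar>(\<rho> / s) ^ N + (s / \<rho>) ^ N\<bar>"
      using \<rho> s0 by (intro mult_left_mono) auto
    ultimately have le: "\<bar>Re (F z0)\<bar> * (s / \<rho>) ^ N \<le> 2 * M" by linarith
    have "\<bar>Re (F z0)\<bar> = \<bar>Re (F z0)\<bar> * (s / \<rho>) ^ N * (\<rho> / s) ^ N"
      using \<rho> s0 by (simp add: power_divide)
    also have "\<dots> \<le> 2 * M * (\<rho> / s) ^ N"
      using le \<rho> s0 by (intro mult_right_mono) auto
    finally show ?thesis .
  qed
  have "((\<lambda>s. 2 * M * (\<rho> / s) ^ N) \<longlongrightarrow> 2 * M * (\<rho> / R) ^ N) (at_left R)"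
    using assms(1) by (intro tendsto_intros) auto
  moreover have "\<forall>\<^sub>F s in at_left R. \<bar>Re (F z0)\<bar> \<le> 2 * M * (\<rho> / s) ^ N"
    using eventually_at_left_real[OF \<rho>(2)] by (rule eventually_mono) (use bound in auto)
  ultimately show ?thesis
    unfolding \<rho>_def[symmetric] by (intro tendsto_lowerbound) auto
qed

section \<open>The polynomial approximations\<close>

text \<open>The minus sign makes Re ((c - i d) z^k) = c Re z^k + d Im z^k, which are the two inner
  sums of \<open>approx_poly\<close>.\<close>

definition schwarz_coeff :: "real \<Rightarrow> (real \<Rightarrow> real) \<Rightarrow> nat \<Rightarrow> complex" where
  "schwarz_coeff R f k =
     (if k = 0 then of_real (coef_c R f 0 / 2) else Complex (coef_c R f k) (- coef_d R f k))"

text \<open>At the centre the kernel of the k-th moment reduces to f(t) R^(-k) e^(-ikt): Taylor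
  coefficients of the Schwarz integral are Fourier coefficients of the data.\<close>

lemma higher_deriv_schwarz_0:
  assumes "R > 0" "continuous_on {-pi..pi} f"
  shows "(deriv ^^ k) (schwarz 0 R f) 0 / fact k = schwarz_coeff R f k"
proof -
  define K where "K = (\<lambda>t. of_real (f t) * (of_real R * cis t) / (0 + of_real R * cis t - 0) ^ Suc k)"
  have zero: "0 \<in> ball (0::complex) R" using assms(1) by simp
  have K0: "(K has_integral cauchy_mom 0 R f k 0) {-pi..pi}"
    unfolding cauchy_mom_def K_def
    by (intro integrable_integral integrable_continuous_interval continuous_on_cauchy_mom_kernel'[OF assms(2) zero])
  have K: "K t = of_real (f t / R ^ k) * cis (- (real k * t))" for t
  proof -
    define z where "z = of_real R * cis t"
    have "z \<noteq> 0" using assms(1) by (simp add: z_def)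
    have "K t = of_real (f t) * z / (0 + z - 0) ^ Suc k" by (simp only: K_def z_def)
    also have "\<dots> = of_real (f t) * inverse (z ^ k)" using \<open>z \<noteq> 0\<close> by (simp add: field_simps)
    also have "z ^ k = of_real R ^ k * cis (real k * t)" by (simp add: z_def power_mult_distrib Complex.DeMoivre)
    finally show ?thesis by (simp add: cis_inverse inverse_mult_distrib divide_inverse)
  qed
  have K_int: "((\<lambda>t. of_real (f t / R ^ k) * cis (- (real k * t))) has_integral cauchy_mom 0 R f k 0) {-pi..pi}"
    using K0 unfolding ext[of K, OF K] .
  have "((\<lambda>t. (f t / R ^ k) * cos (real k * t)) has_integral Re (cauchy_mom 0 R f k 0)) {-pi..pi}"
    using has_integral_Re[OF K_int] by (simp only: Re_of_real_mult cis.sel cos_minus)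
  from has_integral_mult_right[OF this, of "R ^ k"]
  have "((\<lambda>t. f t * cos (real k * t)) has_integral R ^ k * Re (cauchy_mom 0 R f k 0)) {-pi..pi}"
    using assms(1) by simp
  then have re: "coef_c R f k = Re (cauchy_mom 0 R f k 0) / pi"
    using assms(1) by (simp add: coef_c_def integral_unique)
  have "((\<lambda>t. (f t / R ^ k) * - sin (real k * t)) has_integral Im (cauchy_mom 0 R f k 0)) {-pi..pi}"
    using has_integral_Im[OF K_int] by simp
  from has_integral_mult_right[OF this, of "- (R ^ k)"]
  have "((\<lambda>t. f t * sin (real k * t)) has_integral - (R ^ k) * Im (cauchy_mom 0 R f k 0)) {-pi..pi}"
    using assms(1) by simp
  then have im: "coef_d R f k = - Im (cauchy_mom 0 R f k 0) / pi"
    using assms(1) by (simp add: coef_d_def integral_unique)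
  show ?thesis
  proof (cases "k = 0")
    case False
    then have "(deriv ^^ k) (schwarz 0 R f) 0 / fact k = cauchy_mom 0 R f k 0 / of_real pi"
      using higher_deriv_schwarz[OF assms(2) zero, of k] by simp
    then show ?thesis using False re im by (simp add: schwarz_coeff_def complex_eq_iff)
  next
    case True
    \<comment> \<open>Here 1/\<pi> minus the subtracted 1/(2\<pi>) leaves 1/(2\<pi>), whence the
      halved constant coefficient.\<close>
    have "cauchy_mom 0 R f 0 0 = of_real (integral {-pi..pi} f)"
    proof (rule has_integral_unique)
      show "((\<lambda>t. complex_of_real (f t)) has_integral cauchy_mom 0 R f 0 0) {-pi..pi}"
        using K_int True by simp
      show "((\<lambda>t. complex_of_real (f t)) has_integral of_real (integral {-pi..pi} f)) {-pi..pi}"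
        by (intro has_integral_of_real integrable_integral integrable_continuous_interval assms(2))
    qed
    then show ?thesis using True by (simp add: schwarz_def schwarz_coeff_def coef_c_def)
  qed
qed

section \<open>From complex powers to the stated polynomials and Fourier sums\<close>

lemma i_power_even: "even j \<Longrightarrow> \<i> ^ j = of_real ((-1) ^ (j div 2))"
  by (auto elim!: evenE simp: power_mult)

lemma i_power_odd: "odd j \<Longrightarrow> \<i> ^ j = \<i> * of_real ((-1) ^ ((j - 1) div 2))"
  by (auto elim!: oddE simp: power_mult)

lemma Re_cx_power:
  "Re (cx (x, y) ^ k) = (\<Sum>j | j \<le> k \<and> even j. (-1) ^ (j div 2) * real (k choose j) * x ^ (k - j) * y ^ j)"
proof -
  have "Re (cx (x, y) ^ k) = (\<Sum>j\<le>k. Re (1 * of_nat (k choose j) * \<i> ^ j) * (x ^ (k - j) * y ^ j))"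
    using cx_power_expand[of 1 "(x, y)" k] by (simp only: mult_1_left Re_sum Re_mult_of_real fst_conv snd_conv)
  also have "\<dots> = (\<Sum>j\<le>k. if even j then (-1) ^ (j div 2) * real (k choose j) * x ^ (k - j) * y ^ j else 0)"
    by (intro sum.cong) (auto simp: i_power_even i_power_odd)
  also have "\<dots> = (\<Sum>j | j \<in> {..k} \<and> even j. (-1) ^ (j div 2) * real (k choose j) * x ^ (k - j) * y ^ j)"
    by (rule sum.inter_filter[symmetric]) simp
  finally show ?thesis by simp
qed

lemma Im_cx_power:
  "Im (cx (x, y) ^ k) = (\<Sum>j | j \<le> k \<and> odd j. (-1) ^ ((j - 1) div 2) * real (k choose j) * x ^ (k - j) * y ^ j)"
proof -
  have "Im (cx (x, y) ^ k) = (\<Sum>j\<le>k. Im (1 * of_nat (k choose j) * \<i> ^ j * of_real (x ^ (k - j) * y ^ j)))"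
    using cx_power_expand[of 1 "(x, y)" k] by (simp only: mult_1_left Im_sum fst_conv snd_conv)
  also have "\<dots> = (\<Sum>j\<le>k. if odd j then (-1) ^ ((j - 1) div 2) * real (k choose j) * x ^ (k - j) * y ^ j else 0)"
    by (intro sum.cong) (auto simp: i_power_even i_power_odd)
  also have "\<dots> = (\<Sum>j | j \<in> {..k} \<and> odd j. (-1) ^ ((j - 1) div 2) * real (k choose j) * x ^ (k - j) * y ^ j)"
    by (rule sum.inter_filter[symmetric]) simp
  finally show ?thesis by simp
qed

lemma sum_atMost_shift1: "(\<Sum>k\<le>n. f k) = f 0 + (\<Sum>k=1..n. f k)" for f :: "nat \<Rightarrow> 'a::comm_monoid_add"
  by (simp add: atMost_atLeast0 sum.atLeast_Suc_atMost)

lemma approx_poly_eq_Re: "approx_poly R f n p = Re (\<Sum>k\<le>n. schwarz_coeff R f k * cx p ^ k)"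
proof -
  obtain x y where p: "p = (x, y)" by (cases p)
  show ?thesis
    unfolding p approx_poly_def prod.case Re_cx_power[symmetric] Im_cx_power[symmetric]
      sum_atMost_shift1 plus_complex.sel Re_sum
    by (intro arg_cong2[where f = "(+)"] sum.cong) (auto simp: schwarz_coeff_def simp del: cx_Pair)
qed

text \<open>The power R^k of the monomials cancels the R^(-k) in the coefficients.\<close>

lemma approx_poly_circle:
  assumes "R > 0"
  shows "approx_poly R f n (R * cos \<theta>, R * sin \<theta>) = fourier_sum f n \<theta>"
proof -
  have cx: "cx (R * cos \<theta>, R * sin \<theta>) ^ k = of_real (R ^ k) * cis (real k * \<theta>)" for k
  proof -
    have "cx (R * cos \<theta>, R * sin \<theta>) = of_real R * cis \<theta>" by (simp add: complex_eq_iff)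
    then show ?thesis by (simp only: power_mult_distrib Complex.DeMoivre of_real_power)
  qed
  show ?thesis
    unfolding approx_poly_eq_Re cx fourier_sum_def sum_atMost_shift1 plus_complex.sel Re_sum
    by (intro arg_cong2[where f = "(+)"] sum.cong)
       (use assms in \<open>auto simp: schwarz_coeff_def coef_c_def coef_d_def algebra_simps\<close>)
qed

lemma power_series_split:
  fixes F :: "complex \<Rightarrow> complex"
  assumes "F holomorphic_on ball 0 R"
  obtains H where "H holomorphic_on ball 0 R"
    "\<And>z. z \<in> ball 0 R \<Longrightarrow> F z - (\<Sum>k<N. (deriv ^^ k) F 0 / fact k * z ^ k) = z ^ N * H z"
proof -
  define a where "a = (\<lambda>k. (deriv ^^ k) F 0 / fact k)"
  have ps: "(\<lambda>k. a k * z ^ k) sums F z" if "z \<in> ball 0 R" for z :: complex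
    using holomorphic_power_series[OF assms that] by (simp add: a_def)
  have H: "(\<lambda>k. a (k + N) * z ^ k) sums (\<Sum>k. a (k + N) * z ^ k)" if "z \<in> ball 0 R" for z :: complex
    using sums_summable[OF ps[OF that]] summable_powser_ignore_initial_segment[of a N z]
    by (simp add: summable_sums)
  show ?thesis
  proof
    show "(\<lambda>z. \<Sum>k. a (k + N) * z ^ k) holomorphic_on ball 0 R"
      by (rule power_series_holomorphic[where a = "\<lambda>k. a (k + N)"]) (use H in simp)
    fix z :: complex assume z: "z \<in> ball 0 R"
    have "(\<lambda>k. a (k + N) * z ^ (k + N)) sums (F z - (\<Sum>k<N. a k * z ^ k))"
      using ps[OF z] by (subst sums_iff_shift) simp
    moreover have "(\<lambda>k. z ^ N * (a (k + N) * z ^ k)) sums (z ^ N * (\<Sum>k. a (k + N) * z ^ k))"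
      by (intro sums_mult H z)
    ultimately have "F z - (\<Sum>k<N. a k * z ^ k) = z ^ N * (\<Sum>k. a (k + N) * z ^ k)"
      by (auto intro!: sums_unique2 simp: power_add mult_ac)
    then show "F z - (\<Sum>k<N. (deriv ^^ k) F 0 / fact k * z ^ k) = z ^ N * (\<Sum>k. a (k + N) * z ^ k)"
      by (simp add: a_def)
  qed
qed

lemma circ_0_eq_bdry_fun: "circ 0 R g = bdry_fun R g"
  by (simp add: circ_def bdry_fun_def fun_eq_iff)

text \<open>The polynomial is the real part of the Taylor polynomial of degree \<open>n\<close>, so
  the difference vanishes to order \<open>n + 1\<close>. The bound \<open>M\<close> is left open
  because uniform convergence and the rates insert different values.\<close>

lemma approx_poly_error:
  assumes "R > 0" "continuous_on (sphere 0 R) g"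
    and M: "\<And>\<theta>. \<theta> \<in> {-pi..pi} \<Longrightarrow> \<bar>bdry_fun R g \<theta> - fourier_sum (bdry_fun R g) n \<theta>\<bar> \<le> M"
    and p: "p \<in> cball 0 R"
  shows "\<bar>dirichlet_fun 0 R g p - approx_poly R (bdry_fun R g) n p\<bar> \<le> 2 * M * (norm p / R) ^ (n + 1)"
proof -
  define f where "f = bdry_fun R g"
  define F where "F = schwarz 0 R f"
  define P where "P = (\<lambda>z. \<Sum>k\<le>n. schwarz_coeff R f k * z ^ k)"
  define v where "v = (\<lambda>p. dirichlet_fun 0 R g p - approx_poly R f n p)"
  have cf: "continuous_on {-pi..pi} f"
    unfolding f_def circ_0_eq_bdry_fun[symmetric] by (intro continuous_on_circ) (use assms in auto)
  have F: "F holomorphic_on ball 0 R" unfolding F_def by (rule holomorphic_schwarz[OF cf])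
  have FP: "(\<lambda>z. F z - P z) holomorphic_on ball (cx 0) R"
    unfolding P_def using F by (auto intro!: holomorphic_intros)
  have re: "is_Re_on (ball (cx 0) R) v (\<lambda>z. F z - P z)"
    using is_Re_on_dirichlet_fun[of 0 R g]
    by (simp add: is_Re_on_def v_def approx_poly_eq_Re P_def F_def f_def circ_0_eq_bdry_fun del: cx_Pair)
  note har = harmonic_Re[OF FP re]
  have "continuous_on (cball 0 R) v"
    unfolding v_def approx_poly_eq_Re
    by (intro continuous_intros continuous_on_dirichlet_fun assms)
  moreover have "\<bar>v q\<bar> \<le> M" if q: "q \<in> sphere 0 R" for q
  proof -
    obtain t where t: "t \<in> {-pi..pi}" "q = (R * cos t, R * sin t)"
      using sphere_circ[OF q] by auto
    have "v q = f t - fourier_sum f n t"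
      using q approx_poly_circle[OF assms(1)]
      by (simp add: v_def dirichlet_fun_sphere t(2) f_def bdry_fun_def)
    then show ?thesis using M[OF t(1)] by (simp add: f_def)
  qed
  ultimately have v_le: "\<bar>v q\<bar> \<le> M" if "q \<in> cball 0 R" for q
    using harmonic_abs_le[OF har(1) _ har(3)] that by blast
  have "M \<ge> 0" using v_le[OF p] by linarith
  have "\<bar>v p\<bar> \<le> 2 * M * (norm p / R) ^ (n + 1)"
  \<comment> \<open>The decay lemma speaks of interior points only; on the circle the decay factor
    is 1 and the bound \<open>M\<close> itself suffices.\<close>
  proof (cases "p \<in> ball 0 R")
    case False
    then have "norm p = R" using p by simp
    then show ?thesis using v_le[OF p] \<open>M \<ge> 0\<close> assms(1) by simp
  next
    case True
    obtain H where H: "H holomorphic_on ball 0 R"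
      "\<And>z. z \<in> ball 0 R \<Longrightarrow> F z - (\<Sum>k<n+1. (deriv ^^ k) F 0 / fact k * z ^ k) = z ^ (n + 1) * H z"
      using power_series_split[OF F] by blast
    have eq: "F z - P z = z ^ (n + 1) * H z" if "z \<in> ball 0 R" for z :: complex
      using H(2)[OF that] higher_deriv_schwarz_0[OF assms(1) cf]
      by (simp add: P_def F_def lessThan_Suc_atMost)
    have "\<bar>Re (F (cx p) - P (cx p))\<bar> \<le> 2 * M * (norm (cx p) / R) ^ (n + 1)"
    proof (rule Re_decay[OF assms(1) H(1) eq])
      fix z assume z: "z \<in> ball (0::complex) R"
      have "v (Re z, Im z) = Re (F z - P z)"
        using is_Re_onD[OF re, of "(Re z, Im z)"] z by simp
      moreover have "(Re z, Im z) \<in> cball 0 R" using z by (simp add: norm_Pair cmod_def)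
      ultimately show "\<bar>Re (F z - P z)\<bar> \<le> M" using v_le[of "(Re z, Im z)"] by (simp only:)
    next
      show "cx p \<in> ball 0 R" using True by (simp del: cx_Pair)
    next
      show "0 < n + 1" by simp
    qed
    then show ?thesis using is_Re_onD[OF re, of p] True by simp
  qed
  then show ?thesis by (simp add: v_def f_def)
qed

section \<open>Uniform convergence of Fourier series of Hoelder functions\<close>

text \<open>For a shift b \<ge> 0 the piece lost over [-\<pi>, -\<pi> + b] reappears over
  [\<pi>, \<pi> + b]. A negative shift is undone by a positive one applied to the shifted
  function.\<close>

lemma integral_periodic_shift:
  fixes h :: "real \<Rightarrow> 'a::banach"
  assumes "continuous_on UNIV h" and per: "\<And>t. h (t + 2 * pi) = h t"
  shows "integral {-pi..pi} (\<lambda>t. h (t + a)) = integral {-pi..pi} h"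
proof -
  have nonneg: "integral {-pi..pi} (\<lambda>t. k (t + b)) = integral {-pi..pi} k"
    if "b \<ge> 0" and c: "continuous_on UNIV k" and p: "\<And>t. k (t + 2 * pi) = k t" for b :: real and k :: "real \<Rightarrow> 'a"
  proof -
    have int: "k integrable_on {x..y}" for x y
      by (intro integrable_continuous_interval continuous_on_subset[OF c]) auto
    have "integral {-pi..-pi + b} k + integral {-pi + b..pi + b} k = integral {-pi..pi + b} k"
      using that(1) by (intro Henstock_Kurzweil_Integration.integral_combine int) auto
    moreover have "integral {-pi..pi} k + integral {pi..pi + b} k = integral {-pi..pi + b} k"
      using that(1) by (intro Henstock_Kurzweil_Integration.integral_combine int) auto
    moreover have "integral {-pi..-pi + b} k = integral {pi..pi + b} k"
      using integral_shift_Icc_real[of "-pi" "-pi + b" k "2 * pi"] p by (simp add: o_def add.commute)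
    moreover have "integral {-pi..pi} (\<lambda>t. k (t + b)) = integral {-pi + b..pi + b} k"
      using integral_shift_Icc_real[of "-pi" pi k b] by (simp add: o_def add.commute)
    ultimately show ?thesis by (metis add.commute add_right_cancel)
  qed
  show ?thesis
  proof (cases "a \<ge> 0")
    case True
    then show ?thesis by (rule nonneg[OF _ assms])
  next
    case False
    have "integral {-pi..pi} (\<lambda>t. h (t + (- a) + a)) = integral {-pi..pi} (\<lambda>t. h (t + a))"
    proof (rule nonneg)
      show "continuous_on UNIV (\<lambda>t. h (t + a))"
        by (intro continuous_on_compose2[OF assms(1)] continuous_intros) auto
      show "h (t + 2 * pi + a) = h (t + a)" for t using per[of "t + a"] by (simp add: ac_simps)
    qed (use False in simp)
    then show ?thesis by simp
  qed
qed

text \<open>Equal to sin ((n + 1/2) t) / sin (t / 2) where the denominator is nonzero.\<close>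

definition dirichlet_ker :: "nat \<Rightarrow> real \<Rightarrow> real" where
  "dirichlet_ker n t = 1 + 2 * (\<Sum>k=1..n. cos (real k * t))"

text \<open>Multiplication by cis t - 1 telescopes the sum of all exponentials of frequencies -n to
  n. The product form holds also at the zeros of cis t - 1 and leaves two integer frequencies, as
  the Riemann-Lebesgue lemma below requires.\<close>

lemma dirichlet_ker_mult:
  "of_real (dirichlet_ker n t) * (cis t - 1) = cis (of_int (int n + 1) * t) - cis (of_int (- int n) * t)"
proof (induction n)
  case (Suc n)
  define c where "c = complex_of_real (2 * cos (real (Suc n) * t))"
  have c: "c = cis (real (Suc n) * t) + cis (- (real (Suc n) * t))"
    by (simp add: c_def complex_eq_iff)
  have "of_real (dirichlet_ker (Suc n) t) * (cis t - 1) = of_real (dirichlet_ker n t) * (cis t - 1) + c * (cis t - 1)"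
    by (simp add: dirichlet_ker_def c_def algebra_simps)
  also have "c * (cis t - 1) = cis (real (Suc n) * t + t) + cis (- (real (Suc n) * t) + t)
       - cis (real (Suc n) * t) - cis (- (real (Suc n) * t))"
    by (simp only: c algebra_simps cis_mult[symmetric]) simp
  also have "cis (- (real (Suc n) * t) + t) = cis (of_int (- int n) * t)" by (simp add: algebra_simps)
  also have "cis (real (Suc n) * t + t) = cis (of_int (int (Suc n) + 1) * t)" by (simp add: algebra_simps)
  also have "cis (- (real (Suc n) * t)) = cis (of_int (- int (Suc n)) * t)" by (simp add: algebra_simps)
  finally show ?case unfolding Suc by (simp add: algebra_simps)
qed (simp add: dirichlet_ker_def)

lemma continuous_on_dirichlet_ker [continuous_intros]: "continuous_on A (dirichlet_ker n)"
  unfolding dirichlet_ker_def[abs_def] by (intro continuous_intros)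

lemma has_integral_dirichlet_ker: "(dirichlet_ker n has_integral 2 * pi) {-pi..pi}"
proof -
  have "((\<lambda>t. cos (real k * t)) has_integral 0) {-pi..pi}" if "k \<in> {1..n}" for k
    using has_integral_Re[OF has_integral_cis_multiple[of "int k"]] that by simp
  then have "((\<lambda>t. 1 + 2 * (\<Sum>k=1..n. cos (real k * t))) has_integral (2 * pi + 2 * (\<Sum>k=1..n. 0))) {-pi..pi}"
    using has_integral_const_real[of "1::real" "-pi" pi]
    by (intro has_integral_add has_integral_mult_right has_integral_sum) auto
  then show ?thesis by (simp add: dirichlet_ker_def[abs_def])
qed

lemma dirichlet_ker_periodic: "dirichlet_ker n (t + 2 * pi) = dirichlet_ker n t"
proof -
  have "cos (real k * (t + 2 * pi)) = cos (real k * t)" for k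
  proof -
    have "real k * (t + 2 * pi) = real k * t + 2 * real k * pi" by (simp add: algebra_simps)
    then show ?thesis using cos_2npi[of k] sin_2npi[of k] by (simp add: cos_add mult.assoc mult.left_commute)
  qed
  then show ?thesis by (simp add: dirichlet_ker_def)
qed

text \<open>The partial sum is a convolution, recentred at \<theta> by periodicity. The total mass
  2\<pi> of the kernel brings \<open>f \<theta>\<close> under the integral, where a Hoelder bound
  can tame the kernel near 0.\<close>

lemma fourier_sum_eq_dirichlet:
  fixes f :: "real \<Rightarrow> real"
  assumes "continuous_on UNIV f" "\<And>t. f (t + 2 * pi) = f t"
  shows "2 * pi * (fourier_sum f n \<theta> - f \<theta>) = integral {-pi..pi} (\<lambda>t. (f (t + \<theta>) - f \<theta>) * dirichlet_ker n t)"
proof -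
  have cf: "continuous_on A f" for A by (rule continuous_on_subset[OF assms(1)]) auto
  have int: "(\<lambda>t. f t * cos (real k * t)) integrable_on {-pi..pi}" "(\<lambda>t. f t * sin (real k * t)) integrable_on {-pi..pi}" for k
    by (intro integrable_continuous_interval continuous_intros cf)+
  have "(\<lambda>t. f t * dirichlet_ker n (t - \<theta>)) =
     (\<lambda>t. f t * cos (real 0 * t) + (\<Sum>k=1..n. 2 * (cos (real k * \<theta>) * (f t * cos (real k * t)) + sin (real k * \<theta>) * (f t * sin (real k * t)))))"
    by (simp add: dirichlet_ker_def fun_eq_iff right_diff_distrib cos_diff sum_distrib_left algebra_simps)
  moreover have "((\<lambda>t. f t * cos (real 0 * t) + (\<Sum>k=1..n. 2 * (cos (real k * \<theta>) * (f t * cos (real k * t)) + sin (real k * \<theta>) * (f t * sin (real k * t)))))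
      has_integral (integral {-pi..pi} (\<lambda>t. f t * cos (real 0 * t)) +
     (\<Sum>k=1..n. 2 * (cos (real k * \<theta>) * integral {-pi..pi} (\<lambda>t. f t * cos (real k * t))
        + sin (real k * \<theta>) * integral {-pi..pi} (\<lambda>t. f t * sin (real k * t)))))) {-pi..pi}"
    by (intro has_integral_add has_integral_sum has_integral_mult_right integrable_integral int) auto
  moreover have "integral {-pi..pi} (\<lambda>t. f t * cos (real 0 * t)) +
     (\<Sum>k=1..n. 2 * (cos (real k * \<theta>) * integral {-pi..pi} (\<lambda>t. f t * cos (real k * t))
        + sin (real k * \<theta>) * integral {-pi..pi} (\<lambda>t. f t * sin (real k * t)))) = 2 * pi * fourier_sum f n \<theta>"
    unfolding fourier_sum_def distrib_left[of "2 * pi"] sum_distrib_left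
    by (intro arg_cong2[where f = "(+)"] sum.cong) (simp_all add: field_simps)
  ultimately have "integral {-pi..pi} (\<lambda>t. f t * dirichlet_ker n (t - \<theta>)) = 2 * pi * fourier_sum f n \<theta>"
    by (simp only: integral_unique)
  moreover have "integral {-pi..pi} (\<lambda>t. f (t + \<theta>) * dirichlet_ker n (t + \<theta> - \<theta>)) =
      integral {-pi..pi} (\<lambda>t. f t * dirichlet_ker n (t - \<theta>))"
  proof (rule integral_periodic_shift)
    show "continuous_on UNIV (\<lambda>t. f t * dirichlet_ker n (t - \<theta>))"
      by (intro continuous_intros assms(1) continuous_on_compose2[OF continuous_on_dirichlet_ker[of UNIV]]) auto
    show "f (t + 2 * pi) * dirichlet_ker n (t + 2 * pi - \<theta>) = f t * dirichlet_ker n (t - \<theta>)" for t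
      using dirichlet_ker_periodic[of n "t - \<theta>"] assms(2)[of t] by (simp add: algebra_simps)
  qed
  moreover have "integral {-pi..pi} (\<lambda>t. (f (t + \<theta>) - f \<theta>) * dirichlet_ker n t) =
      integral {-pi..pi} (\<lambda>t. f (t + \<theta>) * dirichlet_ker n t) - f \<theta> * (2 * pi)"
  proof -
    have "((\<lambda>t. f (t + \<theta>) * dirichlet_ker n t - f \<theta> * dirichlet_ker n t) has_integral
        (integral {-pi..pi} (\<lambda>t. f (t + \<theta>) * dirichlet_ker n t) - f \<theta> * (2 * pi))) {-pi..pi}"
      by (intro has_integral_diff has_integral_mult_right has_integral_dirichlet_ker integrable_integral
          integrable_continuous_interval continuous_intros continuous_on_compose2[OF assms(1)]) auto
    then show ?thesis by (simp add: integral_unique left_diff_distrib)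
  qed
  ultimately show ?thesis by (simp add: algebra_simps)
qed

text \<open>Riemann--Lebesgue by shifting: translating by \<open>\<pi>/m\<close> changes the sign of \<open>cis (m t)\<close>.\<close>
lemma riemann_lebesgue_uniform:
  fixes p :: "real \<Rightarrow> real \<Rightarrow> complex"
  assumes cont: "continuous_on UNIV (\<lambda>(\<theta>, t). p \<theta> t)" and per: "\<And>\<theta> t. p \<theta> (t + 2 * pi) = p \<theta> t"
    and "\<epsilon> > 0"
  shows "\<exists>N::nat. \<forall>m::int. \<forall>\<theta>\<in>{-pi..pi}. \<bar>m\<bar> \<ge> int N \<longrightarrow>
    norm (integral {-pi..pi} (\<lambda>t. p \<theta> t * cis (of_int m * t))) \<le> \<epsilon>"
proof -
  \<comment> \<open>The second factor is twice as long as the period so that it also contains the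
    translates by \<pi>/m.\<close>
  have "uniformly_continuous_on ({-pi..pi} \<times> {-2*pi..2*pi}) (\<lambda>(\<theta>, t). p \<theta> t)"
    by (intro compact_uniformly_continuous continuous_on_subset[OF cont] compact_Times) auto
  moreover have "\<epsilon> / pi > 0" using assms(3) by simp
  ultimately obtain d where d: "d > 0" "\<And>x y. x \<in> {-pi..pi} \<times> {-2*pi..2*pi} \<Longrightarrow> y \<in> {-pi..pi} \<times> {-2*pi..2*pi} \<Longrightarrow>
      dist y x < d \<Longrightarrow> dist (case y of (\<theta>, t) \<Rightarrow> p \<theta> t) (case x of (\<theta>, t) \<Rightarrow> p \<theta> t) < \<epsilon> / pi"
    unfolding uniformly_continuous_on_def by metis
  \<comment> \<open>The first condition makes the translation \<pi>/m shorter than \<open>d\<close>;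
    the second excludes \<open>m = 0\<close> and keeps the translation within \<pi>.\<close>
  obtain N :: nat where N: "N > pi / d" "N > 0"
    using reals_Archimedean2[of "max 1 (pi / d)"] by auto
  have "norm (integral {-pi..pi} (\<lambda>t. p \<theta> t * cis (of_int m * t))) \<le> \<epsilon>"
    if m: "\<bar>m\<bar> \<ge> int N" and \<theta>: "\<theta> \<in> {-pi..pi}" for m \<theta>
  proof -
    define a where "a = pi / of_int m"
    have m0: "m \<noteq> 0" using m N(2) by auto
    have absm: "\<bar>real_of_int m\<bar> \<ge> real N" using m by linarith
    have "pi / \<bar>real_of_int m\<bar> \<le> pi / real N" using absm N(2) by (intro divide_left_mono mult_pos_pos) auto
    also have "\<dots> < d" using N d(1) by (simp add: divide_simps mult.commute)
    finally have "\<bar>a\<bar> < d" by (simp add: a_def abs_divide)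
    have "pi / \<bar>real_of_int m\<bar> \<le> pi / 1" using absm N(2) by (intro divide_left_mono mult_pos_pos) auto
    then have "\<bar>a\<bar> \<le> pi" by (simp add: a_def abs_divide)
    define h where "h = (\<lambda>t. p \<theta> t * cis (of_int m * t))"
    have cp: "continuous_on UNIV (p \<theta>)"
      using continuous_on_compose2[OF cont continuous_on_Pair[OF continuous_on_const continuous_on_id]] by simp
    have ch: "continuous_on UNIV h" unfolding h_def by (intro continuous_intros cp)
    have hper: "h (t + 2 * pi) = h t" for t
    proof -
      have "cis (of_int m * (t + 2 * pi)) = cis (of_int m * t) * cis (2 * pi * of_int m)"
        by (simp add: cis_mult algebra_simps)
      also have "cis (2 * pi * of_int m) = 1" by (rule cis_multiple_2pi) simp
      finally show ?thesis using per by (simp add: h_def)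
    qed
    have "h (t + a) = - (p \<theta> (t + a) * cis (of_int m * t))" for t
    proof -
      have "of_int m * (t + a) = of_int m * t + pi" using m0 by (simp add: a_def algebra_simps)
      then have "cis (of_int m * (t + a)) = - cis (of_int m * t)" by (simp add: complex_eq_iff)
      then show ?thesis by (simp add: h_def)
    qed
    then have "integral {-pi..pi} h = integral {-pi..pi} (\<lambda>t. - (p \<theta> (t + a) * cis (of_int m * t)))"
      using integral_periodic_shift[OF ch hper, of a] by simp
    moreover have i1: "h integrable_on {-pi..pi}"
      by (intro integrable_continuous_interval continuous_on_subset[OF ch]) auto
    moreover have cpa: "continuous_on A (\<lambda>t. p \<theta> (t + a))" for A
      by (intro continuous_on_compose2[OF cp] continuous_intros) auto
    moreover have i2: "(\<lambda>t. - (p \<theta> (t + a) * cis (of_int m * t))) integrable_on {-pi..pi}"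
      by (intro integrable_continuous_interval continuous_intros cpa)
    ultimately have "2 * integral {-pi..pi} h = integral {-pi..pi} (\<lambda>t. h t + - (p \<theta> (t + a) * cis (of_int m * t)))"
      by (simp only: integral_add mult_2)
    then have "norm (2 * integral {-pi..pi} h) = norm (integral {-pi..pi} (\<lambda>t. h t + - (p \<theta> (t + a) * cis (of_int m * t))))"
      by (simp only:)
    also have "\<dots> \<le> (\<epsilon> / pi) * (pi - (- pi))"
    proof (rule integral_bound)
      show "continuous_on {-pi..pi} (\<lambda>t. h t + - (p \<theta> (t + a) * cis (of_int m * t)))"
        by (intro continuous_intros continuous_on_subset[OF ch] cpa) auto
      fix t assume t: "t \<in> {-pi..pi}"
      have "h t + - (p \<theta> (t + a) * cis (of_int m * t)) = (p \<theta> t - p \<theta> (t + a)) * cis (of_int m * t)"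
        by (simp add: h_def algebra_simps)
      then have "norm (h t + - (p \<theta> (t + a) * cis (of_int m * t))) = dist (p \<theta> t) (p \<theta> (t + a))"
        by (simp add: norm_mult dist_norm)
      also have "\<dots> \<le> \<epsilon> / pi"
      proof -
        have "t + a \<in> {-2*pi..2*pi}" using t abs_le_D1[OF \<open>\<bar>a\<bar> \<le> pi\<close>] abs_le_D2[OF \<open>\<bar>a\<bar> \<le> pi\<close>] by auto
        then show ?thesis using d(2)[of "(\<theta>, t + a)" "(\<theta>, t)"] t \<theta> \<open>\<bar>a\<bar> \<le> pi\<close> \<open>\<bar>a\<bar> < d\<close>
          by (auto simp: dist_Pair_Pair dist_real_def less_imp_le)
      qed
      finally show "norm (h t + - (p \<theta> (t + a) * cis (of_int m * t))) \<le> \<epsilon> / pi" .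
    qed simp
    finally show ?thesis by (simp add: h_def norm_mult)
  qed
  then show ?thesis by blast
qed

text \<open>A weak form of Jordan's inequality. Up to \<pi>/3 the mean value theorem applies with a
  lower bound for the cosine; beyond it the sine is at least 1/2, and x/4 is at most that.\<close>

lemma sin_ge_quarter:
  assumes "0 \<le> x" "x \<le> pi / 2"
  shows "x / 4 \<le> sin x"
proof (cases "x \<le> pi / 3")
  case True
  show ?thesis
  proof (cases "x = 0")
    case False
    have "\<exists>z. 0 < z \<and> z < x \<and> sin x - sin 0 = (x - 0) * cos z"
      by (rule MVT2) (use False assms in \<open>auto intro!: derivative_eq_intros\<close>)
    then obtain z where z: "0 < z" "z < x" "sin x = x * cos z" by auto
    have "cos (pi / 3) \<le> cos z" by (rule cos_monotone_0_pi_le) (use z True in auto)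
    then have "x * (1 / 4) \<le> x * cos z" using assms by (intro mult_left_mono) (auto simp: cos_60)
    then show ?thesis using z(3) by simp
  qed simp
next
  case False
  have "sin (pi / 6) \<le> sin x" by (rule sin_monotone_2pi_le) (use False assms in auto)
  then show ?thesis using assms pi_half_le_two by (simp add: sin_30)
qed

lemma norm_cis_minus_1_ge:
  assumes "t \<in> {-pi..pi}"
  shows "\<bar>t\<bar> / 4 \<le> norm (cis t - 1)"
proof -
  have "\<bar>t / 2\<bar> / 4 \<le> sin \<bar>t / 2\<bar>" by (rule sin_ge_quarter) (use assms in auto)
  also have "\<dots> \<le> \<bar>sin (t / 2)\<bar>" by (cases "t \<ge> 0") auto
  finally show ?thesis using dist_exp_i_1[of t] by (simp add: cis_conv_exp)
qed

lemma integrable_abs_powr: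
  assumes "a > (-1::real)"
  shows "(\<lambda>t. \<bar>t\<bar> powr a) integrable_on {-c..c}"
proof (cases "c \<ge> 0")
  case True
  have "(\<lambda>t. t powr a) integrable_on {0..c}" by (rule integrable_on_powr_from_0[OF assms True])
  then have r: "(\<lambda>t. \<bar>t\<bar> powr a) integrable_on {0..c}" by (rule integrable_eq) auto
  then have "(\<lambda>t. \<bar>- t\<bar> powr a) integrable_on {-c..-0}"
    by (rule Henstock_Kurzweil_Integration.integrable_reflect_real[THEN iffD2])
  then have "(\<lambda>t. \<bar>t\<bar> powr a) integrable_on {-c..0}" by simp
  then show ?thesis using r True by (intro Henstock_Kurzweil_Integration.integrable_combine[of "-c" 0 c]) auto
qed auto

text \<open>The singularity of \<open>1 / (cis t - 1)\<close> is cut off at scale \<open>\<eta>\<close>.  The cut-off kernel is handled by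
  Riemann--Lebesgue; the remainder is supported in \<open>\<bar>t\<bar> < 4\<eta>\<close>, where the Hoelder bound makes it integrable with
  integral tending to \<open>0\<close> with \<open>\<eta>\<close>, uniformly in \<open>n\<close>.\<close>
lemma fourier_sum_uniform:
  fixes f :: "real \<Rightarrow> real"
  assumes per: "\<And>t. f (t + 2 * pi) = f t"
    and hol: "\<And>s t. \<bar>f s - f t\<bar> \<le> C * \<bar>s - t\<bar> powr \<alpha>" and "\<alpha> > 0" and "\<epsilon> > 0" and cont: "continuous_on UNIV f"
  shows "\<exists>N. \<forall>n\<ge>N. \<forall>\<theta>\<in>{-pi..pi}. \<bar>f \<theta> - fourier_sum f n \<theta>\<bar> \<le> \<epsilon>"
proof -
  have C: "C \<ge> 0" using hol[of 0 1] by simp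
  \<comment> \<open>Half of the Hoelder exponent is spent on integrability and half on smallness:
    for |t| \<le> 4\<eta> the product of |t|^\<alpha> and 1/|t| is at most (4\<eta>)^(\<alpha>/2)
    |t|^(\<alpha>/2 - 1).\<close>
  define I where "I = integral {-pi..pi} (\<lambda>t. \<bar>t\<bar> powr (\<alpha> / 2 - 1))"
  have Iint: "(\<lambda>t. \<bar>t\<bar> powr (\<alpha> / 2 - 1)) integrable_on {-pi..pi}"
    by (rule integrable_abs_powr) (use assms(3) in simp)
  have I: "I \<ge> 0" unfolding I_def by (rule integral_nonneg[OF Iint]) simp
  define B where "B = 8 * C * I + 1"
  have B: "B > 0" using C I by (simp add: B_def add_nonneg_pos)
  \<comment> \<open>The solution of (4\<eta>)^(\<alpha>/2) B = \<epsilon>; the +1 in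
    \<open>B\<close> keeps it meaningful when \<open>C = 0\<close>.\<close>
  define \<eta> where "\<eta> = (\<epsilon> / B) powr (2 / \<alpha>) / 4"
  have \<eta>: "\<eta> > 0" using assms(4) B by (simp add: \<eta>_def)
  have \<eta>B: "(4 * \<eta>) powr (\<alpha> / 2) * B = \<epsilon>"
    using assms(3,4) B by (simp add: \<eta>_def powr_powr)
  \<comment> \<open>Since cnj z / |z|^2 = 1 / z, the kernel \<kappa> below is the inverse of cis t -
    1 where that is at least \<eta> in norm. The maximum keeps \<kappa> continuous and periodic
    through the singularity.\<close>
  define w where "w = (\<lambda>t. max ((norm (cis t - 1))\<^sup>2) (\<eta>\<^sup>2))"
  have w: "w t > 0" for t using \<eta> by (simp add: w_def less_max_iff_disj)
  have wne: "w t \<noteq> 0" for t using w[of t] by simp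
  have cw: "continuous_on A w" for A unfolding w_def by (intro continuous_intros)
  define \<kappa> where "\<kappa> = (\<lambda>t. cnj (cis t - 1) / of_real (w t))"
  have \<kappa>: "(cis t - 1) * \<kappa> t = of_real ((norm (cis t - 1))\<^sup>2 / w t)" for t
    by (simp only: \<kappa>_def complex_norm_square of_real_divide times_divide_eq_right)
  have c\<kappa>: "continuous_on A \<kappa>" for A
    unfolding \<kappa>_def by (intro continuous_intros cw) (auto simp: wne)
  define p where "p = (\<lambda>\<theta> t. of_real (f (t + \<theta>) - f \<theta>) * \<kappa> t)"
  have cp: "continuous_on UNIV (\<lambda>(\<theta>, t). p \<theta> t)"
    unfolding p_def split_beta
    by (intro continuous_intros continuous_on_compose2[OF cont] continuous_on_compose2[OF c\<kappa>[of UNIV]]) auto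
  have pper: "p \<theta> (t + 2 * pi) = p \<theta> t" for \<theta> t
  proof -
    have "cis (t + 2 * pi) = cis t" by (simp add: complex_eq_iff)
    then have "\<kappa> (t + 2 * pi) = \<kappa> t" by (simp only: \<kappa>_def w_def)
    moreover have "f (t + 2 * pi + \<theta>) = f (t + \<theta>)" using per[of "t + \<theta>"] by (simp add: ac_simps)
    ultimately show ?thesis by (simp add: p_def)
  qed
  obtain N :: nat where N: "\<And>m \<theta>. \<bar>m\<bar> \<ge> int N \<Longrightarrow> \<theta> \<in> {-pi..pi} \<Longrightarrow>
      norm (integral {-pi..pi} (\<lambda>t. p \<theta> t * cis (of_int m * t))) \<le> \<epsilon>"
    using riemann_lebesgue_uniform[OF cp pper assms(4)] by blast
  have "\<bar>f \<theta> - fourier_sum f n \<theta>\<bar> \<le> \<epsilon>" if n: "n \<ge> N" and \<theta>: "\<theta> \<in> {-pi..pi}" for n \<theta>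
  proof -
    define E where "E = (\<lambda>t. (f (t + \<theta>) - f \<theta>) * dirichlet_ker n t)"
    define A where "A = (\<lambda>t. (f (t + \<theta>) - f \<theta>) * dirichlet_ker n t * (1 - (norm (cis t - 1))\<^sup>2 / w t))"
    have cf: "continuous_on UNIV (\<lambda>t. f (t + \<theta>))"
      by (intro continuous_on_compose2[OF cont] continuous_intros) auto
    have cA: "continuous_on {-pi..pi} A"
      unfolding A_def by (intro continuous_intros continuous_on_subset[OF cf] cw) (auto simp: wne)
    have cpt: "continuous_on {-pi..pi} (\<lambda>t. p \<theta> t * cis (of_int m * t))" for m
      unfolding p_def by (intro continuous_intros continuous_on_subset[OF cf] c\<kappa>) auto
    have split: "complex_of_real (E t) = of_real (A t) + (p \<theta> t * cis (of_int (int n + 1) * t) - p \<theta> t * cis (of_int (- int n) * t))" for t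
    proof -
      have "p \<theta> t * cis (of_int (int n + 1) * t) - p \<theta> t * cis (of_int (- int n) * t) =
          p \<theta> t * (of_real (dirichlet_ker n t) * (cis t - 1))"
        unfolding dirichlet_ker_mult by (simp add: algebra_simps)
      also have "\<dots> = of_real ((f (t + \<theta>) - f \<theta>) * dirichlet_ker n t) * ((cis t - 1) * \<kappa> t)"
        by (simp add: p_def mult_ac)
      also have "\<dots> = of_real ((f (t + \<theta>) - f \<theta>) * dirichlet_ker n t * ((norm (cis t - 1))\<^sup>2 / w t))"
        unfolding \<kappa> by simp
      finally show ?thesis by (simp add: E_def A_def right_diff_distrib)
    qed
    have A_le: "\<bar>A t\<bar> \<le> 8 * C * (4 * \<eta>) powr (\<alpha> / 2) * \<bar>t\<bar> powr (\<alpha> / 2 - 1)" if t: "t \<in> {-pi..pi}" for t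
    proof (cases "norm (cis t - 1) \<ge> \<eta> \<or> t = 0")
      case True
      have "A t = 0"
      proof (cases "t = 0")
        case False
        then have ge: "norm (cis t - 1) \<ge> \<eta>" using True by simp
        then have "(norm (cis t - 1))\<^sup>2 \<ge> \<eta>\<^sup>2" using \<eta> by (intro power_mono) auto
        then have "w t = (norm (cis t - 1))\<^sup>2" by (simp add: w_def)
        then have one: "(norm (cis t - 1))\<^sup>2 / w t = 1" using wne[of t] by (metis divide_self)
        show ?thesis unfolding A_def one by simp
      qed (simp add: A_def)
      then show ?thesis using C by simp
    next
      case False
      then have lt: "norm (cis t - 1) < \<eta>" and t0: "t \<noteq> 0" by auto
      have ge: "\<bar>t\<bar> / 4 \<le> norm (cis t - 1)" by (rule norm_cis_minus_1_ge[OF t])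
      then have z0: "norm (cis t - 1) > 0" using t0 by linarith
      have t\<eta>: "\<bar>t\<bar> \<le> 4 * \<eta>" using ge lt by linarith
      \<comment> \<open>A difference of two unimodular numbers has norm at most 2; this gives a
        bound 8/|t| for the kernel that does not depend on \<open>n\<close>.\<close>
      have "norm (of_real (dirichlet_ker n t) * (cis t - 1)) \<le> norm (cis (of_int (int n + 1) * t)) + norm (cis (of_int (- int n) * t))"
        unfolding dirichlet_ker_mult by (rule norm_triangle_ineq4)
      then have D2: "\<bar>dirichlet_ker n t\<bar> * norm (cis t - 1) \<le> 2" by (simp add: norm_mult)
      have "\<bar>dirichlet_ker n t\<bar> * (\<bar>t\<bar> / 4) \<le> \<bar>dirichlet_ker n t\<bar> * norm (cis t - 1)"
        using ge by (intro mult_left_mono) auto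
      then have "\<bar>dirichlet_ker n t\<bar> * \<bar>t\<bar> \<le> 8" using D2 by simp
      then have D: "\<bar>dirichlet_ker n t\<bar> \<le> 8 / \<bar>t\<bar>" using t0 by (simp add: field_simps)
      have "0 \<le> (norm (cis t - 1))\<^sup>2 / w t" "(norm (cis t - 1))\<^sup>2 / w t \<le> 1"
        using w[of t] by (auto simp: divide_le_eq w_def)
      then have cut: "\<bar>1 - (norm (cis t - 1))\<^sup>2 / w t\<bar> \<le> 1" by linarith
      have "\<bar>A t\<bar> = \<bar>f (t + \<theta>) - f \<theta>\<bar> * \<bar>dirichlet_ker n t\<bar> * \<bar>1 - (norm (cis t - 1))\<^sup>2 / w t\<bar>"
        by (simp add: A_def abs_mult)
      also have "\<dots> \<le> (C * \<bar>t\<bar> powr \<alpha>) * (8 / \<bar>t\<bar>) * 1"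
        using hol[of "t + \<theta>" \<theta>] D cut C by (intro mult_mono mult_nonneg_nonneg) auto
      also have "\<dots> = 8 * C * (\<bar>t\<bar> powr (\<alpha> / 2) * \<bar>t\<bar> powr (\<alpha> / 2 - 1))"
        using t0 by (simp add: powr_diff powr_add[symmetric])
      also have "\<dots> \<le> 8 * C * ((4 * \<eta>) powr (\<alpha> / 2) * \<bar>t\<bar> powr (\<alpha> / 2 - 1))"
        using t\<eta> C assms(3) by (intro mult_left_mono mult_right_mono powr_mono2) auto
      finally show ?thesis by (simp add: mult.assoc)
    qed
    have "norm (integral {-pi..pi} A) \<le> integral {-pi..pi} (\<lambda>t. 8 * C * (4 * \<eta>) powr (\<alpha> / 2) * \<bar>t\<bar> powr (\<alpha> / 2 - 1))"
      by (rule integral_norm_bound_integral)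
         (use A_le in \<open>auto intro!: integrable_continuous_interval cA integrable_on_mult_right Iint\<close>)
    also have "\<dots> = (4 * \<eta>) powr (\<alpha> / 2) * (8 * C * I)" by (simp add: I_def)
    also have "\<dots> \<le> (4 * \<eta>) powr (\<alpha> / 2) * B" by (intro mult_left_mono) (auto simp: B_def)
    finally have IA: "\<bar>integral {-pi..pi} A\<bar> \<le> \<epsilon>" using \<eta>B by simp
    have cE: "continuous_on {-pi..pi} E"
      unfolding E_def by (intro continuous_intros continuous_on_subset[OF cf]) auto
    have "((\<lambda>t. of_real (A t) + (p \<theta> t * cis (of_int (int n + 1) * t) - p \<theta> t * cis (of_int (- int n) * t))) has_integral
        (of_real (integral {-pi..pi} A) + (integral {-pi..pi} (\<lambda>t. p \<theta> t * cis (of_int (int n + 1) * t))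
           - integral {-pi..pi} (\<lambda>t. p \<theta> t * cis (of_int (- int n) * t))))) {-pi..pi}"
      by (intro has_integral_add has_integral_diff integrable_integral integrable_continuous_interval cpt has_integral_of_real cA)
    moreover have "((\<lambda>t. complex_of_real (E t)) has_integral of_real (integral {-pi..pi} E)) {-pi..pi}"
      by (intro has_integral_of_real integrable_integral integrable_continuous_interval cE)
    ultimately have "of_real (integral {-pi..pi} E) = of_real (integral {-pi..pi} A) +
        (integral {-pi..pi} (\<lambda>t. p \<theta> t * cis (of_int (int n + 1) * t))
           - integral {-pi..pi} (\<lambda>t. p \<theta> t * cis (of_int (- int n) * t)))"
      by (simp only: split has_integral_unique)
    then have "norm (complex_of_real (integral {-pi..pi} E)) \<le> norm (complex_of_real (integral {-pi..pi} A)) +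
        (norm (integral {-pi..pi} (\<lambda>t. p \<theta> t * cis (of_int (int n + 1) * t)))
           + norm (integral {-pi..pi} (\<lambda>t. p \<theta> t * cis (of_int (- int n) * t))))"
      by (simp only:) (rule order_trans[OF norm_triangle_ineq add_left_mono[OF norm_triangle_ineq4]])
    \<comment> \<open>One \<epsilon> for the cut-off error and one for each of the two frequencies;
      the sum 3\<epsilon> is absorbed by 2\<pi> > 3.\<close>
    also have "\<dots> \<le> \<epsilon> + (\<epsilon> + \<epsilon>)"
      using IA N[of "int n + 1" \<theta>] N[of "- int n" \<theta>] n \<theta> by (intro add_mono) auto
    finally have "\<bar>integral {-pi..pi} E\<bar> \<le> 3 * \<epsilon>" by simp
    then have "\<bar>2 * pi * (fourier_sum f n \<theta> - f \<theta>)\<bar> \<le> 3 * \<epsilon>"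
      using fourier_sum_eq_dirichlet[OF cont per, of n \<theta>] by (simp add: E_def)
    then have "2 * pi * \<bar>f \<theta> - fourier_sum f n \<theta>\<bar> \<le> 3 * \<epsilon>" by (simp add: abs_mult abs_minus_commute)
    moreover have "3 * \<bar>f \<theta> - fourier_sum f n \<theta>\<bar> \<le> 2 * pi * \<bar>f \<theta> - fourier_sum f n \<theta>\<bar>"
      using pi_gt3 by (intro mult_right_mono) auto
    ultimately show ?thesis by simp
  qed
  then show ?thesis by blast
qed

section \<open>Rates of convergence\<close>

lemma holder_onD:
  assumes "holder_on \<alpha> K w" "p \<in> K" "q \<in> K"
  shows "\<bar>w p - w q\<bar> \<le> holder_seminorm \<alpha> K w * norm (p - q) powr \<alpha>"
proof (cases "p = q")
  case False
  have "\<bar>w p - w q\<bar> / norm (p - q) powr \<alpha> \<le> holder_seminorm \<alpha> K w"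
    unfolding holder_seminorm_def by (rule cSup_upper) (use assms False in \<open>auto simp: holder_on_def\<close>)
  then show ?thesis using False by (simp add: divide_le_eq)
qed simp

lemma holder_seminorm_nonneg:
  assumes "holder_on \<alpha> K w" "p \<in> K" "q \<in> K" "p \<noteq> q"
  shows "holder_seminorm \<alpha> K w \<ge> 0"
proof -
  have "\<bar>w p - w q\<bar> / norm (p - q) powr \<alpha> \<le> holder_seminorm \<alpha> K w"
    unfolding holder_seminorm_def by (rule cSup_upper) (use assms in \<open>auto simp: holder_on_def\<close>)
  moreover have "\<bar>w p - w q\<bar> / norm (p - q) powr \<alpha> \<ge> 0" by simp
  ultimately show ?thesis by linarith
qed

lemma holder_onI:
  assumes "continuous_on K w"
    and le: "\<And>p q. p \<in> K \<Longrightarrow> q \<in> K \<Longrightarrow> \<bar>w p - w q\<bar> \<le> C * norm (p - q) powr \<alpha>"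
  shows "holder_on \<alpha> K w" and "p \<in> K \<Longrightarrow> q \<in> K \<Longrightarrow> p \<noteq> q \<Longrightarrow> holder_seminorm \<alpha> K w \<le> C"
proof -
  let ?S = "{\<bar>w p - w q\<bar> / norm (p - q) powr \<alpha> |p q. p \<in> K \<and> q \<in> K \<and> p \<noteq> q}"
  have b: "x \<le> C" if xS: "x \<in> ?S" for x
  proof -
    obtain p q where x: "x = \<bar>w p - w q\<bar> / norm (p - q) powr \<alpha>" "p \<in> K" "q \<in> K" "p \<noteq> q"
      using xS by blast
    then show ?thesis using le[of p q] by (simp add: divide_le_eq)
  qed
  show "holder_on \<alpha> K w" unfolding holder_on_def by (rule conjI[OF assms(1) bdd_aboveI[of ?S C, OF b]])
  assume "p \<in> K" "q \<in> K" "p \<noteq> q"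
  then have "?S \<noteq> {}" by blast
  then show "holder_seminorm \<alpha> K w \<le> C" unfolding holder_seminorm_def by (rule cSup_least) (rule b)
qed

lemma modulus_cont_bounds:
  assumes "holder_on \<alpha> {-pi..pi} \<psi>" "\<alpha> > 0" "\<delta> > 0"
  shows "modulus_cont \<psi> \<delta> \<le> holder_seminorm \<alpha> {-pi..pi} \<psi> * \<delta> powr \<alpha>"
    and "s \<in> {-pi..pi} \<Longrightarrow> t \<in> {-pi..pi} \<Longrightarrow> \<bar>s - t\<bar> \<le> \<delta> \<Longrightarrow> \<bar>\<psi> s - \<psi> t\<bar> \<le> modulus_cont \<psi> \<delta>"
proof -
  let ?S = "{\<bar>\<psi> \<theta>1 - \<psi> \<theta>2\<bar> | \<theta>1 \<theta>2. \<theta>1 \<in> {-pi..pi} \<and> \<theta>2 \<in> {-pi..pi} \<and> \<bar>\<theta>1 - \<theta>2\<bar> \<le> \<delta>}"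
  have "holder_seminorm \<alpha> {-pi..pi} \<psi> \<ge> 0"
    by (rule holder_seminorm_nonneg[OF assms(1), of 0 pi]) auto
  then have b: "x \<le> holder_seminorm \<alpha> {-pi..pi} \<psi> * \<delta> powr \<alpha>" if xS: "x \<in> ?S" for x
  proof -
    obtain s t where st: "x = \<bar>\<psi> s - \<psi> t\<bar>" "s \<in> {-pi..pi}" "t \<in> {-pi..pi}" "\<bar>s - t\<bar> \<le> \<delta>"
      using xS by blast
    have "x \<le> holder_seminorm \<alpha> {-pi..pi} \<psi> * \<bar>s - t\<bar> powr \<alpha>"
      using holder_onD[OF assms(1) st(2,3)] st(1) by simp
    also have "\<dots> \<le> holder_seminorm \<alpha> {-pi..pi} \<psi> * \<delta> powr \<alpha>"
      using st(4) assms(2) \<open>holder_seminorm \<alpha> {-pi..pi} \<psi> \<ge> 0\<close> by (intro mult_left_mono powr_mono2) auto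
    finally show ?thesis .
  qed
  have "\<bar>\<psi> 0 - \<psi> 0\<bar> \<in> ?S" using assms(3) by (intro CollectI exI[of _ "0::real"] conjI) auto
  then have "?S \<noteq> {}" by blast
  then show "modulus_cont \<psi> \<delta> \<le> holder_seminorm \<alpha> {-pi..pi} \<psi> * \<delta> powr \<alpha>"
    unfolding modulus_cont_def by (rule cSup_least) (rule b)
  assume "s \<in> {-pi..pi}" "t \<in> {-pi..pi}" "\<bar>s - t\<bar> \<le> \<delta>"
  then have "\<bar>\<psi> s - \<psi> t\<bar> \<in> ?S" by blast
  moreover have "bdd_above ?S" by (rule bdd_aboveI) (rule b)
  ultimately show "\<bar>\<psi> s - \<psi> t\<bar> \<le> modulus_cont \<psi> \<delta>"
    unfolding modulus_cont_def by (rule cSup_upper)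
qed

text \<open>A modulus that vanishes at one scale makes \<psi> locally constant, hence constant
  because the interval is connected.\<close>

lemma holder_seminorm_eq_0:
  assumes "holder_on \<alpha> {-pi..pi} \<psi>" "\<alpha> > 0" "\<delta> > 0" "modulus_cont \<psi> \<delta> \<le> 0"
  shows "holder_seminorm \<alpha> {-pi..pi} \<psi> = 0"
proof (rule antisym)
  have const: "\<psi> s = \<psi> t" if "s \<in> {-pi..pi}" "t \<in> {-pi..pi}" for s t
  proof (rule connected_local_const[OF _ that])
    show "\<forall>a\<in>{-pi..pi}. \<forall>\<^sub>F b in at a within {-pi..pi}. \<psi> a = \<psi> b"
    proof
      fix a assume a: "a \<in> {-pi..pi}"
      have "\<psi> a = \<psi> b" if "b \<in> {-pi..pi}" "dist b a < \<delta>" for b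
        using modulus_cont_bounds(2)[OF assms(1-3) a that(1)] that(2) assms(4)
        by (simp add: dist_real_def abs_minus_commute)
      then show "\<forall>\<^sub>F b in at a within {-pi..pi}. \<psi> a = \<psi> b"
        unfolding eventually_at using assms(3) by blast
    qed
  qed simp
  show "holder_seminorm \<alpha> {-pi..pi} \<psi> \<le> 0"
  proof (rule holder_onI(2)[of _ _ _ _ 0 pi])
    show "\<bar>\<psi> s - \<psi> t\<bar> \<le> 0 * norm (s - t) powr \<alpha>" if "s \<in> {-pi..pi}" "t \<in> {-pi..pi}" for s t
      using const[OF that] by simp
  qed (use assms(1) in \<open>simp_all add: holder_on_def\<close>)
  show "0 \<le> holder_seminorm \<alpha> {-pi..pi} \<psi>"
    by (rule holder_seminorm_nonneg[OF assms(1), of 0 pi]) auto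
qed

text \<open>A negative \<open>\<gamma>\<close> is not excluded; it forces \<open>\<psi>\<close> to be constant and then both sides vanish.\<close>
lemma approx_poly_rate:
  assumes "R > 0" "continuous_on (sphere 0 R) g" "holder_on \<alpha> {-pi..pi} \<psi>" "\<alpha> > 0" "n \<ge> 2"
    and J: "\<And>\<theta>. \<theta> \<in> {-pi..pi} \<Longrightarrow> \<bar>bdry_fun R g \<theta> - fourier_sum (bdry_fun R g) n \<theta>\<bar>
      \<le> \<gamma> / real n ^ k * ln (real n) * modulus_cont \<psi> (2 * pi / real n)"
    and p: "(x, y) \<in> cball 0 R"
  shows "\<bar>dirichlet_fun 0 R g (x, y) - approx_poly R (bdry_fun R g) n (x, y)\<bar>
    \<le> 2 * \<gamma> * (2 * pi) powr \<alpha> * holder_seminorm \<alpha> {-pi..pi} \<psi>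
       * (sqrt (x\<^sup>2 + y\<^sup>2) / R) ^ (n + 1) * ln (real n) * (1 / real n) powr (real k + \<alpha>)"
proof -
  define S where "S = holder_seminorm \<alpha> {-pi..pi} \<psi>"
  define \<omega> where "\<omega> = modulus_cont \<psi> (2 * pi / real n)"
  define X where "X = ln (real n) / real n ^ k"
  have X: "X > 0" using assms(5) by (simp add: X_def)
  have \<delta>: "2 * pi / real n > 0" using assms(5) by simp
  have "\<omega> \<le> S * (2 * pi / real n) powr \<alpha>"
    unfolding \<omega>_def S_def by (rule modulus_cont_bounds(1)[OF assms(3,4) \<delta>])
  moreover have pw: "(2 * pi / real n) powr \<alpha> = (2 * pi) powr \<alpha> * (1 / real n) powr \<alpha>"
    using powr_mult[of "2 * pi" "1 / real n" \<alpha>] by simp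
  ultimately have \<omega>: "\<omega> \<le> S * ((2 * pi) powr \<alpha> * (1 / real n) powr \<alpha>)" by simp
  define M where "M = \<gamma> * X * (S * ((2 * pi) powr \<alpha> * (1 / real n) powr \<alpha>))"
  have J': "\<bar>bdry_fun R g \<theta> - fourier_sum (bdry_fun R g) n \<theta>\<bar> \<le> \<gamma> * X * \<omega>" if "\<theta> \<in> {-pi..pi}" for \<theta>
    using J[OF that] by (simp add: X_def \<omega>_def)
  have M: "\<gamma> * X * \<omega> \<le> M"
  proof (cases "\<gamma> \<ge> 0")
    case True
    then show ?thesis unfolding M_def using X \<omega> by (intro mult_left_mono) auto
  next
    case False
    \<comment> \<open>Jackson's bound dominates an absolute value, so a negative \<gamma> leaves no
      room for a positive modulus.\<close>
    have "0 \<le> \<gamma> * X * \<omega>" using J'[of 0] by (simp del: times_divide_eq_left)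
    moreover have "\<gamma> * X < 0" using False X by (simp add: mult_neg_pos)
    ultimately have "\<omega> \<le> 0" using mult_neg_pos[of "\<gamma> * X" \<omega>] by (meson not_le)
    then have "S = 0" unfolding S_def \<omega>_def by (rule holder_seminorm_eq_0[OF assms(3,4) \<delta>])
    moreover have "\<omega> \<ge> 0"
      using modulus_cont_bounds(2)[OF assms(3,4) \<delta>, of 0 0] \<delta> by (simp add: \<omega>_def)
    ultimately show ?thesis using \<open>\<omega> \<le> 0\<close> by (simp add: M_def)
  qed
  have "\<bar>dirichlet_fun 0 R g (x, y) - approx_poly R (bdry_fun R g) n (x, y)\<bar> \<le> 2 * M * (norm (x, y) / R) ^ (n + 1)"
    by (rule approx_poly_error[OF assms(1,2) order_trans[OF J' M] p])
  also have "2 * M * (norm (x, y) / R) ^ (n + 1) = 2 * \<gamma> * (2 * pi) powr \<alpha> * S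
       * (sqrt (x\<^sup>2 + y\<^sup>2) / R) ^ (n + 1) * ln (real n) * (1 / real n) powr (real k + \<alpha>)"
  proof -
    have "(1 / real n) powr (real k + \<alpha>) = (1 / real n ^ k) * (1 / real n) powr \<alpha>"
    using assms(5) by (simp add: powr_add powr_realpow power_divide)
    moreover have "norm (x, y) = sqrt (x\<^sup>2 + y\<^sup>2)" by (simp add: norm_Pair)
    ultimately show ?thesis by (simp add: M_def X_def mult_ac)
  qed
  finally show ?thesis by (simp add: S_def)
qed

text \<open>The chord has length 2R |sin ((s - t)/2)|, at most the arc R |s - t|. The angles are
  arbitrary reals, so the Hoelder bound derived from this holds on the whole line, as
  \<open>fourier_sum_uniform\<close> demands.\<close>

lemma norm_circle_diff_le: "R \<ge> 0 \<Longrightarrow> norm ((R * cos s, R * sin s) - (R * cos t, R * sin t)) \<le> R * \<bar>s - t\<bar>"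
proof -
  assume R: "R \<ge> 0"
  have c: "cx (R * cos a, R * sin a) = of_real R * cis a" for a
    by (simp add: complex_eq_iff)
  have "norm ((R * cos s, R * sin s) - (R * cos t, R * sin t)) = norm (of_real R * cis s - of_real R * cis t)"
    by (simp only: norm_cx[symmetric] cx_diff c)
  also have "of_real R * cis s - of_real R * cis t = of_real R * cis t * (cis (s - t) - 1)"
    by (simp add: algebra_simps cis_mult)
  also have "norm \<dots> = R * (2 * \<bar>sin ((s - t) / 2)\<bar>)"
    using R dist_exp_i_1[of "s - t"] by (simp add: norm_mult cis_conv_exp)
  also have "\<dots> \<le> R * (2 * \<bar>(s - t) / 2\<bar>)"
    using R by (intro mult_left_mono abs_sin_x_le_abs_x) auto
  finally show ?thesis by simp
qed

lemma holder_bdry_fun: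
  assumes "R > 0" "holder_on \<alpha> (sphere 0 R) g" "\<alpha> > 0"
  shows "\<bar>bdry_fun R g s - bdry_fun R g t\<bar> \<le> (R powr \<alpha> * holder_seminorm \<alpha> (sphere 0 R) g) * \<bar>s - t\<bar> powr \<alpha>"
proof -
  have on: "(R * cos a, R * sin a) \<in> sphere 0 R" for a
    using circ_mem_sphere[of R 0 a] assms(1) by simp
  \<comment> \<open>Two distinct points of the circle show that the supremum in the seminorm is over
    a nonempty set, hence nonnegative.\<close>
  have "(R, 0) \<in> sphere (0::real \<times> real) R" "(- R, 0) \<in> sphere (0::real \<times> real) R"
    using assms(1) by (simp_all add: norm_Pair)
  then have S: "holder_seminorm \<alpha> (sphere 0 R) g \<ge> 0"
    by (rule holder_seminorm_nonneg[OF assms(2)]) (use assms(1) in simp)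
  have "\<bar>bdry_fun R g s - bdry_fun R g t\<bar> \<le> holder_seminorm \<alpha> (sphere 0 R) g *
      norm ((R * cos s, R * sin s) - (R * cos t, R * sin t)) powr \<alpha>"
    unfolding bdry_fun_def by (rule holder_onD[OF assms(2) on on])
  also have "\<dots> \<le> holder_seminorm \<alpha> (sphere 0 R) g * (R * \<bar>s - t\<bar>) powr \<alpha>"
    using norm_circle_diff_le[of R s t] assms(1,3) S by (intro mult_left_mono powr_mono2) auto
  also have "\<dots> = (R powr \<alpha> * holder_seminorm \<alpha> (sphere 0 R) g) * \<bar>s - t\<bar> powr \<alpha>"
    using assms(1) by (simp add: powr_mult)
  finally show ?thesis .
qed

lemma bdry_fun_periodic: "bdry_fun R g (t + 2 * pi) = bdry_fun R g t"
  by (simp add: bdry_fun_def)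

lemma uniform_limit_approx_poly:
  assumes "R > 0" "holder_on \<alpha> (sphere 0 R) g" "\<alpha> > 0"
  shows "uniform_limit (cball 0 R) (approx_poly R (bdry_fun R g)) (dirichlet_fun 0 R g) sequentially"
  unfolding uniform_limit_iff
proof (intro allI impI)
  fix \<epsilon> :: real assume \<epsilon>: "\<epsilon> > 0"
  \<comment> \<open>The error lemma doubles the boundary bound; a quarter of \<epsilon> then leaves
    the strict inequality that uniform convergence asks for.\<close>
  then have \<epsilon>4: "\<epsilon> / 4 > 0" by simp
  have cg: "continuous_on (sphere 0 R) g" using assms(2) by (simp add: holder_on_def)
  have cf: "continuous_on UNIV (bdry_fun R g)"
    unfolding circ_0_eq_bdry_fun[symmetric] by (intro continuous_on_circ cg) (use assms in simp)
  obtain N where N: "\<And>n \<theta>. n \<ge> N \<Longrightarrow> \<theta> \<in> {-pi..pi} \<Longrightarrow>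
      \<bar>bdry_fun R g \<theta> - fourier_sum (bdry_fun R g) n \<theta>\<bar> \<le> \<epsilon> / 4"
    using fourier_sum_uniform[OF bdry_fun_periodic holder_bdry_fun[OF assms] assms(3) \<epsilon>4 cf] by blast
  have "dist (approx_poly R (bdry_fun R g) n p) (dirichlet_fun 0 R g p) < \<epsilon>" if "n \<ge> N" "p \<in> cball 0 R" for n p
  proof -
    have "\<bar>dirichlet_fun 0 R g p - approx_poly R (bdry_fun R g) n p\<bar> \<le> 2 * (\<epsilon> / 4) * (norm p / R) ^ (n + 1)"
      by (rule approx_poly_error[OF assms(1) cg N[OF that(1)] that(2)])
    also have "\<dots> \<le> 2 * (\<epsilon> / 4) * 1"
      using that(2) assms(1) \<epsilon> by (intro mult_left_mono power_le_one) auto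
    also have "\<dots> < \<epsilon>" using \<epsilon> by simp
    finally show ?thesis by (simp add: dist_real_def abs_minus_commute)
  qed
  then show "\<forall>\<^sub>F n in sequentially. \<forall>p\<in>cball 0 R. dist (approx_poly R (bdry_fun R g) n p) (dirichlet_fun 0 R g p) < \<epsilon>"
    unfolding eventually_sequentially by blast
qed

theorem theorem1p1:
  fixes R :: real and g :: "real \<times> real \<Rightarrow> real"
  assumes "R > 0" and "continuous_on (sphere 0 R) g"
  shows "\<exists>u :: real \<times> real \<Rightarrow> real.
    \<comment> \<open>(i)\<close>
    dirichlet_solution R g u \<and> Cinf_plane (ball 0 R) u \<and>
    (\<forall>v. dirichlet_solution R g v \<longrightarrow> (\<forall>p\<in>cball 0 R. v p = u p)) \<and>
    (\<forall>r x y \<alpha>1 \<alpha>2. 0 \<le> r \<and> r < R \<and> (x, y) \<in> cball 0 r \<longrightarrow>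
      \<bar>Dpart \<alpha>1 \<alpha>2 u (x, y)\<bar>
        \<le> Dpart \<alpha>1 \<alpha>2 (\<lambda>_. -1 / (2 * pi * R) * circle_integral 0 R (\<lambda>q. \<bar>g q\<bar>)) (x, y)
          + fact (\<alpha>1 + \<alpha>2) / (pi * (R - r) ^ (\<alpha>1 + \<alpha>2 + 1)) * circle_integral 0 R (\<lambda>q. \<bar>g q\<bar>)) \<and>
    \<comment> \<open>(ii)\<close>
    analytic_plane (ball 0 R) u \<and>
    (\<forall>x0 \<kappa> h L. x0 \<in> ball 0 R \<and> L = R - norm x0 \<and> 0 < \<kappa> \<and> \<kappa> < 1/3 \<and> norm h < \<kappa> * L \<longrightarrow>
      taylor_term u x0 h sums u (x0 + h) \<and>
      (\<forall>n\<ge>1. \<bar>u (x0 + h) - (\<Sum>k<n. taylor_term u x0 h k)\<bar>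
        \<le> (2 * \<kappa> / (1 - \<kappa>)) ^ n * (1 / (pi * (L - \<kappa> * L))) * circle_integral x0 L (\<lambda>q. \<bar>u q\<bar>))) \<and>
    (\<forall>\<alpha> f. 0 < \<alpha> \<and> \<alpha> \<le> 1 \<and> holder_on \<alpha> (sphere 0 R) g \<and> f = bdry_fun R g \<longrightarrow>
      \<comment> \<open>(iii)\<close>
      holder_on \<alpha> {-pi..pi} f \<and>
      holder_seminorm \<alpha> {-pi..pi} f \<le> R powr \<alpha> * holder_seminorm \<alpha> (sphere 0 R) g \<and>
      uniform_limit (cball 0 R) (approx_poly R f) u sequentially \<and>
      (\<forall>\<gamma>0. jackson_const_0 \<gamma>0 \<longrightarrow>
        (\<forall>n x y. real n \<ge> exp (1 / \<alpha>) \<and> (x, y) \<in> cball 0 R \<longrightarrow>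
          \<bar>u (x, y) - approx_poly R f n (x, y)\<bar>
            \<le> 2 * \<gamma>0 * (2 * pi) powr \<alpha> * holder_seminorm \<alpha> {-pi..pi} f
               * (sqrt (x\<^sup>2 + y\<^sup>2) / R) ^ (n + 1) * ln (real n) * (1 / real n) powr \<alpha>)) \<and>
      \<comment> \<open>(iv)\<close>
      (\<forall>k\<ge>1. f \<in> Ck_interval k \<and> holder_on \<alpha> {-pi..pi} (ext_deriv k f) \<longrightarrow>
        (\<forall>\<gamma>. jackson_const (Ck_interval k) k \<gamma> \<longrightarrow>
          (\<forall>n x y. real n \<ge> exp 1 \<and> (x, y) \<in> cball 0 R \<longrightarrow>
            \<bar>u (x, y) - approx_poly R f n (x, y)\<bar>
              \<le> 2 * \<gamma> * (2 * pi) powr \<alpha> * holder_seminorm \<alpha> {-pi..pi} (ext_deriv k f)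
                 * (sqrt (x\<^sup>2 + y\<^sup>2) / R) ^ (n + 1) * ln (real n) * (1 / real n) powr (real k + \<alpha>))) \<and>
        \<comment> \<open>(iv) with Jackson's constant for \<open>C\<^sup>k\<close> functions on the whole line\<close>
        (\<forall>\<gamma>. f \<in> Ck_line k \<and> jackson_const (Ck_line k) k \<gamma> \<longrightarrow>
          (\<forall>n x y. real n \<ge> exp 1 \<and> (x, y) \<in> cball 0 R \<longrightarrow>
            \<bar>u (x, y) - approx_poly R f n (x, y)\<bar>
              \<le> 2 * \<gamma> * (2 * pi) powr \<alpha> * holder_seminorm \<alpha> {-pi..pi} (ext_deriv k f)
                 * (sqrt (x\<^sup>2 + y\<^sup>2) / R) ^ (n + 1) * ln (real n) * (1 / real n) powr (real k + \<alpha>)))))"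
proof (rule exI[of _ "dirichlet_fun 0 R g"], intro conjI)
  let ?u = "dirichlet_fun 0 R g"
  have hol: "schwarz (cx 0) R (circ 0 R g) holomorphic_on ball (cx 0) R"
    by (rule holomorphic_schwarz_circ[OF assms])
  note har = harmonic_Re[OF hol is_Re_on_dirichlet_fun]
  have cu: "continuous_on (cball 0 R) ?u" by (rule continuous_on_dirichlet_fun[OF assms])
  show sol: "dirichlet_solution R g ?u"
    using har(1,3) cu by (simp add: dirichlet_solution_def dirichlet_fun_sphere)
  show "Cinf_plane (ball 0 R) ?u" by (rule har(2))
  show "analytic_plane (ball 0 R) ?u" by (rule har(4))
  show "\<forall>v. dirichlet_solution R g v \<longrightarrow> (\<forall>p\<in>cball 0 R. v p = ?u p)"
  proof (intro allI impI ballI)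
    fix v and p :: "real \<times> real" assume v: "dirichlet_solution R g v" and p: "p \<in> cball 0 R"
    have v': "Ck_plane 2 (ball 0 R) v" "continuous_on (cball 0 R) v"
        "\<And>q. q \<in> ball 0 R \<Longrightarrow> laplacian v q = 0" "\<And>q. q \<in> sphere 0 R \<Longrightarrow> v q = ?u q"
      using v dirichlet_fun_sphere[of _ 0 R g] unfolding dirichlet_solution_def by simp_all
    show "v p = ?u p" by (rule harmonic_unique[OF v'(1-3) har(1) cu har(3) v'(4) p])
  qed
  show "\<forall>r x y \<alpha>1 \<alpha>2. 0 \<le> r \<and> r < R \<and> (x, y) \<in> cball 0 r \<longrightarrow>
      \<bar>Dpart \<alpha>1 \<alpha>2 ?u (x, y)\<bar>
        \<le> Dpart \<alpha>1 \<alpha>2 (\<lambda>_. -1 / (2 * pi * R) * circle_integral 0 R (\<lambda>q. \<bar>g q\<bar>)) (x, y)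
          + fact (\<alpha>1 + \<alpha>2) / (pi * (R - r) ^ (\<alpha>1 + \<alpha>2 + 1)) * circle_integral 0 R (\<lambda>q. \<bar>g q\<bar>)"
    by (intro allI impI Dpart_dirichlet_fun_le[OF assms]) auto
  show "\<forall>x0 \<kappa> h L. x0 \<in> ball 0 R \<and> L = R - norm x0 \<and> 0 < \<kappa> \<and> \<kappa> < 1/3 \<and> norm h < \<kappa> * L \<longrightarrow>
      taylor_term ?u x0 h sums ?u (x0 + h) \<and>
      (\<forall>n\<ge>1. \<bar>?u (x0 + h) - (\<Sum>k<n. taylor_term ?u x0 h k)\<bar>
        \<le> (2 * \<kappa> / (1 - \<kappa>)) ^ n * (1 / (pi * (L - \<kappa> * L))) * circle_integral x0 L (\<lambda>q. \<bar>?u q\<bar>))"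
  proof (intro allI impI)
    fix x0 h :: "real \<times> real" and \<kappa> L :: real
    assume "x0 \<in> ball 0 R \<and> L = R - norm x0 \<and> 0 < \<kappa> \<and> \<kappa> < 1/3 \<and> norm h < \<kappa> * L"
    then have x0: "norm x0 < R" and L: "L = R - norm x0" and \<kappa>: "0 < \<kappa>" "\<kappa> < 1" "norm h < \<kappa> * L" by auto
    have L0: "L > 0" using x0 L by simp
    have sub: "ball (cx x0) L \<subseteq> ball (cx 0) R"
      by (rule ball_subset_ball_iff[THEN iffD2]) (simp add: L dist_norm)
    \<comment> \<open>The closed disc reaches the circle of radius \<open>R\<close>, where only
      continuity of the solution is known; \<open>taylor_harmonic\<close> asks for no more
      there.\<close>
    have subc: "cball x0 L \<subseteq> cball 0 R"
      by (rule cball_subset_cball_iff[THEN iffD2]) (simp add: L dist_norm)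
    have re: "is_Re_on (ball (cx x0) L) ?u (schwarz (cx 0) R (circ 0 R g))"
      using is_Re_on_dirichlet_fun[of 0 R g] sub unfolding is_Re_on_def by blast
    note h = harmonic_Re[OF holomorphic_on_subset[OF hol sub] re]
    note t = taylor_harmonic[OF L0 h(1) continuous_on_subset[OF cu subc] h(3) \<kappa>]
    show "taylor_term ?u x0 h sums ?u (x0 + h) \<and>
      (\<forall>n\<ge>1. \<bar>?u (x0 + h) - (\<Sum>k<n. taylor_term ?u x0 h k)\<bar>
        \<le> (2 * \<kappa> / (1 - \<kappa>)) ^ n * (1 / (pi * (L - \<kappa> * L))) * circle_integral x0 L (\<lambda>q. \<bar>?u q\<bar>))"
      using t by blast
  qed
  \<comment> \<open>Jackson's bounds are given for \<open>n \<ge> 2\<close>; an integer that is at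
    least e qualifies because e \<ge> 1 + 1.\<close>
  have two: "n \<ge> 2" if "real n \<ge> exp 1" for n
    using that exp_ge_add_one_self[of 1] by linarith
  have cf: "continuous_on A (bdry_fun R g)" for A
    unfolding circ_0_eq_bdry_fun[symmetric] by (intro continuous_on_circ assms) (use assms(1) in simp)
  have per: "two_pi_periodic (bdry_fun R g)" by (simp add: two_pi_periodic_def bdry_fun_periodic)
  show "\<forall>\<alpha> f. 0 < \<alpha> \<and> \<alpha> \<le> 1 \<and> holder_on \<alpha> (sphere 0 R) g \<and> f = bdry_fun R g \<longrightarrow>
      holder_on \<alpha> {-pi..pi} f \<and>
      holder_seminorm \<alpha> {-pi..pi} f \<le> R powr \<alpha> * holder_seminorm \<alpha> (sphere 0 R) g \<and>
      uniform_limit (cball 0 R) (approx_poly R f) ?u sequentially \<and>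
      (\<forall>\<gamma>0. jackson_const_0 \<gamma>0 \<longrightarrow>
        (\<forall>n x y. real n \<ge> exp (1 / \<alpha>) \<and> (x, y) \<in> cball 0 R \<longrightarrow>
          \<bar>?u (x, y) - approx_poly R f n (x, y)\<bar>
            \<le> 2 * \<gamma>0 * (2 * pi) powr \<alpha> * holder_seminorm \<alpha> {-pi..pi} f
               * (sqrt (x\<^sup>2 + y\<^sup>2) / R) ^ (n + 1) * ln (real n) * (1 / real n) powr \<alpha>)) \<and>
      (\<forall>k\<ge>1. f \<in> Ck_interval k \<and> holder_on \<alpha> {-pi..pi} (ext_deriv k f) \<longrightarrow>
        (\<forall>\<gamma>. jackson_const (Ck_interval k) k \<gamma> \<longrightarrow>
          (\<forall>n x y. real n \<ge> exp 1 \<and> (x, y) \<in> cball 0 R \<longrightarrow>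
            \<bar>?u (x, y) - approx_poly R f n (x, y)\<bar>
              \<le> 2 * \<gamma> * (2 * pi) powr \<alpha> * holder_seminorm \<alpha> {-pi..pi} (ext_deriv k f)
                 * (sqrt (x\<^sup>2 + y\<^sup>2) / R) ^ (n + 1) * ln (real n) * (1 / real n) powr (real k + \<alpha>))) \<and>
        (\<forall>\<gamma>. f \<in> Ck_line k \<and> jackson_const (Ck_line k) k \<gamma> \<longrightarrow>
          (\<forall>n x y. real n \<ge> exp 1 \<and> (x, y) \<in> cball 0 R \<longrightarrow>
            \<bar>?u (x, y) - approx_poly R f n (x, y)\<bar>
              \<le> 2 * \<gamma> * (2 * pi) powr \<alpha> * holder_seminorm \<alpha> {-pi..pi} (ext_deriv k f)
                 * (sqrt (x\<^sup>2 + y\<^sup>2) / R) ^ (n + 1) * ln (real n) * (1 / real n) powr (real k + \<alpha>))))"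
  proof (intro allI impI)
    fix \<alpha> f
    assume "0 < \<alpha> \<and> \<alpha> \<le> 1 \<and> holder_on \<alpha> (sphere 0 R) g \<and> f = bdry_fun R g"
    then have \<alpha>: "0 < \<alpha>" "\<alpha> \<le> 1" and hg: "holder_on \<alpha> (sphere 0 R) g" and f: "f = bdry_fun R g" by auto
    have le: "\<bar>f s - f t\<bar> \<le> (R powr \<alpha> * holder_seminorm \<alpha> (sphere 0 R) g) * norm (s - t) powr \<alpha>" for s t
      using holder_bdry_fun[OF assms(1) hg \<alpha>(1)] by (simp add: f)
    note hf = holder_onI[of "{-pi..pi}" f, OF cf[folded f] le]
    have zero_pi: "0 \<in> {-pi..pi}" "pi \<in> {-pi..pi}" "0 \<noteq> pi" by auto
    \<comment> \<open>Proved for an arbitrary function class so that both readings of Jackson's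
      constant are instances.\<close>
    have iv: "\<bar>?u (x, y) - approx_poly R f n (x, y)\<bar>
              \<le> 2 * \<gamma> * (2 * pi) powr \<alpha> * holder_seminorm \<alpha> {-pi..pi} (ext_deriv k f)
                 * (sqrt (x\<^sup>2 + y\<^sup>2) / R) ^ (n + 1) * ln (real n) * (1 / real n) powr (real k + \<alpha>)"
      if "f \<in> \<F>" "holder_on \<alpha> {-pi..pi} (ext_deriv k f)" "jackson_const \<F> k \<gamma>"
        "real n \<ge> exp 1" "(x, y) \<in> cball 0 R" for \<F> k \<gamma> n x y
      unfolding f
    proof (rule approx_poly_rate[OF assms that(2)[unfolded f] \<alpha>(1) two[OF that(4)] _ that(5)])
      fix \<theta> assume "\<theta> \<in> {-pi..pi}"
      then show "\<bar>bdry_fun R g \<theta> - fourier_sum (bdry_fun R g) n \<theta>\<bar>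
          \<le> \<gamma> / real n ^ k * ln (real n) * modulus_cont (ext_deriv k (bdry_fun R g)) (2 * pi / real n)"
        using that(1,3) per two[OF that(4)] unfolding jackson_const_def f by blast
    qed
    have iii: "\<bar>?u (x, y) - approx_poly R f n (x, y)\<bar>
            \<le> 2 * \<gamma>0 * (2 * pi) powr \<alpha> * holder_seminorm \<alpha> {-pi..pi} f
               * (sqrt (x\<^sup>2 + y\<^sup>2) / R) ^ (n + 1) * ln (real n) * (1 / real n) powr \<alpha>"
      if "jackson_const_0 \<gamma>0" "real n \<ge> exp (1 / \<alpha>)" "(x, y) \<in> cball 0 R" for \<gamma>0 n x y
    proof -
      \<comment> \<open>As \<alpha> \<le> 1, the threshold e^(1/\<alpha>) is at least e.\<close>
      have "exp 1 \<le> exp (1 / \<alpha>)" using \<alpha> by simp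
      then have n: "n \<ge> 2" using that(2) by (intro two) linarith
      \<comment> \<open>Division by the zeroth power casts Jackson's first bound in the form of the
        second, so the rate lemma applies with \<open>k = 0\<close> and \<psi> = f.\<close>
      have "\<bar>bdry_fun R g \<theta> - fourier_sum (bdry_fun R g) n \<theta>\<bar>
          \<le> \<gamma>0 / real n ^ 0 * ln (real n) * modulus_cont (bdry_fun R g) (2 * pi / real n)"
        if "\<theta> \<in> {-pi..pi}" for \<theta>
        using \<open>jackson_const_0 \<gamma>0\<close> per cf[of "{-pi..pi}"] n that unfolding jackson_const_0_def by simp
      from approx_poly_rate[OF assms hf(1)[unfolded f] \<alpha>(1) n this \<open>(x, y) \<in> cball 0 R\<close>]
      show ?thesis by (simp add: f)
    qed
    show "holder_on \<alpha> {-pi..pi} f \<and>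
      holder_seminorm \<alpha> {-pi..pi} f \<le> R powr \<alpha> * holder_seminorm \<alpha> (sphere 0 R) g \<and>
      uniform_limit (cball 0 R) (approx_poly R f) ?u sequentially \<and>
      (\<forall>\<gamma>0. jackson_const_0 \<gamma>0 \<longrightarrow>
        (\<forall>n x y. real n \<ge> exp (1 / \<alpha>) \<and> (x, y) \<in> cball 0 R \<longrightarrow>
          \<bar>?u (x, y) - approx_poly R f n (x, y)\<bar>
            \<le> 2 * \<gamma>0 * (2 * pi) powr \<alpha> * holder_seminorm \<alpha> {-pi..pi} f
               * (sqrt (x\<^sup>2 + y\<^sup>2) / R) ^ (n + 1) * ln (real n) * (1 / real n) powr \<alpha>)) \<and>
      (\<forall>k\<ge>1. f \<in> Ck_interval k \<and> holder_on \<alpha> {-pi..pi} (ext_deriv k f) \<longrightarrow>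
        (\<forall>\<gamma>. jackson_const (Ck_interval k) k \<gamma> \<longrightarrow>
          (\<forall>n x y. real n \<ge> exp 1 \<and> (x, y) \<in> cball 0 R \<longrightarrow>
            \<bar>?u (x, y) - approx_poly R f n (x, y)\<bar>
              \<le> 2 * \<gamma> * (2 * pi) powr \<alpha> * holder_seminorm \<alpha> {-pi..pi} (ext_deriv k f)
                 * (sqrt (x\<^sup>2 + y\<^sup>2) / R) ^ (n + 1) * ln (real n) * (1 / real n) powr (real k + \<alpha>))) \<and>
        (\<forall>\<gamma>. f \<in> Ck_line k \<and> jackson_const (Ck_line k) k \<gamma> \<longrightarrow>
          (\<forall>n x y. real n \<ge> exp 1 \<and> (x, y) \<in> cball 0 R \<longrightarrow>
            \<bar>?u (x, y) - approx_poly R f n (x, y)\<bar>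
              \<le> 2 * \<gamma> * (2 * pi) powr \<alpha> * holder_seminorm \<alpha> {-pi..pi} (ext_deriv k f)
                 * (sqrt (x\<^sup>2 + y\<^sup>2) / R) ^ (n + 1) * ln (real n) * (1 / real n) powr (real k + \<alpha>))))"
    proof (intro conjI allI impI)
      show "holder_on \<alpha> {-pi..pi} f" by (rule hf(1))
      show "holder_seminorm \<alpha> {-pi..pi} f \<le> R powr \<alpha> * holder_seminorm \<alpha> (sphere 0 R) g"
        by (rule hf(2)[OF zero_pi])
      show "uniform_limit (cball 0 R) (approx_poly R f) ?u sequentially"
        unfolding f by (rule uniform_limit_approx_poly[OF assms(1) hg \<alpha>(1)])
    qed (elim conjE, ((rule iii; assumption) | (rule iv, assumption+)))+
  qed
qed

end
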